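(* Let $\alpha\in[0,2)\setminus\{1\}$, $\mu\le\mu(\alpha):=\frac{(1-\alpha)^2}{4}$ and $T_\alpha:=\frac{4}{2-\alpha}$. If $T>T_\alpha$, then the system $$\begin{cases}u_{tt}-(x^\alpha u_x)_x-\frac{\mu}{x^{2-\alpha}}u=0,&(t,x)\in(0,T)\times(0,1),\\ u(t,0)=0\ \text{ if }0\le\alpha<1,\qquad(x^\alpha u_x)(t,0)=0\ \text{ if }1<\alpha<2,&t\in(0,T),\\ u(t,1)=0,&t\in(0,T),\\ u(0,x)=u_0(x),\quad u_t(0,x)=u_1(x),&x\in(0,1)\end{cases}$$ is observable in time $T$: there exists a constant $C>0$ such that for every $(u_0,u_1)\in H^{1,\mu}_{\alpha,0}(0,1)\times L^2(0,1)$ the mild solution $u$ satisfies $$\int_0^Tu_x^2(t,1)\,dt\ge C\,E_u(0),$$ where $E_u(t)=\frac12\int_0^1\big\{u_t^2(t,x)+x^\alpha u_x^2(t,x)-\frac{\mu}{x^{2-\alpha}}u^2(t,x)\big\}dx$.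
   Context: Function spaces. By the Hardy inequality $\mu(\alpha)\int_0^1 x^{\alpha-2}u^2dx\le\int_0^1x^\alpha u_x^2dx$, the form $a_\mu(u,v)=\int_0^1\big(x^\alpha u_xv_x-\frac{\mu}{x^{2-\alpha}}uv\big)dx$ is nonnegative on $C_c^\infty(0,1)$, and moreover $\int_0^1u^2dx\le\frac{16}{(2-\alpha)^2}a_\mu(u,u)$ there. The space $H^{1,\mu}_{\alpha,0}(0,1)$ is the closure of $C^\infty_c(0,1)$ for the norm $a_\mu(u,u)^{1/2}$; it consists of functions of $L^2(0,1)\cap H^1_{loc}((0,1])$ vanishing at $x=1$ (and at $x=0$ if $\alpha<1$). It is a Hilbert space for the form $a_\mu$ extended by continuity, still written as the integral above; in particular $\int_0^1(x^\alpha u_x^2-\frac{\mu}{x^{2-\alpha}}u^2)dx$ means $a_\mu(u,u)=\|u\|^2_{H^{1,\mu}_{\alpha,0}}$, so that $E_u(t)=\frac12\big[\|u_t(t)\|^2_{L^2(0,1)}+\|u(t)\|^2_{H^{1,\mu}_{\alpha,0}}\big]$. Operator and solutions. $A^\mu_\alpha u=(x^\alpha u_x)_x+\frac{\mu}{x^{2-\alpha}}u$ (distributions on $(0,1)$), with domain $D^\mu_\alpha=\{u\in H^{1,\mu}_{\alpha,0}(0,1)\cap H^2_{loc}((0,1]): A^\mu_\alpha u\in L^2(0,1)\}$. The operator $\mathcal A(u,v)=(v,A^\mu_\alpha u)$ with domain $D^\mu_\alpha\times H^{1,\mu}_{\alpha,0}(0,1)$ generates a $C_0$-semigroup on $\mathcal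 H=H^{1,\mu}_{\alpha,0}(0,1)\times L^2(0,1)$. The mild solution with data $(u_0,u_1)\in\mathcal H$ is given by $(u(t),u_t(t))=e^{t\mathcal A}(u_0,u_1)$, so $u\in C([0,T];H^{1,\mu}_{\alpha,0}(0,1))\cap C^1([0,T];L^2(0,1))$; it is classical if $(u_0,u_1)\in D^\mu_\alpha\times H^{1,\mu}_{\alpha,0}(0,1)$. Trace. For a classical solution $u_x(t,1)$ is well defined since $u(t)\in H^2_{loc}((0,1])$. For a mild solution, $u_x(\cdot,1)\in L^2(0,T)$ is the $L^2(0,T)$-limit of the traces of classical solutions whose data converge to $(u_0,u_1)$ in $\mathcal H$ (well defined and continuous in the data). *)

theory Defs
  imports "HOL-Analysis.Analysis" "HOL-Library.Function_Algebras"
begin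

text \<open>
  Elements of \<open>L\<^sup>2\<close> and of the Sobolev spaces are represented by functions \<open>real \<Rightarrow> real\<close>, and every
  notion below depends only on their class modulo equality almost everywhere on the interval in
  question. Function values outside the interval play no role.
\<close>

instantiation "fun" :: (type, real_vector) real_vector
begin

definition scaleR_fun :: "real \<Rightarrow> ('a \<Rightarrow> 'b) \<Rightarrow> 'a \<Rightarrow> 'b" where
  "scaleR_fun c f = (\<lambda>x. c *\<^sub>R f x)"

instance
  by standard (simp_all add: scaleR_fun_def fun_eq_iff scaleR_add_right scaleR_add_left)

end

subsection \<open>Test functions and weak derivatives on \<open>(0,1)\<close>\<close>

definition test_functions :: "(real \<Rightarrow> real) set" where
  "test_functions = {\<phi>. (\<forall>n x. (deriv ^^ n) \<phi> field_differentiable at x) \<and>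
     compact (closure {x. \<phi> x \<noteq> 0}) \<and> closure {x. \<phi> x \<noteq> 0} \<subseteq> {0<..<1}}"

definition square_integrable :: "real set \<Rightarrow> (real \<Rightarrow> real) set" where
  "square_integrable I =
     {f \<in> borel_measurable (lebesgue_on I). integrable (lebesgue_on I) (\<lambda>x. (f x)\<^sup>2)}"

definition locally_integrable :: "(real \<Rightarrow> real) \<Rightarrow> bool" where
  "locally_integrable f \<longleftrightarrow> (\<forall>a b. 0 < a \<and> b < 1 \<longrightarrow> integrable (lebesgue_on {a..b}) f)"

definition weak_deriv :: "(real \<Rightarrow> real) \<Rightarrow> (real \<Rightarrow> real) \<Rightarrow> bool" where
  "weak_deriv u w \<longleftrightarrow> locally_integrable u \<and> locally_integrable w \<and>
     (\<forall>\<phi>\<in>test_functions.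
        (LINT x|lebesgue_on {0<..<1}. u x * deriv \<phi> x)
        = - (LINT x|lebesgue_on {0<..<1}. w x * \<phi> x))"

text \<open>The local Sobolev spaces on the half-closed interval \<open>(0,1]\<close>.\<close>

definition L2_loc :: "(real \<Rightarrow> real) set" where
  "L2_loc = {u. \<forall>a. 0 < a \<and> a < 1 \<longrightarrow> u \<in> square_integrable {a<..<1}}"

definition H1_loc :: "(real \<Rightarrow> real) set" where
  "H1_loc = {u \<in> L2_loc. \<exists>w\<in>L2_loc. weak_deriv u w}"

definition H2_loc :: "(real \<Rightarrow> real) set" where
  "H2_loc = {u \<in> L2_loc. \<exists>w\<in>H1_loc. weak_deriv u w}"

subsection \<open>The form and its energy space\<close>

definition form_test :: "real \<Rightarrow> real \<Rightarrow> (real \<Rightarrow> real) \<Rightarrow> (real \<Rightarrow> real) \<Rightarrow> real" where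
  "form_test \<alpha> \<mu> \<phi> \<psi> =
     (LINT x|lebesgue_on {0<..<1}.
        x powr \<alpha> * deriv \<phi> x * deriv \<psi> x - \<mu> / x powr (2 - \<alpha>) * \<phi> x * \<psi> x)"

text \<open>
  The completion of the test functions for the form is realised inside \<open>L\<^sup>2(0,1)\<close>, into which it
  embeds because the form dominates the \<open>L\<^sup>2\<close> norm and is closable: its elements are the \<open>L\<^sup>2\<close> limits
  of sequences of test functions that are Cauchy for the form. In the critical case
  \<open>\<mu> = (1 - \<alpha>)\<^sup>2 / 4\<close> the integral defining the form need not exist for such a limit, so the form is
  extended by continuity.
\<close>

definition approximates ::
  "real \<Rightarrow> real \<Rightarrow> (nat \<Rightarrow> real \<Rightarrow> real) \<Rightarrow> (real \<Rightarrow> real) \<Rightarrow> bool" where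
  "approximates \<alpha> \<mu> \<phi> u \<longleftrightarrow>
     (\<forall>n. \<phi> n \<in> test_functions) \<and>
     (\<forall>e>0. \<exists>N. \<forall>m\<ge>N. \<forall>n\<ge>N. form_test \<alpha> \<mu> (\<phi> m - \<phi> n) (\<phi> m - \<phi> n) < e) \<and>
     u \<in> square_integrable {0<..<1} \<and>
     (\<lambda>n. LINT x|lebesgue_on {0<..<1}. (\<phi> n x - u x)\<^sup>2) \<longlonglongrightarrow> 0"

definition energy_space :: "real \<Rightarrow> real \<Rightarrow> (real \<Rightarrow> real) set" where
  "energy_space \<alpha> \<mu> = {u. \<exists>\<phi>. approximates \<alpha> \<mu> \<phi> u}"

definition form :: "real \<Rightarrow> real \<Rightarrow> (real \<Rightarrow> real) \<Rightarrow> (real \<Rightarrow> real) \<Rightarrow> real" where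
  "form \<alpha> \<mu> u v = (THE c. \<exists>\<phi> \<psi>. approximates \<alpha> \<mu> \<phi> u \<and> approximates \<alpha> \<mu> \<psi> v \<and>
     (\<lambda>n. form_test \<alpha> \<mu> (\<phi> n) (\<psi> n)) \<longlonglongrightarrow> c)"

subsection \<open>The operator\<close>

text \<open>\<open>degenerate_op \<alpha> \<mu> u f\<close> says that \<open>(x\<^sup>\<alpha> u\<^sub>x)\<^sub>x + \<mu> u / x\<^bsup>2-\<alpha>\<^esup> = f\<close> as distributions on \<open>(0,1)\<close>.\<close>

definition degenerate_op :: "real \<Rightarrow> real \<Rightarrow> (real \<Rightarrow> real) \<Rightarrow> (real \<Rightarrow> real) \<Rightarrow> bool" where
  "degenerate_op \<alpha> \<mu> u f \<longleftrightarrow>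
     (\<exists>w z. weak_deriv u w \<and> weak_deriv (\<lambda>x. x powr \<alpha> * w x) z \<and>
        (AE x in lebesgue_on {0<..<1}. z x + \<mu> / x powr (2 - \<alpha>) * u x = f x))"

definition op_domain :: "real \<Rightarrow> real \<Rightarrow> (real \<Rightarrow> real) set" where
  "op_domain \<alpha> \<mu> = {u \<in> energy_space \<alpha> \<mu> \<inter> H2_loc.
     \<exists>f\<in>square_integrable {0<..<1}. degenerate_op \<alpha> \<mu> u f}"

subsection \<open>Semigroups\<close>

text \<open>
  Strongly continuous semigroups on a subspace \<open>V\<close> with seminorm \<open>N\<close>, where vectors at distance
  zero are identified; that is, a \<open>C\<^sub>0\<close>-semigroup on the quotient of \<open>V\<close> by the kernel of \<open>N\<close>.
  Linearity and boundedness make \<open>S t\<close> compatible with this identification.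
\<close>

definition C0_semigroup ::
  "'a::real_vector set \<Rightarrow> ('a \<Rightarrow> real) \<Rightarrow> (real \<Rightarrow> 'a \<Rightarrow> 'a) \<Rightarrow> bool" where
  "C0_semigroup V N S \<longleftrightarrow>
     (\<forall>t\<ge>0. \<forall>x\<in>V. S t x \<in> V) \<and>
     (\<forall>t\<ge>0. \<forall>x\<in>V. \<forall>y\<in>V. \<forall>a b.
        N (S t (a *\<^sub>R x + b *\<^sub>R y) - (a *\<^sub>R S t x + b *\<^sub>R S t y)) = 0) \<and>
     (\<forall>t\<ge>0. \<exists>M. \<forall>x\<in>V. N (S t x) \<le> M * N x) \<and>
     (\<forall>x\<in>V. N (S 0 x - x) = 0) \<and>
     (\<forall>s\<ge>0. \<forall>t\<ge>0. \<forall>x\<in>V. N (S (s + t) x - S s (S t x)) = 0) \<and>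
     (\<forall>x\<in>V. ((\<lambda>t. N (S t x - x)) \<longlongrightarrow> 0) (at_right 0))"

definition generator ::
  "'a::real_vector set \<Rightarrow> ('a \<Rightarrow> real) \<Rightarrow> (real \<Rightarrow> 'a \<Rightarrow> 'a) \<Rightarrow> ('a \<times> 'a) set" where
  "generator V N S = {(x, y) \<in> V \<times> V.
     ((\<lambda>h. N ((1 / h) *\<^sub>R (S h x - x) - y)) \<longlongrightarrow> 0) (at_right 0)}"

subsection \<open>The wave equation\<close>

type_synonym state = "(real \<Rightarrow> real) \<times> (real \<Rightarrow> real)"

definition state_space :: "real \<Rightarrow> real \<Rightarrow> state set" where
  "state_space \<alpha> \<mu> = energy_space \<alpha> \<mu> \<times> square_integrable {0<..<1}"

definition energy :: "real \<Rightarrow> real \<Rightarrow> state \<Rightarrow> real" where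
  "energy \<alpha> \<mu> U = 1 / 2 * ((LINT x|lebesgue_on {0<..<1}. (snd U x)\<^sup>2) + form \<alpha> \<mu> (fst U) (fst U))"

definition state_norm :: "real \<Rightarrow> real \<Rightarrow> state \<Rightarrow> real" where
  "state_norm \<alpha> \<mu> U =
     sqrt (form \<alpha> \<mu> (fst U) (fst U) + (LINT x|lebesgue_on {0<..<1}. (snd U x)\<^sup>2))"

definition classical_data :: "real \<Rightarrow> real \<Rightarrow> state set" where
  "classical_data \<alpha> \<mu> = op_domain \<alpha> \<mu> \<times> energy_space \<alpha> \<mu>"

text \<open>The graph of \<open>(u, v) \<mapsto> (v, (x\<^sup>\<alpha> u\<^sub>x)\<^sub>x + \<mu> u / x\<^bsup>2-\<alpha>\<^esup>)\<close>.\<close>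

definition wave_op :: "real \<Rightarrow> real \<Rightarrow> (state \<times> state) set" where
  "wave_op \<alpha> \<mu> = {((u, v), (w, f)). (u, v) \<in> classical_data \<alpha> \<mu> \<and>
     (w, f) \<in> state_space \<alpha> \<mu> \<and>
     (AE x in lebesgue_on {0<..<1}. w x = v x) \<and> degenerate_op \<alpha> \<mu> u f}"

text \<open>\<open>U t = (u(t), u\<^sub>t(t))\<close> is the mild solution with data \<open>U\<^sub>0\<close>.\<close>

definition mild_solution :: "real \<Rightarrow> real \<Rightarrow> state \<Rightarrow> (real \<Rightarrow> state) \<Rightarrow> bool" where
  "mild_solution \<alpha> \<mu> U\<^sub>0 U \<longleftrightarrow> U\<^sub>0 \<in> state_space \<alpha> \<mu> \<and>
     (\<exists>S. C0_semigroup (state_space \<alpha> \<mu>) (state_norm \<alpha> \<mu>) S \<and>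
        generator (state_space \<alpha> \<mu>) (state_norm \<alpha> \<mu>) S = wave_op \<alpha> \<mu> \<and>
        (\<forall>t\<ge>0. U t = S t U\<^sub>0))"

subsection \<open>The boundary trace at \<open>x = 1\<close>\<close>

text \<open>For \<open>u\<close> in \<open>H\<^sup>2\<^sub>l\<^sub>o\<^sub>c((0,1])\<close>: the value at \<open>1\<close> of the continuous representative of \<open>u\<^sub>x\<close>.\<close>

definition normal_trace :: "(real \<Rightarrow> real) \<Rightarrow> real" where
  "normal_trace u = (THE c. \<exists>w. weak_deriv u w \<and> continuous_on {0<..1} w \<and> w 1 = c)"

text \<open>
  \<open>g\<close> is \<open>u\<^sub>x(\<cdot>,1)\<close> in \<open>L\<^sup>2(0,T)\<close> for the mild solution \<open>U\<close>: the limit of the traces of classical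
  solutions \<open>W n\<close> whose data \<open>D n\<close> converge to the data of \<open>U\<close>.
\<close>

definition mild_trace :: "real \<Rightarrow> real \<Rightarrow> real \<Rightarrow> (real \<Rightarrow> state) \<Rightarrow> (real \<Rightarrow> real) \<Rightarrow> bool" where
  "mild_trace \<alpha> \<mu> T U g \<longleftrightarrow> g \<in> square_integrable {0<..<T} \<and>
     (\<exists>D W. (\<forall>n. D n \<in> classical_data \<alpha> \<mu> \<and> mild_solution \<alpha> \<mu> (D n) (W n) \<and>
              (\<lambda>t. normal_trace (fst (W n t))) \<in> square_integrable {0<..<T}) \<and>
        (\<lambda>n. state_norm \<alpha> \<mu> (D n - U 0)) \<longlonglongrightarrow> 0 \<and>
        (\<lambda>n. LINT t|lebesgue_on {0<..<T}. (normal_trace (fst (W n t)) - g t)\<^sup>2) \<longlonglongrightarrow> 0)"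

end

theory Submission
  imports Defs
begin

text \<open>
  Multiply the equation by \<open>x u\<^sub>x + \<alpha>/4 u\<close>. For a classical solution the function
  \<open>\<Phi>(t) = \<integral> u\<^sub>t (x u\<^sub>x + \<alpha>/4 u) dx\<close> satisfies \<open>\<Phi>' = u\<^sub>x(t,1)\<^sup>2 / 2 - (2-\<alpha>)/2 E\<close>, where the energy \<open>E\<close> is
  constant because the wave operator is skew. Hardy's inequality with its ground state yields
  \<open>\<parallel>x u\<^sub>x + \<alpha>/4 u\<parallel>\<^sup>2 \<le> a\<^sub>\<mu>(u,u)\<close>, hence \<open>\<bar>\<Phi>\<bar> \<le> E\<close>, and integration over \<open>(0,T)\<close> gives
  \<open>\<integral> u\<^sub>x(t,1)\<^sup>2 dt \<ge> ((2-\<alpha>) T - 4) E\<close>. Mild solutions follow by density. Differentiating \<open>\<Phi>\<close> along an orbit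
  needs local boundedness of the semigroup, which rests on completeness of the state space.
\<close>

text \<open>The weight \<alpha>/4 balances the two energies: with x u_x + c u the squared norm of
  u_t enters the derivative of \<Phi> with coefficient c - 1/2 and the form with -(c +
  (1-\<alpha>)/2), and both equal -(2-\<alpha>)/4 exactly for c = \<alpha>/4. Moreover x u_x +
  \<alpha>/4 u = p + (2-\<alpha>)/4 u with p = x u_x - (1-\<alpha>)/2 u, the ground-state part of
  u_x times a weight at most 1; the inner product of p and u is so negative that the second summand
  does not increase the norm. The obstacle is x = 0 at critical \<mu>, where x^\<alpha> u_x^2 and
  u^2 / x^(2-\<alpha>) need not be separately integrable and no integral may be split near 0. Hence
  the energy space is described through two square integrable functions, \<open>gd u\<close> and
  \<open>R u\<close>; identities are proved on test functions and extended by density, and the only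
  direct computation with a solution runs on [a,1] with a > 0 before a tends to 0.\<close>

section \<open>Semigroups on complete semi-inner product spaces\<close>

text \<open>
  Vectors are representatives of classes modulo null sets, so a vector of norm zero need not vanish.
\<close>

locale semi_inner =
  fixes V :: "'a::real_vector set" and ip :: "'a \<Rightarrow> 'a \<Rightarrow> real"
  assumes V: "subspace V"
    and ip_add: "\<lbrakk>x \<in> V; y \<in> V; z \<in> V\<rbrakk> \<Longrightarrow> ip (x + y) z = ip x z + ip y z"
    and ip_scale: "\<lbrakk>x \<in> V; z \<in> V\<rbrakk> \<Longrightarrow> ip (c *\<^sub>R x) z = c * ip x z"
    and ip_sym: "\<lbrakk>x \<in> V; y \<in> V\<rbrakk> \<Longrightarrow> ip x y = ip y x"
    and ip_nonneg: "x \<in> V \<Longrightarrow> 0 \<le> ip x x"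
begin

definition N where "N x = sqrt (ip x x)"

lemma V_closed [simp, intro]:
  "\<lbrakk>x \<in> V; y \<in> V\<rbrakk> \<Longrightarrow> x + y \<in> V" "\<lbrakk>x \<in> V; y \<in> V\<rbrakk> \<Longrightarrow> x - y \<in> V"
  "x \<in> V \<Longrightarrow> c *\<^sub>R x \<in> V" "0 \<in> V" "x \<in> V \<Longrightarrow> - x \<in> V"
  using V by (auto simp: subspace_add subspace_diff subspace_scale subspace_0 subspace_neg)

lemma ip_add2: "\<lbrakk>x \<in> V; y \<in> V; z \<in> V\<rbrakk> \<Longrightarrow> ip z (x + y) = ip z x + ip z y"
  by (metis V_closed(1) ip_add ip_sym)

lemma ip_scale2: "\<lbrakk>x \<in> V; z \<in> V\<rbrakk> \<Longrightarrow> ip z (c *\<^sub>R x) = c * ip z x"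
  by (metis V_closed(3) ip_scale ip_sym)

lemma ip_minus: "\<lbrakk>x \<in> V; z \<in> V\<rbrakk> \<Longrightarrow> ip (- x) z = - ip x z"
  using ip_scale[of x z "-1"] by simp

lemma ip_minus2: "\<lbrakk>x \<in> V; z \<in> V\<rbrakk> \<Longrightarrow> ip z (- x) = - ip z x"
  using ip_scale2[of x z "-1"] by simp

lemma ip_diff: "\<lbrakk>x \<in> V; y \<in> V; z \<in> V\<rbrakk> \<Longrightarrow> ip (x - y) z = ip x z - ip y z"
  using ip_add[of x "- y" z] ip_minus[of y z] by simp

lemma ip_diff2: "\<lbrakk>x \<in> V; y \<in> V; z \<in> V\<rbrakk> \<Longrightarrow> ip z (x - y) = ip z x - ip z y"
  using ip_add2[of x "- y" z] ip_minus2[of y z] by simp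

lemma N_nonneg [simp]: "x \<in> V \<Longrightarrow> 0 \<le> N x"
  by (simp add: N_def ip_nonneg)

lemma N_square: "x \<in> V \<Longrightarrow> (N x)\<^sup>2 = ip x x"
  by (simp add: N_def ip_nonneg)

lemma N_scale: "x \<in> V \<Longrightarrow> N (c *\<^sub>R x) = \<bar>c\<bar> * N x"
  by (simp add: N_def ip_scale ip_scale2 real_sqrt_mult mult.assoc[symmetric])

lemma N_minus: "x \<in> V \<Longrightarrow> N (- x) = N x"
  using N_scale[of x "-1"] by simp

lemma N_commute: "\<lbrakk>x \<in> V; y \<in> V\<rbrakk> \<Longrightarrow> N (x - y) = N (y - x)"
  using N_minus[of "x - y"] by simp

lemma N_zero [simp]: "N 0 = 0"
  using N_scale[of 0 0] by simp

lemma ip_Cauchy_Schwarz: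
  assumes x: "x \<in> V" and y: "y \<in> V"
  shows "\<bar>ip x y\<bar> \<le> N x * N y"
proof -
  have quad: "0 \<le> ip x x + 2 * r * ip x y + r\<^sup>2 * ip y y" for r
    using ip_nonneg[of "x + r *\<^sub>R y"] x y
    by (simp add: ip_add ip_add2 ip_scale ip_scale2 ip_sym[OF y x] power2_eq_square algebra_simps)
  have "(ip x y)\<^sup>2 \<le> ip x x * ip y y"
  proof (cases "ip y y = 0")
    case True
    have "ip x y = 0"
    proof (rule ccontr)
      assume "ip x y \<noteq> 0"
      \<comment> \<open>When \<open>ip y y = 0\<close> the quadratic is affine in r; this r gives it
        the value -1, against \<open>quad\<close>.\<close>
      then have "2 * (- (ip x x + 1) / (2 * ip x y)) * ip x y = - (ip x x + 1)"
        by simp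
      with quad[of "- (ip x x + 1) / (2 * ip x y)"] True show False
        by simp
    qed
    then show ?thesis by (simp add: True)
  next
    case False
    then have "ip y y > 0"
      using ip_nonneg[OF y] by simp
    \<comment> \<open>The minimiser of the quadratic.\<close>
    with quad[of "- ip x y / ip y y"] have "0 \<le> ip x x - (ip x y)\<^sup>2 / ip y y"
      by (simp add: power2_eq_square field_simps)
    with \<open>ip y y > 0\<close> show ?thesis
      by (simp add: field_simps)
  qed
  then have "sqrt ((ip x y)\<^sup>2) \<le> sqrt (ip x x * ip y y)"
    by (rule real_sqrt_le_mono)
  then show ?thesis
    by (simp add: N_def real_sqrt_mult)
qed

lemma N_triangle: 
  assumes "x \<in> V" "y \<in> V"
  shows "N (x + y) \<le> N x + N y"
proof (rule power2_le_imp_le)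
  show "(N (x + y))\<^sup>2 \<le> (N x + N y)\<^sup>2"
    using assms ip_Cauchy_Schwarz[OF assms]
    by (simp add: N_square power2_sum ip_add ip_add2 ip_sym[of y x])
qed (use assms in simp)

lemma N_triangle_diff: "\<lbrakk>x \<in> V; y \<in> V; z \<in> V\<rbrakk> \<Longrightarrow> N (x - z) \<le> N (x - y) + N (y - z)"
  using N_triangle[of "x - y" "y - z"] by simp

lemma N_reverse_triangle:
  assumes "x \<in> V" "y \<in> V"
  shows "\<bar>N x - N y\<bar> \<le> N (x - y)"
  using N_triangle[of "x - y" y] N_triangle[of "y - x" x] N_commute[of x y] assms by simp

lemma N_eqI: "\<lbrakk>x \<in> V; y \<in> V; N (x - y) = 0\<rbrakk> \<Longrightarrow> N x = N y"
  using N_reverse_triangle[of x y] by simp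

lemma N_tendsto:
  assumes "\<And>n. X n \<in> V" "x \<in> V" and lim: "((\<lambda>n. N (X n - x)) \<longlongrightarrow> 0) F"
  shows "((\<lambda>n. N (X n)) \<longlongrightarrow> N x) F"
proof (rule LIM_zero_cancel, rule Lim_null_comparison[OF _ lim])
  show "\<forall>\<^sub>F n in F. norm (N (X n) - N x) \<le> N (X n - x)"
    using N_reverse_triangle assms by simp
qed

lemma ip_tendsto:
  assumes X: "\<And>n. X n \<in> V" "x \<in> V" and lim: "((\<lambda>n. N (X n - x)) \<longlongrightarrow> 0) F"
    and Y: "\<And>n. Y n \<in> V" "y \<in> V" and limY: "((\<lambda>n. N (Y n - y)) \<longlongrightarrow> 0) F"
  shows "((\<lambda>n. ip (X n) (Y n)) \<longlongrightarrow> ip x y) F"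
proof (rule LIM_zero_cancel, rule Lim_null_comparison)
  show "\<forall>\<^sub>F n in F. norm (ip (X n) (Y n) - ip x y) \<le> N (X n - x) * N (Y n) + N x * N (Y n - y)"
  proof (rule always_eventually, rule allI)
    fix n
    have "ip (X n) (Y n) - ip x y = ip (X n - x) (Y n) + ip x (Y n - y)"
      using X Y by (simp add: ip_diff ip_diff2)
    then show "norm (ip (X n) (Y n) - ip x y) \<le> N (X n - x) * N (Y n) + N x * N (Y n - y)"
      using ip_Cauchy_Schwarz[of "X n - x" "Y n"] ip_Cauchy_Schwarz[of x "Y n - y"] X Y by simp
  qed
  show "((\<lambda>n. N (X n - x) * N (Y n) + N x * N (Y n - y)) \<longlongrightarrow> 0) F"
    using lim limY N_tendsto[OF Y limY] by (auto intro!: tendsto_eq_intros)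
qed

end

locale semi_hilbert = semi_inner +
  assumes complete: "\<lbrakk>\<And>n. X n \<in> V; \<forall>e>0. \<exists>M. \<forall>m\<ge>M. \<forall>n\<ge>M. N (X m - X n) < e\<rbrakk>
    \<Longrightarrow> \<exists>x\<in>V. (\<lambda>n. N (X n - x)) \<longlonglongrightarrow> 0"
begin

text \<open>The rate matters as much as the limit: the gliding hump below must know how far the
  steps after n can still move the point. The factor 3/2 is the sum of the powers of 1/3.\<close>

lemma geometric_series_converges:
  fixes X :: "nat \<Rightarrow> 'a"
  assumes X: "\<And>n. X n \<in> V" and step: "\<And>n. N (X (Suc n) - X n) \<le> (1/3)^n"
  obtains x where "x \<in> V" "\<And>n. N (x - X n) \<le> 3/2 * (1/3)^n"
proof -
  have geo: "N (X (n + k) - X n) \<le> 3/2 * ((1/3)^n - (1/3)^(n+k))" for n k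
  proof (induction k)
    case (Suc k)
    have "N (X (n + Suc k) - X n) \<le> N (X (Suc (n + k)) - X (n + k)) + N (X (n + k) - X n)"
      using N_triangle_diff[of "X (Suc (n+k))" "X (n+k)" "X n"] X by simp
    also have "\<dots> \<le> (1/3)^(n+k) + 3/2 * ((1/3)^n - (1/3)^(n+k))"
      using add_mono[OF step[of "n+k"] Suc] .
    finally show ?case by (simp add: field_simps)
  qed simp
  have geo': "N (X m - X n) \<le> 3/2 * (1/3)^n" if "n \<le> m" for m n
  proof -
    have "(0::real) \<le> (1/3)^(n + (m - n))" by simp
    then show ?thesis
      using geo[of n "m - n"] that by (simp add: algebra_simps del: zero_le_power)
  qed
  have "\<exists>M. \<forall>m\<ge>M. \<forall>n\<ge>M. N (X m - X n) < e" if "e > 0" for e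
  proof -
    obtain M where M: "(1/3::real)^M < e/3"
      using real_arch_pow_inv[of "e/3" "1/3"] \<open>e > 0\<close> by auto
    have "N (X m - X n) < e" if "M \<le> m" "M \<le> n" for m n
      using N_triangle_diff[of "X m" "X M" "X n"] geo'[OF that(1)] geo'[OF that(2)]
        N_commute[of "X M" "X n"] X M by simp
    then show ?thesis by blast
  qed
  then obtain x where x: "x \<in> V" "(\<lambda>n. N (X n - x)) \<longlonglongrightarrow> 0"
    using complete[of X] X by blast
  have "N (x - X n) \<le> 3/2 * (1/3)^n" for n
  proof (rule field_le_epsilon)
    fix e :: real assume "e > 0"
    with x(2) have "\<forall>\<^sub>F m in sequentially. N (X m - x) < e"
      by (rule order_tendstoD)
    then obtain K where "\<And>m. m \<ge> K \<Longrightarrow> N (X m - x) < e"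
      by (auto simp: eventually_sequentially)
    then obtain m where m: "m \<ge> n" "N (X m - x) < e"
      using max.cobounded1 max.cobounded2 by blast
    show "N (x - X n) \<le> 3/2 * (1/3)^n + e"
      using N_triangle_diff[of x "X m" "X n"] N_commute[of x "X m"] geo'[OF m(1)] m(2) X x(1) by simp
  qed
  with x(1) that show thesis by blast
qed

text \<open>Sokal's form of the gliding hump argument, which avoids Baire's theorem.\<close>

lemma uniform_boundedness:
  fixes T :: "nat \<Rightarrow> 'a \<Rightarrow> 'a"
  assumes T: "\<And>n x. x \<in> V \<Longrightarrow> T n x \<in> V"
    and lin: "\<And>n x y a b. \<lbrakk>x \<in> V; y \<in> V\<rbrakk> \<Longrightarrow>
      N (T n (a *\<^sub>R x + b *\<^sub>R y) - (a *\<^sub>R T n x + b *\<^sub>R T n y)) = 0"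
    and bounded: "\<And>n. \<exists>M. \<forall>x\<in>V. N (T n x) \<le> M * N x"
    and unbounded: "\<And>n. \<exists>x\<in>V. N (T n x) > 4^n * N x"
  shows "\<exists>x\<in>V. \<forall>n. N (T n x) \<ge> 1/4 * (4/3)^n"
proof -
  have "\<exists>M z. (\<forall>x\<in>V. N (T n x) \<le> M * N x) \<and> M \<ge> 4^n \<and> z \<in> V \<and> N (T n z) > 3/4 * M * N z" for n
  proof -
    obtain M where M: "\<forall>x\<in>V. N (T n x) \<le> M * N x"
      using bounded by blast
    obtain x where x: "x \<in> V" "N (T n x) > 4^n * N x"
      using unbounded by blast
    \<comment> \<open>A bound within a factor 4/3 of the best one, found without a supremum: shrink
      an admissible bound by 3/4 until it fails. It must fail because \<open>not_bound\<close>
      excludes every bound up to \<open>4^n\<close>; the last admissible one is kept, and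
      \<open>z\<close> witnesses the failure of the next.\<close>
    define P where "P k \<longleftrightarrow> (\<forall>x\<in>V. N (T n x) \<le> (3/4)^k * M * N x)" for k :: nat
    have not_bound: "\<not> c \<le> 4^n" if "\<forall>x\<in>V. N (T n x) \<le> c * N x" for c
    proof
      assume "c \<le> 4^n"
      then have "c * N x \<le> 4^n * N x"
        using x(1) by (intro mult_right_mono) auto
      moreover have "N (T n x) \<le> c * N x"
        using that x(1) by blast
      ultimately show False
        using x(2) by linarith
    qed
    have "M > 0"
      using not_bound[OF M] zero_less_power[of "4::real" n] by linarith
    obtain k where k: "(3/4::real)^k < 1/M"
      using real_arch_pow_inv[of "1/M" "3/4"] \<open>M > 0\<close> by auto
    have "\<not> P k"
    proof
      assume "P k"
      then have "\<not> (3/4)^k * M \<le> 4^n"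
        unfolding P_def by (rule not_bound)
      moreover have "(3/4)^k * M < 1"
        using k \<open>M > 0\<close> by (simp add: field_simps)
      moreover have "1 \<le> (4::real)^n" by simp
      ultimately show False by linarith
    qed
    moreover have "P 0" using M by (simp add: P_def)
    ultimately have "\<not> (\<forall>j. P j \<longrightarrow> P (Suc j))"
      using nat_induct[of P k] by blast
    then obtain j where j: "P j" "\<not> P (Suc j)"
      by blast
    have "\<forall>x\<in>V. N (T n x) \<le> (3/4)^j * M * N x"
      using j(1) by (simp add: P_def)
    moreover from not_bound[OF this] have "(3/4)^j * M \<ge> 4^n" by simp
    moreover obtain z where "z \<in> V" "N (T n z) > 3/4 * ((3/4)^j * M) * N z"
      using j(2) by (auto simp: P_def not_le mult.assoc)
    ultimately show ?thesis by blast
  qed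
  then obtain M z where M: "\<And>n x. x \<in> V \<Longrightarrow> N (T n x) \<le> M n * N x" "\<And>n. M n \<ge> 4^n"
    and z: "\<And>n. z n \<in> V" "\<And>n. N (T n (z n)) > 3/4 * M n * N (z n)"
    by metis
  have zpos: "N (z n) > 0" for n
  proof (rule ccontr)
    assume "\<not> N (z n) > 0"
    then have "N (z n) = 0"
      using N_nonneg[OF z(1)[of n]] by linarith
    then show False
      using M(1)[OF z(1), of n n] z(2)[of n] by simp
  qed
  \<comment> \<open>Near-extremal vectors, rescaled to the step length of the hump.\<close>
  define y where "y n = ((1/3)^n / N (z n)) *\<^sub>R z n" for n
  have y: "y n \<in> V" "N (y n) = (1/3)^n" for n
  proof -
    show "y n \<in> V" by (simp add: y_def z)
    have "N (y n) = \<bar>(1/3)^n / N (z n)\<bar> * N (z n)"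
      unfolding y_def by (rule N_scale[OF z(1)])
    then show "N (y n) = (1/3)^n" using zpos[of n] by simp
  qed
  have comb: "N (T n (a *\<^sub>R u + b *\<^sub>R v)) = N (a *\<^sub>R T n u + b *\<^sub>R T n v)" if "u \<in> V" "v \<in> V" for n u v a b
    using N_eqI[OF _ _ lin[OF that]] that T by simp
  have Ty: "N (T n (y n)) \<ge> 3/4 * M n * (1/3)^n" for n
  proof -
    have "N (T n (y n)) = N (((1/3)^n / N (z n)) *\<^sub>R T n (z n))"
      using comb[OF z(1) z(1), of n "(1/3)^n / N (z n)" n 0 n] by (simp add: y_def)
    also have "\<dots> = (1/3)^n / N (z n) * N (T n (z n))"
      using N_scale[OF T[OF z(1)[of n]], of "(1/3)^n / N (z n)" n] zpos[of n] by simp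
    also have "\<dots> \<ge> (1/3)^n / N (z n) * (3/4 * M n * N (z n))"
      using z(2)[of n] zpos[of n] by (intro mult_left_mono) auto
    also have "(1/3)^n / N (z n) * (3/4 * M n * N (z n)) = 3/4 * M n * (1/3)^n"
      using zpos[of n] by (simp add: field_simps)
    finally show ?thesis by simp
  qed
  \<comment> \<open>One of x + y n and x - y n has an image at least as long as that of y n, because
    the two images differ by twice it.\<close>
  have "\<exists>w. w \<in> V \<and> N (w - x) = (1/3)^n \<and> N (T n w) \<ge> N (T n (y n))" if "x \<in> V" for x n
  proof -
    have *: "N (T n (x + y n)) = N (T n x + T n (y n))" "N (T n (x - y n)) = N (T n x - T n (y n))"
      using comb[OF \<open>x \<in> V\<close> y(1), of n 1 1 n] comb[OF \<open>x \<in> V\<close> y(1), of n 1 "-1" n] by simp_all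
    have "2 * N (T n (y n)) = N (2 *\<^sub>R T n (y n))"
      using N_scale[OF T[OF y(1)], of 2] by simp
    also have "2 *\<^sub>R T n (y n) = (T n x + T n (y n)) + - (T n x - T n (y n))"
      by (simp add: scaleR_2)
    also have "N \<dots> \<le> N (T n x + T n (y n)) + N (T n x - T n (y n))"
      using N_triangle[of "T n x + T n (y n)" "- (T n x - T n (y n))"] N_minus[of "T n x - T n (y n)"]
        T y \<open>x \<in> V\<close> by simp
    finally have "N (T n (x + y n)) \<ge> N (T n (y n)) \<or> N (T n (x - y n)) \<ge> N (T n (y n))"
      using * by linarith
    moreover have "N ((x + y n) - x) = (1/3)^n" "N ((x - y n) - x) = (1/3)^n"
      using y N_minus[of "y n"] by simp_all
    ultimately show ?thesis using y(1) that V_closed(1,2) by metis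
  qed
  then have "\<forall>x n. \<exists>w. x \<in> V \<longrightarrow> w \<in> V \<and> N (w - x) = (1/3)^n \<and> N (T n w) \<ge> N (T n (y n))"
    by blast
  then obtain w' where "\<forall>x n. x \<in> V \<longrightarrow> w' x n \<in> V \<and> N (w' x n - x) = (1/3)^n \<and> N (T n (w' x n)) \<ge> N (T n (y n))"
    unfolding choice_iff by blast
  then obtain w where w: "\<And>x n. x \<in> V \<Longrightarrow> w n x \<in> V" "\<And>x n. x \<in> V \<Longrightarrow> N (w n x - x) = (1/3)^n"
     "\<And>x n. x \<in> V \<Longrightarrow> N (T n (w n x)) \<ge> N (T n (y n))"
    using that[of "\<lambda>n x. w' x n"] by blast
  \<comment> \<open>Each step of length \<open>(1/3)^n\<close> takes the sign that makes
    \<open>T n\<close> large at the new point.\<close>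
  define X where "X = rec_nat 0 w"
  have Xsimp: "X 0 = 0" "X (Suc n) = w n (X n)" for n by (simp_all add: X_def)
  have X: "X n \<in> V" for n by (induction n) (auto simp: Xsimp w(1))
  obtain x where x: "x \<in> V" "\<And>n. N (x - X n) \<le> 3/2 * (1/3)^n"
    using geometric_series_converges[of X] X w(2)[OF X] by (metis Xsimp(2) order_refl)
  \<comment> \<open>At \<open>X (Suc n)\<close> the image has norm at least 3/4 M n 3^(-n); the
    limit lies within 1/2 3^(-n) of that point and so loses at most 1/2 M n 3^(-n). The remaining
    quarter grows like (4/3)^n since \<open>M n\<close> is at least \<open>4^n\<close>.\<close>
  have "N (T n x) \<ge> 1/4 * (4/3)^n" for n
  proof -
    have "N (T n (x - X (Suc n))) \<le> M n * N (x - X (Suc n))"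
      using x X by (intro M) simp
    also have "\<dots> \<le> M n * (3/2 * (1/3)^Suc n)"
      using M(2)[of n] x(2)[of "Suc n"] by (intro mult_left_mono) (auto intro: order_trans[of _ "4^n"])
    finally have 1: "N (T n (x - X (Suc n))) \<le> 1/2 * M n * (1/3)^n" by simp
    have "N (T n (X (Suc n))) = N (T n x - T n (x - X (Suc n)))"
      using comb[OF x(1) V_closed(2)[OF x(1) X], of n 1 "-1" "Suc n"] by simp
    also have "\<dots> \<le> N (T n x) + N (T n (x - X (Suc n)))"
      using N_triangle[of "T n x" "- T n (x - X (Suc n))"] N_minus[of "T n (x - X (Suc n))"] T x X by simp
    finally have "N (T n x) \<ge> 3/4 * M n * (1/3)^n - 1/2 * M n * (1/3)^n"
      using 1 Ty[of n] w(3)[OF X, of n n] by (simp add: Xsimp)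
    moreover have "M n * (1/3)^n \<ge> 4^n * (1/3)^n"
      using M(2)[of n] by (intro mult_right_mono) auto
    moreover have "(4::real)^n * (1/3)^n = (4/3)^n"
      by (simp add: power_divide)
    ultimately show ?thesis by simp
  qed
  with x(1) show ?thesis by blast
qed

end

section \<open>Orbits and generators of strongly continuous semigroups\<close>

locale semi_hilbert_semigroup = semi_hilbert +
  fixes S :: "real \<Rightarrow> 'a \<Rightarrow> 'a"
  assumes semigroup: "C0_semigroup V N S"
begin

lemma S_closed [simp]: "\<lbrakk>0 \<le> t; x \<in> V\<rbrakk> \<Longrightarrow> S t x \<in> V"
  and S_comb: "\<lbrakk>0 \<le> t; x \<in> V; y \<in> V\<rbrakk> \<Longrightarrow>
    N (S t (a *\<^sub>R x + b *\<^sub>R y) - (a *\<^sub>R S t x + b *\<^sub>R S t y)) = 0"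
  and S_bounded: "0 \<le> t \<Longrightarrow> \<exists>M. \<forall>x\<in>V. N (S t x) \<le> M * N x"
  and S_zero: "x \<in> V \<Longrightarrow> N (S 0 x - x) = 0"
  and S_add: "\<lbrakk>0 \<le> s; 0 \<le> t; x \<in> V\<rbrakk> \<Longrightarrow> N (S (s + t) x - S s (S t x)) = 0"
  and S_continuous: "x \<in> V \<Longrightarrow> ((\<lambda>t. N (S t x - x)) \<longlongrightarrow> 0) (at_right 0)"
  using semigroup unfolding C0_semigroup_def by blast+

text \<open>Each \<open>S t\<close> is bounded, but with a bound that may depend on t. If no common
  bound existed near 0, there would be times t n <= 1/(n+1) at which the bound 4^n is violated, and
  \<open>uniform_boundedness\<close> would supply a single x whose orbit is unbounded along times
  tending to 0, against continuity at 0.\<close>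

lemma bounded_near_zero: "\<exists>\<delta>>0. \<exists>M\<ge>1. \<forall>t\<in>{0..\<delta>}. \<forall>x\<in>V. N (S t x) \<le> M * N x"
proof (rule ccontr)
  assume contr: "\<not> ?thesis"
  have "\<exists>t. t \<in> {0..1 / Suc n} \<and> (\<exists>x\<in>V. N (S t x) > 4^n * N x)" for n
  proof -
    have "\<not> (\<forall>t\<in>{0..1 / real (Suc n)}. \<forall>x\<in>V. N (S t x) \<le> 4^n * N x)"
    proof
      assume "\<forall>t\<in>{0..1 / real (Suc n)}. \<forall>x\<in>V. N (S t x) \<le> 4^n * N x"
      moreover have "1 / real (Suc n) > 0" "(4::real)^n \<ge> 1" by simp_all
      ultimately show False using contr by blast
    qed
    then show ?thesis by (auto simp: not_le)
  qed
  then obtain t where t: "\<And>n. t n \<in> {0..1 / Suc n}" and unb: "\<And>n. \<exists>x\<in>V. N (S (t n) x) > 4^n * N x"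
    by metis
  obtain x where x: "x \<in> V" "\<And>n. N (S (t n) x) \<ge> 1/4 * (4/3)^n"
    using uniform_boundedness[of "\<lambda>n. S (t n)"] t unb S_comb S_bounded S_closed by auto
  have "t \<longlonglongrightarrow> 0"
  proof (rule tendsto_sandwich[of "\<lambda>_. 0" _ _ "\<lambda>n. 1 / Suc n"])
    show "(\<lambda>n. 1 / real (Suc n)) \<longlonglongrightarrow> 0"
      using LIMSEQ_inverse_real_of_nat by (simp add: inverse_eq_divide)
  qed (use t in auto)
  have "\<forall>\<^sub>F s in at_right 0. N (S s x - x) < 1"
    using S_continuous[OF x(1)] by (rule order_tendstoD) simp
  then obtain d where d: "d > 0" "\<And>s. 0 < s \<Longrightarrow> s < d \<Longrightarrow> N (S s x - x) < 1"
    by (auto simp: eventually_at_right_field)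
  have "N (S s x) \<le> N x + 1" if "0 \<le> s" "s < d" for s
  proof -
    have "N (S s x - x) \<le> 1"
      using d(2)[of s] S_zero[OF x(1)] that by (cases "s = 0") auto
    then show ?thesis
      using N_reverse_triangle[OF S_closed[OF \<open>0 \<le> s\<close> x(1)] x(1)] by linarith
  qed
  moreover have "\<forall>\<^sub>F n in sequentially. t n < d"
    using \<open>t \<longlonglongrightarrow> 0\<close> d(1) by (rule order_tendstoD)
  moreover have "(4/3)^n \<le> 4 * (N x + 1)" if "N (S (t n) x) \<le> N x + 1" for n
    using x(2)[of n] that by simp
  moreover have "0 \<le> t n" for n
    using t[of n] by simp
  ultimately have ev: "\<forall>\<^sub>F n in sequentially. (4/3)^n \<le> 4 * (N x + 1)"
    by (auto elim: eventually_mono)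
  obtain k where k: "4 * (N x + 1) < (4/3)^k"
    using real_arch_pow[of "4/3"] by auto
  obtain K where "\<And>n. n \<ge> K \<Longrightarrow> (4/3)^n \<le> 4 * (N x + 1)"
    using ev by (auto simp: eventually_sequentially)
  then obtain n where "n \<ge> k" "(4/3)^n \<le> 4 * (N x + 1)"
    using max.cobounded1 max.cobounded2 by blast
  moreover have "(4/3::real)^k \<le> (4/3)^n"
    using \<open>n \<ge> k\<close> by (intro power_increasing) auto
  ultimately show False using k by linarith
qed

lemma locally_bounded:
  obtains M where "M \<ge> 1" "\<And>t x. \<lbrakk>0 \<le> t; t \<le> T; x \<in> V\<rbrakk> \<Longrightarrow> N (S t x) \<le> M * N x"
proof -
  obtain d M where d: "d > 0" "M \<ge> 1" "\<And>t x. \<lbrakk>0 \<le> t; t \<le> d; x \<in> V\<rbrakk> \<Longrightarrow> N (S t x) \<le> M * N x"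
    using bounded_near_zero by auto
  \<comment> \<open>Peeling off pieces of length d costs a factor \<open>M\<close> each, and what is
    left costs one more.\<close>
  have step: "N (S t x) \<le> M ^ Suc n * N x" if "0 \<le> t" "t \<le> n * d" "x \<in> V" for n t x
    using that
  proof (induction n arbitrary: t)
    case 0
    then show ?case using d by simp
  next
    case (Suc n)
    show ?case
    proof (cases "t \<le> d")
      case True
      have "N (S t x) \<le> M * N x"
        using d(3) True Suc.prems by blast
      also have "\<dots> \<le> M ^ Suc (Suc n) * N x"
        using power_increasing[of 1 "Suc (Suc n)" M] d(2) Suc.prems(3)
        by (intro mult_right_mono) (simp_all del: power_Suc)
      finally show ?thesis .
    next
      case False
      have "N (S t x) = N (S d (S (t - d) x))"
        using S_add[of d "t - d" x] False Suc.prems(1,3) d(1) by (intro N_eqI) simp_all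
      also have "\<dots> \<le> M * N (S (t - d) x)"
        using False Suc.prems(3) d(1) by (intro d(3)) simp_all
      also have "\<dots> \<le> M * (M ^ Suc n * N x)"
        using False Suc.prems d by (intro mult_left_mono Suc.IH) (auto simp: algebra_simps)
      finally show ?thesis by (simp add: mult.assoc)
    qed
  qed
  obtain n where "T < real n * d"
    using d(1) reals_Archimedean3 by blast
  then show thesis
    using one_le_power[OF d(2), of "Suc n"] by (intro that[of "M ^ Suc n"] step) auto
qed

lemma S_diff: "\<lbrakk>0 \<le> t; x \<in> V; y \<in> V\<rbrakk> \<Longrightarrow> N (S t (x - y)) = N (S t x - S t y)"
  using N_eqI[OF _ _ S_comb[of t x y 1 "-1"]] by simp

text \<open>Both one-sided difference quotients factor through \<open>S (min s t)\<close>, which reduces them to time 0.\<close>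

lemma orbit_estimate:
  assumes M: "\<And>t x. \<lbrakk>0 \<le> t; t \<le> T; x \<in> V\<rbrakk> \<Longrightarrow> N (S t x) \<le> M * N x"
    and "0 \<le> r" "r < s" "s \<le> T" "x \<in> V"
  shows "N (S s x - S r x) \<le> M * N (S (s - r) x - x)"
    and "y \<in> V \<Longrightarrow> N ((1 / (s - r)) *\<^sub>R (S s x - S r x) - S r y)
      \<le> M * N ((1 / (s - r)) *\<^sub>R (S (s - r) x - x) - y)"
proof -
  have in_V [simp]: "S (s - r) x \<in> V" "S s x \<in> V" "S r x \<in> V" "S r (S (s - r) x) \<in> V"
    using assms by simp_all
  have add: "N (S s x - S r (S (s - r) x)) = 0"
    using S_add[of r "s - r" x] assms by simp
  have "N (S s x - S r x) \<le> N (S s x - S r (S (s - r) x)) + N (S r (S (s - r) x) - S r x)"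
    using assms by (intro N_triangle_diff) auto
  also have "\<dots> = N (S r (S (s - r) x - x))"
    using add S_diff[of r "S (s - r) x" x] assms by simp
  also have "\<dots> \<le> M * N (S (s - r) x - x)"
    using assms by (intro M) auto
  finally show "N (S s x - S r x) \<le> M * N (S (s - r) x - x)" .
  assume y: "y \<in> V"
  define c where "c = 1 / (s - r)"
  define q where "q = c *\<^sub>R (S (s - r) x - x)"
  have q: "q \<in> V" using assms by (simp add: q_def)
  have Sq: "N (S r q - c *\<^sub>R (S r (S (s - r) x) - S r x)) = 0"
    using S_comb[of r "S (s - r) x" x c "-c"] assms
    by (simp add: q_def scaleR_diff_right)
  have "N (c *\<^sub>R (S s x - S r x) - S r y)
    \<le> N (c *\<^sub>R (S s x - S r x) - c *\<^sub>R (S r (S (s - r) x) - S r x)) +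
      (N (c *\<^sub>R (S r (S (s - r) x) - S r x) - S r q) + N (S r q - S r y))"
    using y q assms by (intro order_trans[OF N_triangle_diff add_left_mono[OF N_triangle_diff]]) auto
  also have "c *\<^sub>R (S s x - S r x) - c *\<^sub>R (S r (S (s - r) x) - S r x) = c *\<^sub>R (S s x - S r (S (s - r) x))"
    by (simp add: algebra_simps)
  also have "N \<dots> = 0"
    using N_scale[of "S s x - S r (S (s - r) x)" c] add by simp
  also have "N (c *\<^sub>R (S r (S (s - r) x) - S r x) - S r q) = 0"
    using Sq N_commute[of "c *\<^sub>R (S r (S (s - r) x) - S r x)" "S r q"] q assms by simp
  also have "N (S r q - S r y) = N (S r (q - y))"
    using S_diff[of r q y] y q assms by simp
  also have "\<dots> \<le> M * N (q - y)"
    using y q assms by (intro M) auto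
  finally show "N ((1 / (s - r)) *\<^sub>R (S s x - S r x) - S r y)
      \<le> M * N ((1 / (s - r)) *\<^sub>R (S (s - r) x - x) - y)"
    by (simp add: c_def q_def)
qed

text \<open>Both one-sided limits at t come from the single right-hand limit at 0, through the
  distance of s and t.\<close>

lemma tendsto_at_right_abs:
  fixes f :: "real \<Rightarrow> real"
  assumes "(f \<longlongrightarrow> 0) (at_right 0)"
  shows "((\<lambda>s. f \<bar>s - t\<bar>) \<longlongrightarrow> 0) (at t within A)"
proof (rule filterlim_compose[OF assms])
  have "((\<lambda>s. \<bar>s - t\<bar>) \<longlongrightarrow> \<bar>t - t\<bar>) (at t within A)"
    by (intro tendsto_intros)
  then show "filterlim (\<lambda>s. \<bar>s - t\<bar>) (at_right 0) (at t within A)"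
    by (auto simp: filterlim_at eventually_at_filter)
qed

lemma orbit_continuous:
  assumes "0 \<le> t" "x \<in> V"
  shows "((\<lambda>s. N (S s x - S t x)) \<longlongrightarrow> 0) (at t within {0..})"
proof -
  obtain M where M: "M \<ge> 1" "\<And>s x. \<lbrakk>0 \<le> s; s \<le> t + 1; x \<in> V\<rbrakk> \<Longrightarrow> N (S s x) \<le> M * N x"
    using locally_bounded[of "t + 1"] by blast
  have lim: "((\<lambda>s. M * N (S \<bar>s - t\<bar> x - x)) \<longlongrightarrow> 0) (at t within {0..})"
    using tendsto_mult_right_zero[OF tendsto_at_right_abs[OF S_continuous[OF assms(2)]]] by blast
  show ?thesis
  proof (rule Lim_null_comparison[OF _ lim])
    have "\<forall>\<^sub>F s in at t within {0..}. s \<in> {0..} \<and> s \<noteq> t \<and> s < t + 1"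
      using order_tendstoD(2)[OF tendsto_ident_at, of t "t + 1" "{0..}"]
      by (auto simp: eventually_at_filter elim: eventually_mono)
    then show "\<forall>\<^sub>F s in at t within {0..}. norm (N (S s x - S t x)) \<le> M * N (S \<bar>s - t\<bar> x - x)"
    proof eventually_elim
      case (elim s)
      then show ?case
        using orbit_estimate(1)[OF M(2), where r=s and s=t and x=x] orbit_estimate(1)[OF M(2), where r=t and s=s and x=x] assms
          N_commute[of "S s x" "S t x"]
        by (cases s t rule: linorder_cases) auto
    qed
  qed
qed

text \<open>For s < t the estimate compares the quotient with \<open>S s y\<close>; replacing it by
  \<open>S t y\<close> costs the term \<open>N (S s y - S t y)\<close>, which tends to 0 by
  continuity of the orbit of y.\<close>

lemma orbit_derivative:
  assumes "0 \<le> t" and gen: "(x, y) \<in> generator V N S"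
  shows "((\<lambda>s. N ((1 / (s - t)) *\<^sub>R (S s x - S t x) - S t y)) \<longlongrightarrow> 0) (at t within {0..})"
proof -
  have x: "x \<in> V" and y: "y \<in> V"
    and quot: "((\<lambda>h. N ((1 / h) *\<^sub>R (S h x - x) - y)) \<longlongrightarrow> 0) (at_right 0)"
    using gen by (auto simp: generator_def)
  obtain M where M: "M \<ge> 1" "\<And>s x. \<lbrakk>0 \<le> s; s \<le> t + 1; x \<in> V\<rbrakk> \<Longrightarrow> N (S s x) \<le> M * N x"
    using locally_bounded[of "t + 1"] by blast
  let ?q = "\<lambda>h. N ((1 / h) *\<^sub>R (S h x - x) - y)"
  have lim: "((\<lambda>s. M * ?q \<bar>s - t\<bar> + N (S s y - S t y)) \<longlongrightarrow> 0) (at t within {0..})"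
    using tendsto_add[OF tendsto_mult_right_zero[OF tendsto_at_right_abs[OF quot], of M] orbit_continuous[OF assms(1) y]]
    by simp
  show ?thesis
  proof (rule Lim_null_comparison[OF _ lim])
    have "\<forall>\<^sub>F s in at t within {0..}. s \<in> {0..} \<and> s \<noteq> t \<and> s < t + 1"
      using order_tendstoD(2)[OF tendsto_ident_at, of t "t + 1" "{0..}"]
      by (auto simp: eventually_at_filter elim: eventually_mono)
    then show "\<forall>\<^sub>F s in at t within {0..}. norm (N ((1 / (s - t)) *\<^sub>R (S s x - S t x) - S t y))
        \<le> M * ?q \<bar>s - t\<bar> + N (S s y - S t y)"
    proof eventually_elim
      case (elim s)
      show ?case
      proof (cases "t < s")
        case True
        then show ?thesis
          using orbit_estimate(2)[OF M(2), where r=t and s=s and x=x and y=y] assms x y elim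
          by (auto intro: add_increasing2)
      next
        case False
        then have "s < t" using elim by simp
        have eq: "(1 / (s - t)) *\<^sub>R (S s x - S t x) = (1 / (t - s)) *\<^sub>R (S t x - S s x)"
        proof -
          have "1 / (s - t) = - (1 / (t - s))"
            by (metis minus_diff_eq minus_divide_right)
          then show ?thesis
            by (metis minus_diff_eq scaleR_minus_left scaleR_minus_right)
        qed
        have "N ((1 / (t - s)) *\<^sub>R (S t x - S s x) - S t y)
          \<le> N ((1 / (t - s)) *\<^sub>R (S t x - S s x) - S s y) + N (S s y - S t y)"
          using elim assms x y by (intro N_triangle_diff) auto
        moreover have "N ((1 / (t - s)) *\<^sub>R (S t x - S s x) - S s y) \<le> M * ?q \<bar>s - t\<bar>"
          using orbit_estimate(2)[OF M(2), where r=s and s=t and x=x and y=y] \<open>s < t\<close> assms x y elim by simp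
        ultimately show ?thesis
          using elim assms x y by (simp add: eq)
      qed
    qed
  qed
qed

text \<open>Invariance of the domain. It makes the wave operator, and with it the trace identity,
  available at every time of a classical orbit.\<close>

lemma generator_orbit:
  assumes "0 \<le> t" and gen: "(x, y) \<in> generator V N S"
  shows "(S t x, S t y) \<in> generator V N S"
proof -
  have x: "x \<in> V" and y: "y \<in> V"
    using gen by (auto simp: generator_def)
  have "filterlim (\<lambda>h. t + h) (at t within {0..}) (at_right 0)"
    unfolding filterlim_at
    using assms(1) by (auto intro!: tendsto_eq_intros simp: eventually_at_filter)
  from filterlim_compose[OF orbit_derivative[OF assms] this]
  have lim: "((\<lambda>h. N ((1 / h) *\<^sub>R (S (t + h) x - S t x) - S t y)) \<longlongrightarrow> 0) (at_right 0)"
    by simp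
  have "\<forall>\<^sub>F h in at_right 0. N ((1 / h) *\<^sub>R (S (t + h) x - S t x) - S t y) = N ((1 / h) *\<^sub>R (S h (S t x) - S t x) - S t y)"
  proof -
    have "\<forall>\<^sub>F h in at_right (0::real). h > 0"
      by (simp add: eventually_at_filter)
    then show ?thesis
    proof eventually_elim
      case (elim h)
      have 0: "N (S (t + h) x - S h (S t x)) = 0"
        using S_add[of h t x] elim assms x by (simp add: add.commute)
      have "((1 / h) *\<^sub>R (S (t + h) x - S t x) - S t y) - ((1 / h) *\<^sub>R (S h (S t x) - S t x) - S t y)
          = (1 / h) *\<^sub>R (S (t + h) x - S h (S t x))"
        by (simp add: algebra_simps)
      then show ?case
        using N_scale[of "S (t + h) x - S h (S t x)" "1/h"] 0 elim assms x y
        by (intro N_eqI) auto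
    qed
  qed
  from Lim_transform_eventually[OF lim this]
  show ?thesis
    using assms x y by (simp add: generator_def)
qed

text \<open>Serves twice: with the inner product of the state space for conservation of energy, and
  with the pairing of velocity and multiplier for \<Phi>. The second is not symmetric, hence the two
  terms of the derivative.\<close>

lemma bilinear_orbit_derivative:
  fixes b :: "'a \<Rightarrow> 'a \<Rightarrow> real"
  assumes add1: "\<And>x y z. \<lbrakk>x \<in> V; y \<in> V; z \<in> V\<rbrakk> \<Longrightarrow> b (x + y) z = b x z + b y z"
    and add2: "\<And>x y z. \<lbrakk>x \<in> V; y \<in> V; z \<in> V\<rbrakk> \<Longrightarrow> b z (x + y) = b z x + b z y"
    and scale1: "\<And>c x z. \<lbrakk>x \<in> V; z \<in> V\<rbrakk> \<Longrightarrow> b (c *\<^sub>R x) z = c * b x z"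
    and scale2: "\<And>c x z. \<lbrakk>x \<in> V; z \<in> V\<rbrakk> \<Longrightarrow> b z (c *\<^sub>R x) = c * b z x"
    and bound: "\<And>x y. \<lbrakk>x \<in> V; y \<in> V\<rbrakk> \<Longrightarrow> \<bar>b x y\<bar> \<le> K * N x * N y"
    and t: "0 \<le> t" and gen: "(x, y) \<in> generator V N S"
  shows "((\<lambda>s. b (S s x) (S s x)) has_real_derivative b (S t y) (S t x) + b (S t x) (S t y)) (at t within {0..})"
proof -
  have x: "x \<in> V" and y: "y \<in> V"
    using gen by (auto simp: generator_def)
  have diff1: "b (p - q) z = b p z - b q z" if "p \<in> V" "q \<in> V" "z \<in> V" for p q z
    using add1[of p "(-1) *\<^sub>R q" z] scale1[of q z "-1"] that by simp
  have diff2: "b z (p - q) = b z p - b z q" if "p \<in> V" "q \<in> V" "z \<in> V" for p q z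
    using add2[of p "(-1) *\<^sub>R q" z] scale2[of q z "-1"] that by simp
  define Q where "Q s = (1 / (s - t)) *\<^sub>R (S s x - S t x)" for s
  have limQ: "((\<lambda>s. N (Q s - S t y)) \<longlongrightarrow> 0) (at t within {0..})"
    unfolding Q_def by (rule orbit_derivative[OF t gen])
  have limS: "((\<lambda>s. N (S s x - S t x)) \<longlongrightarrow> 0) (at t within {0..})"
    by (rule orbit_continuous[OF t x])
  let ?bd = "\<lambda>s. K * N (Q s - S t y) * (N (S s x - S t x) + N (S t x)) + K * N (S t y) * N (S s x - S t x)
      + K * N (S t x) * N (Q s - S t y)"
  have lim: "(?bd \<longlongrightarrow> 0) (at t within {0..})"
    using limQ limS by (auto intro!: tendsto_eq_intros)
  have K: "K * N p * N q \<ge> 0" if "p \<in> V" "q \<in> V" for p q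
    using bound[OF that] by linarith
  show ?thesis
    unfolding has_field_derivative_iff
  proof (rule LIM_zero_cancel, rule Lim_null_comparison[OF _ lim])
    have "\<forall>\<^sub>F s in at t within {0..}. s \<in> {0..} \<and> s \<noteq> t"
      by (auto simp: eventually_at_filter)
    then show "\<forall>\<^sub>F s in at t within {0..}. norm ((b (S s x) (S s x) - b (S t x) (S t x)) / (s - t)
        - (b (S t y) (S t x) + b (S t x) (S t y))) \<le> ?bd s"
    proof eventually_elim
      case (elim s)
      then have [simp]: "S s x \<in> V" "S t x \<in> V" "S t y \<in> V" using x y t by auto
      then have [simp]: "Q s \<in> V" by (simp add: Q_def)
      have "(b (S s x) (S s x) - b (S t x) (S t x)) / (s - t) = b (Q s) (S s x) + b (S t x) (Q s)"
        using elim by (simp add: Q_def scale1 scale2 diff1 diff2 diff_divide_distrib)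
      \<comment> \<open>Bilinear expansion about the limits \<open>S t y\<close> and
        \<open>S t x\<close>: every summand contains a factor that tends to 0.\<close>
      then have eq: "(b (S s x) (S s x) - b (S t x) (S t x)) / (s - t) - (b (S t y) (S t x) + b (S t x) (S t y))
        = b (Q s - S t y) (S s x - S t x) + b (Q s - S t y) (S t x) + b (S t y) (S s x - S t x) + b (S t x) (Q s - S t y)"
        by (simp add: diff1 diff2)
      show ?case
        unfolding eq distrib_left real_norm_def
        by (intro order_trans[OF abs_triangle_ineq] add_mono bound) simp_all
    qed
  qed
qed

end

section \<open>Test functions and the fundamental lemma\<close>

abbreviation L01 :: "real measure" where "L01 \<equiv> lebesgue_on {0<..<1}"

text \<open>Phrased with iterated \<open>deriv\<close> to match
  \<open>test_functions\<close>.\<close>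

definition smooth_on :: "real set \<Rightarrow> (real \<Rightarrow> real) \<Rightarrow> bool" where
  "smooth_on S f \<longleftrightarrow> (\<forall>n. \<forall>x\<in>S. (deriv ^^ n) f field_differentiable at x)"

text \<open>The function algebra generated by \<open>B\<close>. If the derivatives of the generators
  stay inside, the whole algebra is closed under differentiation and
  \<open>smooth_on_coinduct\<close> applies; this replaces a Leibniz formula for higher
  derivatives.\<close>

inductive gen_alg :: "((real \<Rightarrow> real) \<Rightarrow> bool) \<Rightarrow> (real \<Rightarrow> real) \<Rightarrow> bool" for B where
  base: "B f \<Longrightarrow> gen_alg B f"
| const: "gen_alg B (\<lambda>x. c)"
| add: "\<lbrakk>gen_alg B f; gen_alg B g\<rbrakk> \<Longrightarrow> gen_alg B (\<lambda>x. f x + g x)"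
| mult: "\<lbrakk>gen_alg B f; gen_alg B g\<rbrakk> \<Longrightarrow> gen_alg B (\<lambda>x. f x * g x)"

lemma DERIV_transform_open:
  fixes f g :: "real \<Rightarrow> real"
  assumes "open S" "x \<in> S" "\<And>y. y \<in> S \<Longrightarrow> f y = g y" "(f has_field_derivative D) (at x)"
  shows "(g has_field_derivative D) (at x)"
  using has_field_derivative_transform_within_open[OF assms(4,1,2,3)] .

text \<open>Any class \<open>P\<close> closed under derivatives on \<open>S\<close> works as a
  coinduction invariant. Iterated derivatives are matched with members of \<open>P\<close> only on
  the open set \<open>S\<close>, where equality of functions passes to \<open>deriv\<close>.\<close>

lemma smooth_on_coinduct:
  assumes S: "open S" and f: "P f"
    and step: "\<And>f. P f \<Longrightarrow> \<exists>g. P g \<and> (\<forall>x\<in>S. (f has_field_derivative g x) (at x))"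
  shows "smooth_on S f"
proof -
  have iter: "\<exists>g. P g \<and> (\<forall>x\<in>S. (deriv ^^ n) f x = g x)" for n
  proof (induction n)
    case 0
    then show ?case using f by auto
  next
    case (Suc n)
    then obtain g where g: "P g" "\<And>x. x \<in> S \<Longrightarrow> (deriv ^^ n) f x = g x" by blast
    obtain g' where g': "P g'" "\<And>x. x \<in> S \<Longrightarrow> (g has_field_derivative g' x) (at x)"
      using step[OF g(1)] by blast
    have "((deriv ^^ n) f has_field_derivative g' x) (at x)" if "x \<in> S" for x
      using DERIV_transform_open[OF S that _ g'(2)[OF that]] g(2) by simp
    then have "\<forall>x\<in>S. (deriv ^^ Suc n) f x = g' x"
      by (simp add: DERIV_imp_deriv)
    with g'(1) show ?case by blast
  qed
  show ?thesis
    unfolding smooth_on_def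
  proof (intro allI ballI)
    fix n x assume x: "x \<in> S"
    obtain g where g: "P g" "\<And>x. x \<in> S \<Longrightarrow> (deriv ^^ n) f x = g x" using iter by blast
    obtain g' where "(g has_field_derivative g' x) (at x)"
      using step[OF g(1)] x by blast
    then have "((deriv ^^ n) f has_field_derivative g' x) (at x)"
      using DERIV_transform_open[OF S x] g(2) by metis
    then show "(deriv ^^ n) f field_differentiable at x"
      by (auto simp: field_differentiable_def)
  qed
qed

lemma smooth_on_DERIV: "\<lbrakk>smooth_on S f; x \<in> S\<rbrakk> \<Longrightarrow> (f has_field_derivative deriv f x) (at x)"
  unfolding smooth_on_def by (metis DERIV_deriv_iff_field_differentiable funpow_0)

lemma smooth_on_deriv: "smooth_on S f \<Longrightarrow> smooth_on S (deriv f)"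
  unfolding smooth_on_def by (metis funpow_Suc_right o_apply)

lemma gen_alg_DERIV:
  assumes B: "\<And>f. B f \<Longrightarrow> \<exists>g. gen_alg B g \<and> (\<forall>x\<in>S. (f has_field_derivative g x) (at x))"
    and f: "gen_alg B f"
  shows "\<exists>g. gen_alg B g \<and> (\<forall>x\<in>S. (f has_field_derivative g x) (at x))"
  using f
proof induction
  case (base f)
  then show ?case by (rule B)
next
  case (const c)
  show ?case by (rule exI[of _ "\<lambda>x. 0"]) (auto intro: gen_alg.const)
next
  case (add f g)
  then obtain f' g' where "gen_alg B f'" "\<forall>x\<in>S. (f has_field_derivative f' x) (at x)"
    "gen_alg B g'" "\<forall>x\<in>S. (g has_field_derivative g' x) (at x)" by blast
  then show ?case
    by (intro exI[of _ "\<lambda>x. f' x + g' x"]) (auto intro: gen_alg.add DERIV_add)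
next
  case (mult f g)
  then obtain f' g' where "gen_alg B f'" "\<forall>x\<in>S. (f has_field_derivative f' x) (at x)"
    "gen_alg B g'" "\<forall>x\<in>S. (g has_field_derivative g' x) (at x)" by blast
  with mult.hyps show ?case
    by (intro exI[of _ "\<lambda>x. f' x * g x + g' x * f x"]) (auto intro: gen_alg.add gen_alg.mult DERIV_mult)
qed

lemma gen_alg_smooth:
  assumes "open S" "gen_alg B f"
    and "\<And>f. B f \<Longrightarrow> \<exists>g. gen_alg B g \<and> (\<forall>x\<in>S. (f has_field_derivative g x) (at x))"
  shows "smooth_on S f"
proof (rule smooth_on_coinduct[OF assms(1), of "gen_alg B"])
  fix f assume "gen_alg B f"
  then show "\<exists>g. gen_alg B g \<and> (\<forall>x\<in>S. (f has_real_derivative g x) (at x))"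
    by (rule gen_alg_DERIV[of B S, rotated]) (rule assms(3))
qed (rule assms)

lemma smooth_on_gen_alg:
  assumes "open S" "gen_alg (smooth_on S) f"
  shows "smooth_on S f"
proof (rule gen_alg_smooth[OF assms])
  fix f assume "smooth_on S f"
  then show "\<exists>g. gen_alg (smooth_on S) g \<and> (\<forall>x\<in>S. (f has_real_derivative g x) (at x))"
    by (intro exI[of _ "deriv f"] conjI gen_alg.base ballI smooth_on_deriv smooth_on_DERIV)
qed

lemma smooth_on_add: "\<lbrakk>open S; smooth_on S f; smooth_on S g\<rbrakk> \<Longrightarrow> smooth_on S (\<lambda>x. f x + g x)"
  by (rule smooth_on_gen_alg) (simp_all add: gen_alg.add gen_alg.base)

lemma smooth_on_mult: "\<lbrakk>open S; smooth_on S f; smooth_on S g\<rbrakk> \<Longrightarrow> smooth_on S (\<lambda>x. f x * g x)"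
  by (rule smooth_on_gen_alg) (simp_all add: gen_alg.mult gen_alg.base)

lemma smooth_on_const: "open S \<Longrightarrow> smooth_on S (\<lambda>x. c)"
  by (rule smooth_on_gen_alg) (simp_all add: gen_alg.const)

lemma smooth_on_cong:
  assumes S: "open S" and f: "smooth_on S f" and eq: "\<And>x. x \<in> S \<Longrightarrow> f x = g x"
  shows "smooth_on S g"
proof (rule smooth_on_coinduct[OF S, of "\<lambda>h. \<exists>f. smooth_on S f \<and> (\<forall>x\<in>S. f x = h x)"])
  show "\<exists>f. smooth_on S f \<and> (\<forall>x\<in>S. f x = g x)" using f eq by blast
  fix h assume "\<exists>f. smooth_on S f \<and> (\<forall>x\<in>S. f x = h x)"
  then obtain f where f: "smooth_on S f" "\<And>x. x \<in> S \<Longrightarrow> f x = h x" by blast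
  have "(h has_field_derivative deriv f x) (at x)" if "x \<in> S" for x
    by (rule DERIV_transform_open[OF S that f(2) smooth_on_DERIV[OF f(1) that]])
  then show "\<exists>g. (\<exists>f. smooth_on S f \<and> (\<forall>x\<in>S. f x = g x)) \<and> (\<forall>x\<in>S. (h has_field_derivative g x) (at x))"
    using smooth_on_deriv[OF f(1)] by blast
qed

lemma smooth_on_Un: "\<lbrakk>smooth_on S f; smooth_on T f\<rbrakk> \<Longrightarrow> smooth_on (S \<union> T) f"
  by (auto simp: smooth_on_def)

lemma smooth_on_subset: "\<lbrakk>smooth_on S f; T \<subseteq> S\<rbrakk> \<Longrightarrow> smooth_on T f"
  by (auto simp: smooth_on_def)

lemma smooth_on_powr: "smooth_on {0<..} (\<lambda>x. x powr a)"
proof (rule gen_alg_smooth[of _ "\<lambda>f. \<exists>a. f = (\<lambda>x. x powr a)"])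
  fix f :: "real \<Rightarrow> real" assume "\<exists>a. f = (\<lambda>x. x powr a)"
  then obtain a where f: "f = (\<lambda>x. x powr a)" by blast
  have "(f has_field_derivative a * x powr (a - 1)) (at x)" if "x \<in> {0<..}" for x
    unfolding f using that by (auto intro!: derivative_eq_intros)
  moreover have "gen_alg (\<lambda>f. \<exists>a. f = (\<lambda>x. x powr a)) (\<lambda>x. a * x powr (a - 1))"
    by (intro gen_alg.mult gen_alg.const gen_alg.base) blast
  ultimately show "\<exists>g. gen_alg (\<lambda>f. \<exists>a. f = (\<lambda>x. x powr a)) g \<and> (\<forall>x\<in>{0<..}. (f has_field_derivative g x) (at x))"
    by (intro exI[of _ "\<lambda>x. a * x powr (a - 1)"]) blast
qed (auto intro: gen_alg.base)

lemma smooth_on_affine: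
  assumes "smooth_on UNIV f"
  shows "smooth_on UNIV (\<lambda>x. f (c * x + d))"
\<comment> \<open>The free factor a absorbs the c that the chain rule produces at each
  differentiation.\<close>
proof (rule smooth_on_coinduct[of _ "\<lambda>h. \<exists>a f. smooth_on UNIV f \<and> h = (\<lambda>x. a * f (c * x + d))"])
  show "\<exists>a g. smooth_on UNIV g \<and> (\<lambda>x. f (c * x + d)) = (\<lambda>x. a * g (c * x + d))"
    using assms by (intro exI[of _ 1] exI[of _ f]) simp
  fix h assume "\<exists>a f. smooth_on UNIV f \<and> h = (\<lambda>x. a * f (c * x + d))"
  then obtain a f where f: "smooth_on UNIV f" and h: "h = (\<lambda>x. a * f (c * x + d))" by blast
  have "(h has_field_derivative a * c * deriv f (c * x + d)) (at x)" for x
  proof -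
    have "((\<lambda>x. f (c * x + d)) has_field_derivative deriv f (c * x + d) * c) (at x)"
      by (rule DERIV_chain2[where g="\<lambda>x. c * x + d"]) (auto intro!: derivative_eq_intros smooth_on_DERIV[OF f])
    then show ?thesis
      unfolding h by (auto intro!: derivative_eq_intros)
  qed
  then show "\<exists>g. (\<exists>a f. smooth_on UNIV f \<and> g = (\<lambda>x. a * f (c * x + d))) \<and> (\<forall>x\<in>UNIV. (h has_field_derivative g x) (at x))"
    using smooth_on_deriv[OF f] by (intro exI[of _ "\<lambda>x. a * c * deriv f (c * x + d)"]) blast
qed simp

text \<open>The family \<open>x\<^sup>-\<^sup>k exp (-1/x)\<close> is closed under differentiation up to linear combinations.\<close>

definition flat_exp :: "nat \<Rightarrow> real \<Rightarrow> real" where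
  "flat_exp k x = (if x > 0 then (1 / x) ^ k * exp (- (1 / x)) else 0)"

lemma flat_exp_tendsto_0: "(flat_exp k \<longlongrightarrow> 0) (at 0)"
proof (rule filterlim_split_at)
  show "(flat_exp k \<longlongrightarrow> 0) (at_left 0)"
    by (rule tendsto_eventually) (auto simp: flat_exp_def eventually_at_filter)
  have "((\<lambda>x::real. (inverse x) ^ k / exp (inverse x)) \<longlongrightarrow> 0) (at_right 0)"
    by (rule filterlim_compose[OF tendsto_power_div_exp_0 filterlim_inverse_at_top_right])
  then show "(flat_exp k \<longlongrightarrow> 0) (at_right 0)"
    by (rule Lim_transform_eventually) (auto simp: flat_exp_def eventually_at_filter exp_minus field_simps)
qed

lemma flat_exp_DERIV:
  "(flat_exp k has_field_derivative - real k * flat_exp (Suc k) x + flat_exp (k + 2) x) (at x)"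
proof (cases x "0::real" rule: linorder_cases)
  case less
  have "((\<lambda>x. 0) has_field_derivative 0) (at x)" by simp
  then have "(flat_exp k has_field_derivative 0) (at x)"
    by (rule DERIV_transform_open[of "{..<0}", rotated 3]) (use less in \<open>auto simp: flat_exp_def\<close>)
  then show ?thesis using less by (simp add: flat_exp_def)
next
  case equal
  \<comment> \<open>At 0 the difference quotient of \<open>flat_exp k\<close> is
    \<open>flat_exp (Suc k)\<close> itself, whose limit is known.\<close>
  have "((\<lambda>h. (flat_exp k (0 + h) - flat_exp k 0) / h) \<longlongrightarrow> 0) (at 0)"
    by (rule Lim_transform_eventually[OF flat_exp_tendsto_0[of "Suc k"]])
      (auto simp: flat_exp_def eventually_at_filter)
  then show ?thesis
    unfolding equal DERIV_def by (simp add: flat_exp_def)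
next
  case greater
  have "((\<lambda>x. (1 / x) ^ k * exp (- (1 / x))) has_field_derivative
     - real k * ((1 / x) ^ Suc k * exp (- (1 / x))) + (1 / x) ^ (k + 2) * exp (- (1 / x))) (at x)"
  proof (cases k)
    case 0
    show ?thesis using greater unfolding 0
      by (auto intro!: derivative_eq_intros simp: power2_eq_square)
  next
    case (Suc j)
    have inv: "((\<lambda>x. 1 / x) has_field_derivative - ((1 / x) * (1 / x))) (at x)"
      using greater by (auto intro!: derivative_eq_intros simp: power2_eq_square)
    have "((\<lambda>x. exp (- (1 / x))) has_field_derivative exp (- (1 / x)) * ((1 / x) * (1 / x))) (at x)"
      by (rule DERIV_cong[OF DERIV_fun_exp[OF DERIV_minus[OF inv]]]) simp
    from DERIV_mult[OF DERIV_power_Suc[OF inv, of j] this] show ?thesis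
      unfolding Suc by (rule DERIV_cong) (simp add: algebra_simps add_divide_distrib diff_divide_distrib)
  qed
  then have "(flat_exp k has_field_derivative
     - real k * ((1 / x) ^ Suc k * exp (- (1 / x))) + (1 / x) ^ (k + 2) * exp (- (1 / x))) (at x)"
    by (rule DERIV_transform_open[of "{0<..}", rotated 3]) (use greater in \<open>auto simp: flat_exp_def\<close>)
  then show ?thesis using greater by (simp add: flat_exp_def)
qed

lemma flat_exp_smooth: "smooth_on UNIV (flat_exp k)"
proof (rule gen_alg_smooth[of _ "\<lambda>f. \<exists>k. f = flat_exp k"])
  fix f assume "\<exists>k. f = flat_exp k"
  then obtain k where f: "f = flat_exp k" by blast
  have "gen_alg (\<lambda>f. \<exists>k. f = flat_exp k) (\<lambda>x. - real k * flat_exp (Suc k) x + flat_exp (k + 2) x)"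
    by (intro gen_alg.add gen_alg.mult gen_alg.const gen_alg.base) auto
  then show "\<exists>g. gen_alg (\<lambda>f. \<exists>k. f = flat_exp k) g \<and> (\<forall>x\<in>UNIV. (f has_field_derivative g x) (at x))"
    unfolding f using flat_exp_DERIV by blast
qed (auto intro: gen_alg.base)

section \<open>Calculus of test functions\<close>

lemma test_functions_iff:
  "\<phi> \<in> test_functions \<longleftrightarrow> smooth_on UNIV \<phi> \<and> (\<exists>a b. 0 < a \<and> a \<le> b \<and> b < 1 \<and> (\<forall>x. x < a \<or> b < x \<longrightarrow> \<phi> x = 0))"
proof (intro iffI conjI)
  assume \<phi>: "\<phi> \<in> test_functions"
  then show "smooth_on UNIV \<phi>" by (simp add: test_functions_def smooth_on_def)
  let ?K = "closure {x. \<phi> x \<noteq> 0}"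
  have K: "compact ?K" "?K \<subseteq> {0<..<1}" using \<phi> by (auto simp: test_functions_def)
  show "\<exists>a b. 0 < a \<and> a \<le> b \<and> b < 1 \<and> (\<forall>x. x < a \<or> b < x \<longrightarrow> \<phi> x = 0)"
  proof (cases "?K = {}")
    case True
    then have "\<phi> x = 0" for x using closure_subset[of "{x. \<phi> x \<noteq> 0}"] by blast
    then show ?thesis by (intro exI[of _ "1/2"]) auto
  next
    case False
    obtain a where a: "a \<in> ?K" "\<And>x. x \<in> ?K \<Longrightarrow> a \<le> x" using compact_attains_inf[OF K(1) False] by blast
    obtain b where b: "b \<in> ?K" "\<And>x. x \<in> ?K \<Longrightarrow> x \<le> b" using compact_attains_sup[OF K(1) False] by blast
    have "\<phi> x = 0" if "x < a \<or> b < x" for x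
    proof (rule ccontr)
      assume "\<phi> x \<noteq> 0"
      then have "x \<in> ?K" using closure_subset[of "{x. \<phi> x \<noteq> 0}"] by blast
      from a(2)[OF this] b(2)[OF this] that show False by linarith
    qed
    moreover have "0 < a" "b < 1" "a \<le> b" using K(2) a b by auto
    ultimately show ?thesis by blast
  qed
next
  assume "smooth_on UNIV \<phi> \<and> (\<exists>a b. 0 < a \<and> a \<le> b \<and> b < 1 \<and> (\<forall>x. x < a \<or> b < x \<longrightarrow> \<phi> x = 0))"
  then obtain a b where \<phi>: "smooth_on UNIV \<phi>" "0 < a" "b < 1" "\<And>x. x < a \<or> b < x \<Longrightarrow> \<phi> x = 0" by blast
  have sub: "{x. \<phi> x \<noteq> 0} \<subseteq> {a..b}"
  proof
    fix x assume "x \<in> {x. \<phi> x \<noteq> 0}"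
    with \<phi>(4)[of x] show "x \<in> {a..b}" by (cases "x < a"; cases "b < x") auto
  qed
  then have "closure {x. \<phi> x \<noteq> 0} \<subseteq> {a..b}"
    by (intro closure_minimal) auto
  moreover have "compact (closure {x. \<phi> x \<noteq> 0})"
    by (intro compact_closure[THEN iffD2] bounded_subset[OF bounded_closed_interval sub])
  moreover have "{a..b} \<subseteq> {0<..<1}"
    using \<phi>(2,3) by auto
  ultimately show "\<phi> \<in> test_functions"
    using \<phi>(1) by (simp add: test_functions_def smooth_on_def subset_trans)
qed

lemma test_supportE:
  assumes "\<phi> \<in> test_functions"
  obtains a b where "0 < a" "a \<le> b" "b < 1" "\<And>x. x < a \<or> b < x \<Longrightarrow> \<phi> x = 0"
  using assms unfolding test_functions_iff by blast

lemma test_smooth: "\<phi> \<in> test_functions \<Longrightarrow> smooth_on UNIV \<phi>"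
  by (simp add: test_functions_iff)

lemma test_DERIV: "\<phi> \<in> test_functions \<Longrightarrow> (\<phi> has_field_derivative deriv \<phi> x) (at x)"
  using smooth_on_DERIV test_smooth by blast

lemma test_continuous: "\<phi> \<in> test_functions \<Longrightarrow> continuous_on S \<phi>"
  by (meson DERIV_isCont continuous_at_imp_continuous_on test_DERIV)

lemma test_deriv:
  assumes "\<phi> \<in> test_functions" shows "deriv \<phi> \<in> test_functions"
proof -
  obtain a b where ab: "0 < a" "a \<le> b" "b < 1" "\<And>x. x < a \<or> b < x \<Longrightarrow> \<phi> x = 0"
    using test_supportE[OF assms] by metis
  have "deriv \<phi> x = 0" if "x < a \<or> b < x" for x
  proof -
    have "((\<lambda>x. 0) has_field_derivative 0) (at x)" by simp
    then have "(\<phi> has_field_derivative 0) (at x)"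
      by (rule DERIV_transform_open[of "- {a..b}", rotated 3]) (use ab that in \<open>auto simp: open_Compl\<close>)
    then show ?thesis by (rule DERIV_imp_deriv)
  qed
  with ab show ?thesis
    unfolding test_functions_iff using smooth_on_deriv[OF test_smooth[OF assms]] by blast
qed

text \<open>Admits weights that are singular at 0, such as powers of x: near 0 the product is
  identically zero, and the two open sets on which smoothness is clear cover the line.\<close>

lemma test_smooth_mult:
  assumes p: "smooth_on {0<..} p" and "\<phi> \<in> test_functions"
  shows "(\<lambda>x. p x * \<phi> x) \<in> test_functions"
proof -
  obtain a b where ab: "0 < a" "a \<le> b" "b < 1" "\<And>x. x < a \<or> b < x \<Longrightarrow> \<phi> x = 0"
    using test_supportE[OF assms(2)] by metis
  have "smooth_on {0<..} (\<lambda>x. p x * \<phi> x)"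
    by (intro smooth_on_mult p smooth_on_subset[OF test_smooth[OF assms(2)]]) auto
  moreover have "smooth_on {..<a} (\<lambda>x. p x * \<phi> x)"
    by (rule smooth_on_cong[OF _ smooth_on_const[of _ 0]]) (auto simp: ab)
  ultimately have "smooth_on ({0<..} \<union> {..<a}) (\<lambda>x. p x * \<phi> x)"
    by (rule smooth_on_Un)
  moreover have "{0<..} \<union> {..<a} = UNIV" using ab by force
  ultimately show ?thesis
    unfolding test_functions_iff using ab by (intro conjI exI[of _ a] exI[of _ b]) auto
qed

lemma test_mult: "\<lbrakk>\<phi> \<in> test_functions; \<psi> \<in> test_functions\<rbrakk> \<Longrightarrow> (\<lambda>x. \<phi> x * \<psi> x) \<in> test_functions"
  by (intro test_smooth_mult smooth_on_subset[OF test_smooth]) auto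

lemma test_powr_mult: "\<phi> \<in> test_functions \<Longrightarrow> (\<lambda>x. x powr a * \<phi> x) \<in> test_functions"
  by (intro test_smooth_mult smooth_on_powr)

lemma test_scale: "\<phi> \<in> test_functions \<Longrightarrow> (\<lambda>x. c * \<phi> x) \<in> test_functions"
  by (intro test_smooth_mult smooth_on_const) auto

lemma test_add:
  assumes "\<phi> \<in> test_functions" "\<psi> \<in> test_functions"
  shows "(\<lambda>x. \<phi> x + \<psi> x) \<in> test_functions"
proof -
  obtain a b where ab: "0 < a" "a \<le> b" "b < 1" "\<And>x. x < a \<or> b < x \<Longrightarrow> \<phi> x = 0"
    using test_supportE[OF assms(1)] by metis
  obtain c d where cd: "0 < c" "c \<le> d" "d < 1" "\<And>x. x < c \<or> d < x \<Longrightarrow> \<psi> x = 0"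
    using test_supportE[OF assms(2)] by metis
  have "smooth_on UNIV (\<lambda>x. \<phi> x + \<psi> x)"
    using assms by (intro smooth_on_add test_smooth) auto
  moreover have "\<phi> x + \<psi> x = 0" if "x < min a c \<or> max b d < x" for x
    using that ab(4)[of x] cd(4)[of x] by auto
  moreover have "0 < min a c" "min a c \<le> max b d" "max b d < 1" using ab cd by auto
  ultimately show ?thesis unfolding test_functions_iff by blast
qed

lemma test_diff: "\<lbrakk>\<phi> \<in> test_functions; \<psi> \<in> test_functions\<rbrakk> \<Longrightarrow> (\<lambda>x. \<phi> x - \<psi> x) \<in> test_functions"
  using test_add[OF _ test_scale[of \<psi> "-1"], of \<phi>] by simp

lemma integrable_lebesgue_on_support:
  fixes f :: "real \<Rightarrow> real"
  assumes "S \<subseteq> T" "S \<in> sets lebesgue" "T \<in> sets lebesgue" "\<And>x. x \<in> T - S \<Longrightarrow> f x = 0"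
  shows "integrable (lebesgue_on T) f \<longleftrightarrow> integrable (lebesgue_on S) f"
    and "integral\<^sup>L (lebesgue_on T) f = integral\<^sup>L (lebesgue_on S) f"
proof -
  have eq: "(\<lambda>x. if x \<in> T then f x else 0) = (\<lambda>x. if x \<in> S then f x else 0)"
    using assms(1) assms(4) by fastforce
  show "integrable (lebesgue_on T) f \<longleftrightarrow> integrable (lebesgue_on S) f"
    using Lebesgue_Measure.integrable_restrict_UNIV[OF assms(2), of f] Lebesgue_Measure.integrable_restrict_UNIV[OF assms(3), of f] eq by simp
  show "integral\<^sup>L (lebesgue_on T) f = integral\<^sup>L (lebesgue_on S) f"
    using Lebesgue_Measure.integral_restrict_UNIV[OF assms(2), of f]
      Lebesgue_Measure.integral_restrict_UNIV[OF assms(3), of f] eq by simp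
qed

lemma continuous_imp_measurable_lebesgue_on:
  "continuous_on UNIV (f :: real \<Rightarrow> real) \<Longrightarrow> f \<in> borel_measurable (lebesgue_on S)"
  by (intro measurable_restrict_space1 measurable_completion)
    (simp add: borel_measurable_continuous_onI)

lemma integrable_mult_continuous:
  fixes u \<phi> :: "real \<Rightarrow> real"
  assumes u: "integrable (lebesgue_on {a..b}) u" and \<phi>: "continuous_on {a..b} \<phi>"
  shows "integrable (lebesgue_on {a..b}) (\<lambda>x. u x * \<phi> x)"
proof -
  have "bounded (\<phi> ` {a..b})"
    using \<phi> by (intro compact_imp_bounded compact_continuous_image) auto
  then obtain C where C: "\<And>x. x \<in> {a..b} \<Longrightarrow> \<bar>\<phi> x\<bar> \<le> C"
    by (force simp: bounded_iff)
  have meas: "\<phi> \<in> borel_measurable (lebesgue_on {a..b})"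
    using \<phi> by (intro continuous_imp_measurable_on_sets_lebesgue) auto
  show ?thesis
  proof (rule Bochner_Integration.integrable_bound[of _ "\<lambda>x. C * u x"])
    show "integrable (lebesgue_on {a..b}) (\<lambda>x. C * u x)" using u by simp
    show "(\<lambda>x. u x * \<phi> x) \<in> borel_measurable (lebesgue_on {a..b})"
      using u meas by measurable
    have "norm (u x * \<phi> x) \<le> norm (C * u x)" if "x \<in> {a..b}" for x
    proof -
      have "\<bar>u x\<bar> * \<bar>\<phi> x\<bar> \<le> \<bar>u x\<bar> * \<bar>C\<bar>"
        using C[OF that] by (intro mult_left_mono) auto
      then show ?thesis by (simp add: abs_mult mult.commute)
    qed
    then show "AE x in lebesgue_on {a..b}. norm (u x * \<phi> x) \<le> norm (C * u x)"
      by (intro AE_I2) auto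
  qed
qed

lemma test_mult_integral:
  assumes u: "locally_integrable u" and \<phi>: "\<phi> \<in> test_functions"
  shows "integrable L01 (\<lambda>x. u x * \<phi> x)"
proof -
  obtain a b where ab: "0 < a" "a \<le> b" "b < 1" "\<And>x. x < a \<or> b < x \<Longrightarrow> \<phi> x = 0"
    using test_supportE[OF \<phi>] by metis
  have "integrable (lebesgue_on {a..b}) (\<lambda>x. u x * \<phi> x)"
    using u ab by (intro integrable_mult_continuous test_continuous[OF \<phi>]) (auto simp: locally_integrable_def)
  then show ?thesis
    using ab by (subst integrable_lebesgue_on_support(1)[of "{a..b}"]) auto
qed

lemma locally_integrable_continuous:
  assumes "continuous_on {0<..<1} f" shows "locally_integrable f"
  unfolding locally_integrable_def
proof (intro allI impI)
  fix a b :: real assume "0 < a \<and> b < 1"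
  then have "continuous_on {a..b} f" by (intro continuous_on_subset[OF assms]) auto
  then have "integrable (lebesgue_on {a..b}) (\<lambda>x. 1 * f x)"
    by (intro integrable_mult_continuous) auto
  then show "integrable (lebesgue_on {a..b}) f" by simp
qed

lemma test_integrable: "\<phi> \<in> test_functions \<Longrightarrow> integrable L01 \<phi>"
  using test_mult_integral[OF locally_integrable_continuous[of "\<lambda>x. 1"], of \<phi>] by simp

lemma test_integral_deriv:
  assumes "\<phi> \<in> test_functions"
  shows "(LINT x|L01. deriv \<phi> x) = 0"
proof -
  obtain a b where ab: "0 < a" "a \<le> b" "b < 1" "\<And>x. x < a \<or> b < x \<Longrightarrow> \<phi> x = 0"
    using test_supportE[OF assms] by metis
  obtain c d where cd: "0 < c" "c \<le> d" "d < 1" "\<And>x. x < c \<or> d < x \<Longrightarrow> deriv \<phi> x = 0"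
    using test_supportE[OF test_deriv[OF assms]] by metis
  have ends: "deriv \<phi> x = 0" if "x \<in> {0..1} - {0<..<1}" for x
    using that cd(1-3) by (intro cd(4)) auto
  have "integrable (lebesgue_on {0..1}) (deriv \<phi>)" "(LINT x|L01. deriv \<phi> x) = (LINT x|lebesgue_on {0..1}. deriv \<phi> x)"
    using test_integrable[OF test_deriv[OF assms]]
      integrable_lebesgue_on_support[of "{0<..<1}" "{0..1}" "deriv \<phi>", OF _ _ _ ends]
    by (simp_all add: greaterThanLessThan_subseteq_atLeastAtMost_iff)
  moreover have "(deriv \<phi> has_integral (\<phi> 1 - \<phi> 0)) {0..1}"
    by (intro fundamental_theorem_of_calculus)
      (auto simp: has_real_derivative_iff_has_vector_derivative[symmetric] intro: has_field_derivative_at_within test_DERIV[OF assms])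
  ultimately have "(LINT x|L01. deriv \<phi> x) = \<phi> 1 - \<phi> 0"
    using has_integral_unique[OF has_integral_integral_lebesgue_on[of "{0..1}" "deriv \<phi>"]] by simp
  moreover have "\<phi> 1 = 0" "\<phi> 0 = 0"
    using ab by simp_all
  ultimately show ?thesis by simp
qed

lemma AE_L01_iff_intervals:
  assumes "\<And>a b. \<lbrakk>0 < a; a < b; b < 1\<rbrakk> \<Longrightarrow> AE x in lebesgue. x \<in> {a..b} \<longrightarrow> P x"
  shows "AE x in L01. P x"
proof -
  \<comment> \<open>The shift by 3 keeps the interval nondegenerate for n = 0, as the hypothesis
    demands a < b.\<close>
  have "AE x in lebesgue. \<forall>n. x \<in> {1 / real (n + 3)..1 - 1 / real (n + 3)} \<longrightarrow> P x"
    unfolding AE_all_countable by (intro allI assms) (auto simp: field_simps)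
  moreover have "\<exists>n. x \<in> {1 / real (n + 3)..1 - 1 / real (n + 3)}" if x: "0 < x" "x < 1" for x :: real
  proof -
    obtain n where "inverse (real (Suc n)) < min x (1 - x)"
      using reals_Archimedean[of "min x (1 - x)"] x by auto
    moreover have "1 / real (n + 3) \<le> inverse (real (Suc n))"
      by (simp add: field_simps)
    ultimately show ?thesis by (intro exI[of _ n]) auto
  qed
  ultimately have "AE x in lebesgue. x \<in> {0<..<1} \<longrightarrow> P x"
    by (auto elim!: AE_mp)
  then show ?thesis
    by (subst AE_restrict_space_iff) auto
qed

text \<open>Smooth cut-offs converge boundedly to the indicator of an interval, so h has zero
  integral over every [a,b] inside (0,1); Lebesgue differentiation then gives h = 0 almost
  everywhere.\<close>

theorem fundamental_lemma:
  assumes h: "locally_integrable h"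
    and orth: "\<And>\<phi>. \<phi> \<in> test_functions \<Longrightarrow> (LINT x|L01. h x * \<phi> x) = 0"
  shows "AE x in L01. h x = 0"
proof -
  have int0: "(LINT x|lebesgue_on {a..b}. h x) = 0" if ab: "0 < a" "a < b" "b < 1" for a b
  proof -
    \<comment> \<open>Positive exactly on (a,b). The factor \<open>Suc n\<close> steepens both
      flanks, and on (a,b) the values tend to 1 while staying in [0,1].\<close>
    define \<phi> where "\<phi> n x = flat_exp 0 (real (Suc n) * x + - real (Suc n) * a) * flat_exp 0 (- real (Suc n) * x + real (Suc n) * b)" for n x
    have out: "\<phi> n x = 0" if "x < a \<or> b < x" for n x
    proof -
      have "real (Suc n) * x + - real (Suc n) * a = real (Suc n) * (x - a)" 
        "- real (Suc n) * x + real (Suc n) * b = real (Suc n) * (b - x)" by (simp_all add: algebra_simps)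
      then show ?thesis using that by (auto simp: \<phi>_def flat_exp_def zero_less_mult_iff)
    qed
    have test: "\<phi> n \<in> test_functions" for n
      unfolding test_functions_iff
    proof
      show "smooth_on UNIV (\<phi> n)"
        unfolding \<phi>_def by (intro smooth_on_mult smooth_on_affine flat_exp_smooth) auto
      show "\<exists>a b. 0 < a \<and> a \<le> b \<and> b < 1 \<and> (\<forall>x. x < a \<or> b < x \<longrightarrow> \<phi> n x = 0)"
        using ab out by (intro exI[of _ a] exI[of _ b]) auto
    qed
    have bound: "\<bar>\<phi> n x\<bar> \<le> 1" for n x
    proof -
      have "0 \<le> flat_exp 0 y \<and> flat_exp 0 y \<le> 1" for y by (simp add: flat_exp_def)
      then show ?thesis by (simp add: \<phi>_def abs_mult mult_le_one)
    qed
    have lim: "(\<lambda>n. \<phi> n x) \<longlonglongrightarrow> 1" if x: "a < x" "x < b" for x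
    proof -
      have *: "\<phi> n x = exp (- (inverse (real (Suc n)) * inverse (x - a))) * exp (- (inverse (real (Suc n)) * inverse (b - x)))" for n
      proof -
        have "real (Suc n) * x + - real (Suc n) * a = real (Suc n) * (x - a)" 
          "- real (Suc n) * x + real (Suc n) * b = real (Suc n) * (b - x)" by (simp_all add: algebra_simps)
        moreover have "real (Suc n) * (x - a) > 0" "real (Suc n) * (b - x) > 0" using x by simp_all
        ultimately show ?thesis
          unfolding \<phi>_def flat_exp_def by (simp add: inverse_eq_divide)
      qed
      have "(\<lambda>n. exp (- (inverse (real (Suc n)) * inverse (x - a))) * exp (- (inverse (real (Suc n)) * inverse (b - x))))
        \<longlonglongrightarrow> exp (- (0 * inverse (x - a))) * exp (- (0 * inverse (b - x)))"
        by (intro tendsto_intros LIMSEQ_inverse_real_of_nat)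
      then show ?thesis unfolding * by simp
    qed
    have hint: "integrable (lebesgue_on {a..b}) h"
      using h ab by (auto simp: locally_integrable_def)
    have "(\<lambda>n. LINT x|lebesgue_on {a..b}. h x * \<phi> n x) \<longlonglongrightarrow> (LINT x|lebesgue_on {a..b}. h x)"
    proof (rule integral_dominated_convergence[where w="\<lambda>x. \<bar>h x\<bar>"])
      show "h \<in> borel_measurable (lebesgue_on {a..b})" using hint by auto
      show "integrable (lebesgue_on {a..b}) (\<lambda>x. \<bar>h x\<bar>)" using hint by auto
      show "(\<lambda>x. h x * \<phi> n x) \<in> borel_measurable (lebesgue_on {a..b})" for n
        using hint continuous_imp_measurable_lebesgue_on[OF test_continuous[OF test[of n]], of "{a..b}"]
        by measurable
      show "AE x in lebesgue_on {a..b}. norm (h x * \<phi> n x) \<le> \<bar>h x\<bar>" for n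
        using bound[of n] by (auto simp: abs_mult intro!: AE_I2 mult_left_le)
      have "AE x in lebesgue. x \<in> {a..b} \<longrightarrow> (\<lambda>n. h x * \<phi> n x) \<longlonglongrightarrow> h x"
      proof (rule AE_I')
        show "{a, b} \<in> null_sets lebesgue"
          using null_sets_completionI[OF countable_imp_null_set_lborel[of "{a,b}"]] by simp
        show "{x \<in> space lebesgue. \<not> (x \<in> {a..b} \<longrightarrow> (\<lambda>n. h x * \<phi> n x) \<longlonglongrightarrow> h x)} \<subseteq> {a, b}"
          using tendsto_mult[OF tendsto_const lim] by fastforce
      qed
      then show "AE x in lebesgue_on {a..b}. (\<lambda>n. h x * \<phi> n x) \<longlonglongrightarrow> h x"
        by (subst AE_restrict_space_iff) auto
    qed
    moreover have "(LINT x|lebesgue_on {a..b}. h x * \<phi> n x) = 0" for n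
    proof -
      have "h x * \<phi> n x = 0" if "x \<in> {0<..<1} - {a..b}" for x
      proof -
        have "x < a \<or> b < x" using that by auto
        then show ?thesis by (simp add: out)
      qed
      moreover have "{a..b} \<subseteq> {0<..<1}" using ab by auto
      ultimately have "(LINT x|L01. h x * \<phi> n x) = (LINT x|lebesgue_on {a..b}. h x * \<phi> n x)"
        by (intro integrable_lebesgue_on_support(2)) simp_all
      then show ?thesis using orth[OF test] by simp
    qed
    ultimately show ?thesis
      by (simp add: LIMSEQ_const_iff)
  qed
  show ?thesis
  proof (rule AE_L01_iff_intervals)
    fix a b :: real assume ab: "0 < a" "a < b" "b < 1"
    define f where "f x = (if x \<in> {a..b} then h x else 0)" for x
    have hint: "integrable (lebesgue_on {c..d}) h" if "0 < c" "d < 1" for c d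
      using h that by (auto simp: locally_integrable_def)
    have fint: "integrable lebesgue f"
      unfolding f_def using hint ab by (subst Lebesgue_Measure.integrable_restrict_UNIV) auto
    have box: "integral (cbox c d) f = 0" "f integrable_on cbox c d" for c d
    proof -
      have fint': "integrable (lebesgue_on (cbox c d)) f"
        using integrable_mult_indicator[OF _ fint, of "cbox c d"]
        by (subst integrable_restrict_space) simp_all
      then show "f integrable_on cbox c d"
        by (rule integrable_on_lebesgue_on) auto
      have "integral (cbox c d) f = (LINT x|lebesgue_on (cbox c d). f x)"
        using fint' by (intro lebesgue_integral_eq_integral[symmetric]) auto
      also have "\<dots> = (LINT x|lebesgue_on {max a c..min b d}. f x)"
        by (rule integrable_lebesgue_on_support) (auto simp: f_def)
      also have "\<dots> = (LINT x|lebesgue_on {max a c..min b d}. h x)"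
        by (intro Bochner_Integration.integral_cong) (auto simp: f_def)
      also have "\<dots> = 0"
      proof (cases "max a c < min b d")
        case True
        with ab show ?thesis by (intro int0) auto
      next
        case False
        then have "{max a c..min b d} \<in> null_sets lebesgue"
          by (cases "max a c = min b d") auto
        then have "AE x in lebesgue. x \<in> {max a c..min b d} \<longrightarrow> h x = 0"
          by (auto intro: AE_I')
        then have "AE x in lebesgue_on {max a c..min b d}. h x = 0"
          by (subst AE_restrict_space_iff) auto
        then show ?thesis by (rule integral_eq_zero_AE)
      qed
      finally show "integral (cbox c d) f = 0" .
    qed
    \<comment> \<open>Lebesgue differentiation with one-sided averages over [x, x+h]; by
      \<open>box\<close> all of these averages vanish.\<close>
    obtain N where N: "negligible N" "\<And>x e. \<lbrakk>x \<notin> N; 0 < e\<rbrakk> \<Longrightarrow>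
               \<exists>d>0. \<forall>h. 0 < h \<and> h < d \<longrightarrow>
                         norm(integral (cbox x (x + h *\<^sub>R One)) f /\<^sub>R h ^ DIM(real) - f x) < e"
      using integrable_ccontinuous_explicit[of f] box(2) by blast
    have f0: "f x = 0" if "x \<notin> N" for x
    proof (rule ccontr)
      assume "f x \<noteq> 0"
      then have "\<bar>f x\<bar> > 0" by simp
      from N(2)[OF that this] obtain d where "d > 0" and
        d: "\<And>h. 0 < h \<and> h < d \<Longrightarrow> norm(integral (cbox x (x + h *\<^sub>R One)) f /\<^sub>R h ^ DIM(real) - f x) < \<bar>f x\<bar>"
        by blast
      have "0 < d / 2 \<and> d / 2 < d" using \<open>d > 0\<close> by simp
      from d[OF this] show False unfolding box(1) by simp
    qed
    have sub: "{x \<in> space lebesgue. \<not> (x \<in> {a..b} \<longrightarrow> h x = 0)} \<subseteq> N"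
    proof
      fix x assume "x \<in> {x \<in> space lebesgue. \<not> (x \<in> {a..b} \<longrightarrow> h x = 0)}"
      then have "f x \<noteq> 0" by (simp add: f_def)
      with f0 show "x \<in> N" by blast
    qed
    have "N \<in> null_sets lebesgue"
      using N(1) by (simp add: negligible_iff_null_sets)
    then show "AE x in lebesgue. x \<in> {a..b} \<longrightarrow> h x = 0"
      using sub by (rule AE_I')
  qed
qed

text \<open>Zero mean is what makes the primitive taken from the left vanish again to the right of
  the support.\<close>

lemma test_primitive:
  assumes \<theta>: "\<theta> \<in> test_functions" and zero: "(LINT x|L01. \<theta> x) = 0"
  obtains \<Theta> where "\<Theta> \<in> test_functions" "deriv \<Theta> = \<theta>"
proof -
  obtain a b where ab: "0 < a" "a \<le> b" "b < 1" "\<And>x. x < a \<or> b < x \<Longrightarrow> \<theta> x = 0"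
    using test_supportE[OF \<theta>] by metis
  define \<Theta> where "\<Theta> x = integral {0..x} \<theta>" for x
  have left: "\<Theta> x = 0" if "x < a" for x
  proof -
    have "\<Theta> x = integral {0..x} (\<lambda>x. 0)"
      unfolding \<Theta>_def using that ab by (intro integral_cong) auto
    then show ?thesis by simp
  qed
  have right: "\<Theta> x = 0" if "x \<ge> b" for x
  proof -
    have "integrable (lebesgue_on {0..x}) (\<lambda>x. 1 * \<theta> x)"
      by (intro integrable_mult_continuous test_continuous[OF \<theta>]) auto
    then have "\<Theta> x = (LINT x|lebesgue_on {0..x}. \<theta> x)"
      unfolding \<Theta>_def by (intro lebesgue_integral_eq_integral[symmetric]) auto
    also have "\<dots> = (LINT x|lebesgue_on {a..b}. \<theta> x)"
      using ab that by (intro integrable_lebesgue_on_support) auto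
    also have "\<dots> = (LINT x|L01. \<theta> x)"
      using ab that by (intro integrable_lebesgue_on_support(2)[symmetric]) auto
    finally show ?thesis using zero by simp
  qed
  have deriv: "(\<Theta> has_field_derivative \<theta> x) (at x)" for x
  proof (cases "x < a")
    case True
    have "((\<lambda>x. 0) has_field_derivative 0) (at x)" by simp
    then have "(\<Theta> has_field_derivative 0) (at x)"
      by (rule DERIV_transform_open[of "{..<a}", rotated 3]) (use True left in auto)
    then show ?thesis using ab True by simp
  next
    case False
    then have "0 < x" using ab by simp
    have "(\<Theta> has_real_derivative \<theta> x) (at x within {0..x+1})"
      unfolding \<Theta>_def using \<open>0 < x\<close> by (intro integral_has_real_derivative test_continuous[OF \<theta>]) auto
    then show ?thesis
      using \<open>0 < x\<close> by (simp add: at_within_Icc_at)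
  qed
  have "smooth_on UNIV \<Theta>"
  proof (rule smooth_on_coinduct[of _ "\<lambda>h. h = \<Theta> \<or> smooth_on UNIV h"])
    fix h assume "h = \<Theta> \<or> smooth_on UNIV h"
    then show "\<exists>g. (g = \<Theta> \<or> smooth_on UNIV g) \<and> (\<forall>x\<in>UNIV. (h has_real_derivative g x) (at x))"
      using deriv test_smooth[OF \<theta>] smooth_on_DERIV smooth_on_deriv by blast
  qed auto
  then have "\<Theta> \<in> test_functions"
    unfolding test_functions_iff using left right ab by (intro conjI exI[of _ a] exI[of _ b]) auto
  moreover have "deriv \<Theta> = \<theta>"
    using deriv by (intro ext DERIV_imp_deriv)
  ultimately show thesis by (rule that)
qed

text \<open>A test function minus its mean times a fixed \<eta> of integral 1 is the derivative of a
  test function. Orthogonality to it says that h and the constant c, the integral of h \<eta>, pair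
  alike with every test function.\<close>

theorem du_Bois_Reymond:
  assumes h: "locally_integrable h"
    and orth: "\<And>\<phi>. \<phi> \<in> test_functions \<Longrightarrow> (LINT x|L01. h x * deriv \<phi> x) = 0"
  shows "\<exists>c. AE x in L01. h x = c"
proof -
  \<comment> \<open>A bump of nonzero integral, by contradiction: otherwise
    \<open>fundamental_lemma\<close> would make the constant 1 vanish almost everywhere.\<close>
  have "\<exists>\<eta>\<in>test_functions. (LINT x|L01. \<eta> x) \<noteq> 0"
  proof (rule ccontr)
    assume "\<not> ?thesis"
    then have "AE x in L01. (1::real) = 0"
      by (intro fundamental_lemma locally_integrable_continuous) auto
    then have "AE x in lebesgue. x \<notin> {0<..<1::real}"
      by (subst (asm) AE_restrict_space_iff) auto
    then have "{0<..<1::real} \<in> null_sets lebesgue"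
      by (subst (asm) AE_iff_null_sets[symmetric]) auto
    then show False by (auto simp: null_sets_def)
  qed
  then obtain \<eta>' where \<eta>': "\<eta>' \<in> test_functions" "(LINT x|L01. \<eta>' x) \<noteq> 0" by blast
  define \<eta> where "\<eta> x = (1 / (LINT x|L01. \<eta>' x)) * \<eta>' x" for x
  have \<eta>: "\<eta> \<in> test_functions" "(LINT x|L01. \<eta> x) = 1"
    unfolding \<eta>_def using \<eta>' by (blast intro: test_scale) (simp add: \<eta>'(2))
  define c where "c = (LINT x|L01. h x * \<eta> x)"
  have "AE x in L01. h x - c = 0"
  proof (rule fundamental_lemma)
    show "locally_integrable (\<lambda>x. h x - c)"
      using h by (auto simp: locally_integrable_def)
    fix \<psi> assume \<psi>: "\<psi> \<in> test_functions"
    define m where "m = (LINT x|L01. \<psi> x)"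
    have \<theta>: "(\<lambda>x. \<psi> x - m * \<eta> x) \<in> test_functions"
      using \<psi> \<eta> by (intro test_diff test_scale)
    moreover have "(LINT x|L01. \<psi> x - m * \<eta> x) = 0"
      using test_integrable[OF \<psi>] test_integrable[OF \<eta>(1)] \<eta>(2) by (simp add: m_def)
    ultimately obtain \<Theta> where \<Theta>: "\<Theta> \<in> test_functions" "deriv \<Theta> = (\<lambda>x. \<psi> x - m * \<eta> x)"
      by (rule test_primitive)
    have i1: "integrable L01 (\<lambda>x. h x * \<psi> x)" and i2: "integrable L01 (\<lambda>x. h x * \<eta> x)"
      using h \<psi> \<eta> by (auto intro: test_mult_integral)
    have "0 = (LINT x|L01. h x * (\<psi> x - m * \<eta> x))"
      using orth[OF \<Theta>(1)] \<Theta>(2) by simp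
    also have "\<dots> = (LINT x|L01. h x * \<psi> x - m * (h x * \<eta> x))"
      by (simp add: algebra_simps)
    also have "\<dots> = (LINT x|L01. h x * \<psi> x) - m * c"
      using i1 i2 by (simp add: c_def)
    also have "\<dots> = (LINT x|L01. h x * \<psi> x - c * \<psi> x)"
      using i1 test_integrable[OF \<psi>] by (simp add: m_def)
    also have "\<dots> = (LINT x|L01. (h x - c) * \<psi> x)"
      by (simp add: algebra_simps)
    finally show "(LINT x|L01. (h x - c) * \<psi> x) = 0" by simp
  qed
  then show ?thesis by (auto intro!: exI[of _ c])
qed

section \<open>The space of square integrable functions\<close>

definition L2_ip :: "real set \<Rightarrow> (real \<Rightarrow> real) \<Rightarrow> (real \<Rightarrow> real) \<Rightarrow> real" where
  "L2_ip I f g = (LINT x|lebesgue_on I. f x * g x)"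

lemma square_integrable_measurable:
  "f \<in> square_integrable I \<Longrightarrow> f \<in> borel_measurable (lebesgue_on I)"
  by (simp add: square_integrable_def)

lemma square_integrable_mult:
  assumes "f \<in> square_integrable I" "g \<in> square_integrable I"
  shows "integrable (lebesgue_on I) (\<lambda>x. f x * g x)"
proof (rule Bochner_Integration.integrable_bound[of _ "\<lambda>x. (f x)\<^sup>2 + (g x)\<^sup>2"])
  show "integrable (lebesgue_on I) (\<lambda>x. (f x)\<^sup>2 + (g x)\<^sup>2)"
    using assms by (simp add: square_integrable_def)
  show "(\<lambda>x. f x * g x) \<in> borel_measurable (lebesgue_on I)"
    using assms[THEN square_integrable_measurable] by measurable
  have "\<bar>f x * g x\<bar> \<le> (f x)\<^sup>2 + (g x)\<^sup>2" for x
  proof -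
    have "2 * (\<bar>f x\<bar> * \<bar>g x\<bar>) \<le> (f x)\<^sup>2 + (g x)\<^sup>2"
      using sum_squares_bound[of "\<bar>f x\<bar>" "\<bar>g x\<bar>"] by simp
    moreover have "0 \<le> \<bar>f x\<bar> * \<bar>g x\<bar>" by simp
    ultimately show ?thesis unfolding abs_mult by linarith
  qed
  then show "AE x in lebesgue_on I. norm (f x * g x) \<le> norm ((f x)\<^sup>2 + (g x)\<^sup>2)"
    by (auto intro!: AE_I2 order_trans[OF _ abs_ge_self])
qed

lemma square_integrable_add:
  assumes "f \<in> square_integrable I" "g \<in> square_integrable I"
  shows "(\<lambda>x. f x + g x) \<in> square_integrable I"
proof -
  have "integrable (lebesgue_on I) (\<lambda>x. (f x)\<^sup>2 + 2 * (f x * g x) + (g x)\<^sup>2)"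
    using assms square_integrable_mult[OF assms] by (simp add: square_integrable_def)
  then have "integrable (lebesgue_on I) (\<lambda>x. (f x + g x)\<^sup>2)"
    by (simp add: power2_sum algebra_simps)
  then show ?thesis
    using assms by (auto simp: square_integrable_def)
qed

lemma square_integrable_scale:
  "f \<in> square_integrable I \<Longrightarrow> (\<lambda>x. c * f x) \<in> square_integrable I"
  by (auto simp: square_integrable_def power_mult_distrib)

lemma square_integrable_cong_AE:
  assumes "f \<in> square_integrable I" "g \<in> borel_measurable (lebesgue_on I)" "AE x in lebesgue_on I. f x = g x"
  shows "g \<in> square_integrable I"
proof -
  have "integrable (lebesgue_on I) (\<lambda>x. (f x)\<^sup>2) \<longleftrightarrow> integrable (lebesgue_on I) (\<lambda>x. (g x)\<^sup>2)"
    using assms square_integrable_measurable[OF assms(1)] by (intro integrable_cong_AE) auto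
  then show ?thesis using assms by (simp add: square_integrable_def)
qed

lemma L2_semi_inner: "semi_inner (square_integrable I) (L2_ip I)"
proof
  show "subspace (square_integrable I)"
    using square_integrable_add square_integrable_scale
    by (auto simp: subspace_def plus_fun_def scaleR_fun_def zero_fun_def)
      (simp add: square_integrable_def)
next
  fix f g h assume "f \<in> square_integrable I" "g \<in> square_integrable I" "h \<in> square_integrable I"
  then show "L2_ip I (f + g) h = L2_ip I f h + L2_ip I g h"
    by (simp add: L2_ip_def plus_fun_def distrib_right square_integrable_mult)
qed (simp_all add: L2_ip_def scaleR_fun_def mult_ac)

lemma L2_norm_square: "semi_inner.N (L2_ip I) f = sqrt (LINT x|lebesgue_on I. (f x)\<^sup>2)"
  by (simp add: semi_inner.N_def[OF L2_semi_inner] L2_ip_def power2_eq_square)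

text \<open>Riesz-Fischer for representatives. Finite measure turns square-mean steps into mean
  steps, a subsequence with summable steps converges almost everywhere, and Fatou's lemma moves the
  Cauchy estimate to the limit, so that the full sequence converges in norm.\<close>

lemma L2_complete:
  assumes I: "I \<in> lmeasurable"
    and X: "\<And>n. X n \<in> square_integrable I"
    and Cauchy: "\<forall>e>0. \<exists>M. \<forall>m\<ge>M. \<forall>n\<ge>M. semi_inner.N (L2_ip I) (X m - X n) < e"
  shows "\<exists>F\<in>square_integrable I. (\<lambda>n. semi_inner.N (L2_ip I) (X n - F)) \<longlonglongrightarrow> 0"
proof -
  interpret semi_inner "square_integrable I" "L2_ip I" by (rule L2_semi_inner)
  let ?M = "lebesgue_on I"
  interpret finite_measure ?M using I by (rule finite_measure_lebesgue_on)
  have [measurable]: "X n \<in> borel_measurable ?M" for n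
    using X by (rule square_integrable_measurable)
  obtain K where K: "\<And>k m n. \<lbrakk>m \<ge> K k; n \<ge> K k\<rbrakk> \<Longrightarrow> N (X m - X n) < (1/2)^k"
  proof -
    have "\<forall>k. \<exists>K. \<forall>m\<ge>K. \<forall>n\<ge>K. N (X m - X n) < (1/2)^k"
      using Cauchy by (auto simp: zero_less_power)
    then show thesis using that by (auto simp: choice_iff)
  qed
  \<comment> \<open>Partial sums dominate all earlier thresholds, so r k and r (Suc k) both lie
    beyond \<open>K k\<close>.\<close>
  define r where "r k = (\<Sum>i\<le>k. K i)" for k
  have r_ge: "r k \<ge> K j" if "j \<le> k" for j k
    unfolding r_def using that by (intro member_le_sum) auto
  define d where "d k x = X (r (Suc k)) x - X (r k) x" for k x
  have [measurable]: "d k \<in> borel_measurable ?M" for k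
    unfolding d_def by measurable
  have one: "(\<lambda>x. 1) \<in> square_integrable I"
    by (simp add: square_integrable_def)
  have d: "d k \<in> square_integrable I" "N (d k) \<le> (1/2)^k" for k
  proof -
    have "d k = X (r (Suc k)) - X (r k)" by (simp add: d_def fun_eq_iff)
    moreover have "N (X (r (Suc k)) - X (r k)) < (1/2)^k"
      by (intro K r_ge) auto
    ultimately show "d k \<in> square_integrable I" "N (d k) \<le> (1/2)^k" using X by auto
  qed
  define C where "C = N (\<lambda>x. 1)"
  have int_d: "(\<integral>\<^sup>+x. ennreal \<bar>d k x\<bar> \<partial>?M) \<le> ennreal (C * (1/2)^k)" for k
  proof -
    have abs: "(\<lambda>x. \<bar>d k x\<bar>) \<in> square_integrable I"
      using d(1)[of k] by (simp add: square_integrable_def)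
    have "(LINT x|?M. \<bar>d k x\<bar>) = L2_ip I (\<lambda>x. \<bar>d k x\<bar>) (\<lambda>x. 1)"
      by (simp add: L2_ip_def)
    also have "\<dots> \<le> N (\<lambda>x. \<bar>d k x\<bar>) * C"
      using ip_Cauchy_Schwarz[OF abs one] by (simp add: C_def)
    also have "N (\<lambda>x. \<bar>d k x\<bar>) = N (d k)"
      by (simp add: L2_norm_square)
    also have "N (d k) * C \<le> (1/2)^k * C"
      using d(2)[of k] N_nonneg[OF one] by (intro mult_right_mono) (auto simp: C_def)
    finally have "(LINT x|?M. \<bar>d k x\<bar>) \<le> C * (1/2)^k" by (simp add: mult.commute)
    moreover have "integrable ?M (\<lambda>x. \<bar>d k x\<bar>)"
      using square_integrable_mult[OF abs one] by simp
    ultimately show ?thesis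
      by (subst nn_integral_eq_integral) (auto intro: ennreal_leI)
  qed
  have "(\<integral>\<^sup>+x. (\<Sum>k. ennreal \<bar>d k x\<bar>) \<partial>?M) = (\<Sum>k. \<integral>\<^sup>+x. ennreal \<bar>d k x\<bar> \<partial>?M)"
    by (rule nn_integral_suminf) measurable
  also have "\<dots> \<le> (\<Sum>k. ennreal (C * (1/2)^k))"
    by (intro suminf_le int_d summableI)
  also have "\<dots> = ennreal (\<Sum>k. C * (1/2)^k)"
    using N_nonneg[OF one] unfolding C_def
    by (intro suminf_ennreal2 summable_mult summable_geometric mult_nonneg_nonneg) simp_all
  finally have "(\<integral>\<^sup>+x. (\<Sum>k. ennreal \<bar>d k x\<bar>) \<partial>?M) \<noteq> \<infinity>"
    by (auto simp: top_unique)
  then have "AE x in ?M. (\<Sum>k. ennreal \<bar>d k x\<bar>) \<noteq> \<infinity>"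
    by (intro nn_integral_PInf_AE) auto
  then have conv: "AE x in ?M. convergent (\<lambda>k. X (r k) x)"
  proof eventually_elim
    case (elim x)
    then have "summable (\<lambda>k. \<bar>d k x\<bar>)"
      by (intro summable_suminf_not_top) auto
    then have "summable (\<lambda>k. d k x)"
      by (rule summable_rabs_cancel)
    then have "convergent (\<lambda>k. \<Sum>i<k. d i x)"
      by (rule summable_iff_convergent[THEN iffD1])
    also have "(\<lambda>k. \<Sum>i<k. d i x) = (\<lambda>k. X (r k) x - X (r 0) x)"
      using sum_lessThan_telescope[of "\<lambda>k. X (r k) x"] by (simp add: d_def)
    finally have "convergent (\<lambda>k. X (r k) x - X (r 0) x + X (r 0) x)"
      by (intro convergent_add convergent_const)
    then show ?case by simp
  qed
  define F where "F x = lim (\<lambda>k. X (r k) x)" for x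
  have F_meas [measurable]: "F \<in> borel_measurable ?M"
    unfolding F_def by measurable
  \<comment> \<open>Fatou along the subsequence, with n held fixed.\<close>
  have bound: "(\<integral>\<^sup>+x. ennreal ((F x - X n x)\<^sup>2) \<partial>?M) \<le> ennreal (((1/2)^j)\<^sup>2)" if "n \<ge> K j" for n j
  proof -
    have "(\<integral>\<^sup>+x. ennreal ((F x - X n x)\<^sup>2) \<partial>?M) = (\<integral>\<^sup>+x. liminf (\<lambda>k. ennreal ((X (r k) x - X n x)\<^sup>2)) \<partial>?M)"
    proof (intro nn_integral_cong_AE, use conv in eventually_elim)
      case (elim x)
      then have "(\<lambda>k. X (r k) x) \<longlonglongrightarrow> F x"
        by (simp add: F_def convergent_LIMSEQ_iff)
      then have "(\<lambda>k. ennreal ((X (r k) x - X n x)\<^sup>2)) \<longlonglongrightarrow> ennreal ((F x - X n x)\<^sup>2)"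
        by (intro tendsto_intros)
      then show ?case
        by (metis lim_imp_Liminf trivial_limit_sequentially)
    qed
    also have "\<dots> \<le> liminf (\<lambda>k. \<integral>\<^sup>+x. ennreal ((X (r k) x - X n x)\<^sup>2) \<partial>?M)"
      by (intro nn_integral_liminf) measurable
    also have "\<dots> \<le> ennreal (((1/2)^j)\<^sup>2)"
    proof (rule Liminf_le[OF sequentially_bot], rule eventually_sequentiallyI[of j])
      fix k assume "k \<ge> j"
      have Xn: "X (r k) - X n \<in> square_integrable I" using X by auto
      have "(LINT x|?M. (X (r k) x - X n x)\<^sup>2) = (N (X (r k) - X n))\<^sup>2"
        by (subst N_square[OF Xn]) (simp add: L2_ip_def power2_eq_square)
      also have "\<dots> \<le> ((1/2)^j)\<^sup>2"
        using K[OF r_ge[OF \<open>k \<ge> j\<close>] that] N_nonneg[OF Xn] by (intro power_mono) auto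
      finally show "(\<integral>\<^sup>+x. ennreal ((X (r k) x - X n x)\<^sup>2) \<partial>?M) \<le> ennreal (((1/2)^j)\<^sup>2)"
        using Xn by (subst nn_integral_eq_integral) (auto simp: square_integrable_def intro: ennreal_leI)
    qed
    finally show ?thesis .
  qed
  have diff: "F - X n \<in> square_integrable I \<and> N (F - X n) \<le> (1/2)^j" if "n \<ge> K j" for n j
  proof -
    have int: "integrable ?M (\<lambda>x. (F x - X n x)\<^sup>2)"
      using bound[OF that] by (intro integrableI_bounded) (auto simp: order.strict_trans1[OF _ ennreal_less_top])
    then have mem: "F - X n \<in> square_integrable I"
      by (simp add: square_integrable_def fun_diff_def)
    have "ennreal (LINT x|?M. (F x - X n x)\<^sup>2) \<le> ennreal (((1/2)^j)\<^sup>2)"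
      using bound[OF that] int by (subst (asm) nn_integral_eq_integral) auto
    then have "(LINT x|?M. (F x - X n x)\<^sup>2) \<le> ((1/2)^j)\<^sup>2"
      by (subst (asm) ennreal_le_iff) auto
    then have "sqrt (LINT x|?M. (F x - X n x)\<^sup>2) \<le> (1/2)^j"
      using real_le_lsqrt[of "(1/2)^j"] by (simp add: real_sqrt_le_iff real_le_lsqrt)
    with mem show ?thesis by (simp add: L2_norm_square fun_diff_def)
  qed
  have "F \<in> square_integrable I"
    using V_closed(1)[OF conjunct1[OF diff[of 0 "K 0"]] X[of "K 0"]] by simp
  moreover have "(\<lambda>n. N (X n - F)) \<longlonglongrightarrow> 0"
  proof (rule LIMSEQ_I)
    fix e :: real assume "e > 0"
    then obtain j where j: "(1/2)^j < e" using real_arch_pow_inv[of e "1/2"] by auto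
    have "norm (N (X n - F) - 0) < e" if "n \<ge> K j" for n
      using diff[OF that] j N_commute[OF X \<open>F \<in> square_integrable I\<close>, of n]
        N_nonneg[OF V_closed(2)[OF X \<open>F \<in> square_integrable I\<close>], of n] by simp
    then show "\<exists>no. \<forall>n\<ge>no. norm (N (X n - F) - 0) < e" by blast
  qed
  ultimately show ?thesis by blast
qed

lemma L2_semi_hilbert: "I \<in> lmeasurable \<Longrightarrow> semi_hilbert (square_integrable I) (L2_ip I)"
  using L2_complete L2_semi_inner by (simp add: semi_hilbert_def semi_hilbert_axioms_def)

interpretation L2: semi_hilbert "square_integrable {0<..<1}" "L2_ip {0<..<1}"
  by (rule L2_semi_hilbert) simp

section \<open>Primitives of integrable functions and weak derivatives\<close>

lemma integrable_lebesgue_on_subset: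
  fixes f :: "real \<Rightarrow> real"
  assumes "integrable (lebesgue_on T) f" "S \<subseteq> T" "S \<in> sets lebesgue" "T \<in> sets lebesgue"
  shows "integrable (lebesgue_on S) f"
proof -
  have "integrable lebesgue (\<lambda>x. indicator S x *\<^sub>R (if x \<in> T then f x else 0))"
    using assms by (intro integrable_mult_indicator) (simp_all add: Lebesgue_Measure.integrable_restrict_UNIV)
  also have "(\<lambda>x. indicator S x *\<^sub>R (if x \<in> T then f x else 0)) = (\<lambda>x. if x \<in> S then f x else 0)"
    using assms(2) by (auto simp: fun_eq_iff indicator_def)
  finally show ?thesis
    using assms by (simp add: Lebesgue_Measure.integrable_restrict_UNIV)
qed

lemma AE_lebesgue_on_neq: "AE t in lebesgue_on S. t \<noteq> (s::real)" if "S \<in> sets lebesgue"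
proof -
  have "AE t in lebesgue. t \<noteq> s"
    by (rule AE_I'[of "{s}"]) auto
  then show ?thesis
    using that by (subst AE_restrict_space_iff) (auto elim: eventually_mono)
qed

lemma integral_upper_part:
  fixes g :: "real \<Rightarrow> real"
  assumes g: "integrable (lebesgue_on {a..b}) g" and s: "s \<in> {a..b}"
  shows "(LINT t|lebesgue_on {a..b}. (if s \<le> t then g t else 0)) = (LINT t|lebesgue_on {s..b}. g t)"
    and "(LINT t|lebesgue_on {a..b}. (if s < t then g t else 0)) = (LINT t|lebesgue_on {s..b}. g t)"
proof -
  have "(LINT t|lebesgue_on {a..b}. (if s \<le> t then g t else 0)) = (LINT t|lebesgue_on {s..b}. (if s \<le> t then g t else 0))"
    using s by (intro integrable_lebesgue_on_support) auto
  also have "\<dots> = (LINT t|lebesgue_on {s..b}. g t)"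
    by (intro Bochner_Integration.integral_cong) auto
  finally show *: "(LINT t|lebesgue_on {a..b}. (if s \<le> t then g t else 0)) = (LINT t|lebesgue_on {s..b}. g t)" .
  have [measurable]: "g \<in> borel_measurable (lebesgue_on {a..b})" using g by auto
  have [measurable]: "(\<lambda>t. t) \<in> borel_measurable (lebesgue_on {a..b})"
    by (rule continuous_imp_measurable_lebesgue_on) simp
  have "(LINT t|lebesgue_on {a..b}. (if s < t then g t else 0)) = (LINT t|lebesgue_on {a..b}. (if s \<le> t then g t else 0))"
  proof (intro Bochner_Integration.integral_cong_AE)
    show "AE t in lebesgue_on {a..b}. (if s < t then g t else 0) = (if s \<le> t then g t else 0)"
      using AE_lebesgue_on_neq[of "{a..b}" s] by (auto elim!: eventually_mono)
  qed measurable
  with * show "(LINT t|lebesgue_on {a..b}. (if s < t then g t else 0)) = (LINT t|lebesgue_on {s..b}. g t)" by simp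
qed

text \<open>Fubini on the square, cut along the diagonal.\<close>

lemma integral_by_parts_Fubini:
  fixes f g :: "real \<Rightarrow> real"
  assumes f: "integrable (lebesgue_on {a..b}) f" and g: "integrable (lebesgue_on {a..b}) g"
  shows "(LINT s|lebesgue_on {a..b}. f s * (LINT t|lebesgue_on {s..b}. g t))
     + (LINT t|lebesgue_on {a..b}. g t * (LINT s|lebesgue_on {t..b}. f s))
     = (LINT s|lebesgue_on {a..b}. f s) * (LINT t|lebesgue_on {a..b}. g t)"
proof -
  let ?M = "lebesgue_on {a..b}"
  interpret M: finite_measure ?M by (rule finite_measure_lebesgue_on) simp
  interpret P: pair_sigma_finite ?M ?M ..
  have [measurable]: "f \<in> borel_measurable ?M" "g \<in> borel_measurable ?M" using f g by auto
  have [measurable]: "(\<lambda>t. t) \<in> borel_measurable ?M"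
    by (rule continuous_imp_measurable_lebesgue_on) simp
  define h1 where "h1 p = (if fst p \<le> snd p then f (fst p) * g (snd p) else 0)" for p
  define h2 where "h2 p = (if snd p < fst p then f (fst p) * g (snd p) else 0)" for p
  have [measurable]: "fst \<in> borel_measurable (?M \<Otimes>\<^sub>M ?M)" "snd \<in> borel_measurable (?M \<Otimes>\<^sub>M ?M)"
    using measurable_compose[OF measurable_fst \<open>(\<lambda>t. t) \<in> borel_measurable ?M\<close>]
      measurable_compose[OF measurable_snd \<open>(\<lambda>t. t) \<in> borel_measurable ?M\<close>] by simp_all
  have [measurable]: "(\<lambda>p. f (fst p)) \<in> borel_measurable (?M \<Otimes>\<^sub>M ?M)" "(\<lambda>p. g (snd p)) \<in> borel_measurable (?M \<Otimes>\<^sub>M ?M)"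
    using measurable_compose[OF measurable_fst, of f] measurable_compose[OF measurable_snd, of g] by measurable
  have prod: "integrable (?M \<Otimes>\<^sub>M ?M) (\<lambda>p. f (fst p) * g (snd p))"
  proof (rule P.Fubini_integrable)
    show "integrable ?M (\<lambda>x. LINT y|?M. norm (f (fst (x, y)) * g (snd (x, y))))"
      using f by (simp add: abs_mult)
  qed (use g in auto)
  have h1: "integrable (?M \<Otimes>\<^sub>M ?M) h1" and h2: "integrable (?M \<Otimes>\<^sub>M ?M) h2"
    unfolding h1_def h2_def
    by (auto intro!: Bochner_Integration.integrable_bound[OF prod] AE_I2)
  have "(LINT s|?M. f s) * (LINT t|?M. g t) = (LINT s|?M. (LINT t|?M. f s * g t))"
    by simp
  also have "\<dots> = integral\<^sup>L (?M \<Otimes>\<^sub>M ?M) (\<lambda>p. f (fst p) * g (snd p))"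
    using P.integral_fst'[OF prod] by simp
  also have "\<dots> = integral\<^sup>L (?M \<Otimes>\<^sub>M ?M) (\<lambda>p. h1 p + h2 p)"
    by (intro Bochner_Integration.integral_cong) (auto simp: h1_def h2_def)
  also have "\<dots> = integral\<^sup>L (?M \<Otimes>\<^sub>M ?M) h1 + integral\<^sup>L (?M \<Otimes>\<^sub>M ?M) h2"
    using h1 h2 by simp
  also have "integral\<^sup>L (?M \<Otimes>\<^sub>M ?M) h1 = (LINT s|?M. (LINT t|?M. h1 (s, t)))"
    using P.integral_fst'[OF h1] by simp
  also have "\<dots> = (LINT s|?M. f s * (LINT t|lebesgue_on {s..b}. g t))"
  proof (intro Bochner_Integration.integral_cong refl)
    fix s assume "s \<in> space ?M"
    then have s: "s \<in> {a..b}" by simp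
    have "(LINT t|?M. h1 (s, t)) = (LINT t|?M. f s * (if s \<le> t then g t else 0))"
      by (intro Bochner_Integration.integral_cong) (auto simp: h1_def)
    then show "(LINT t|?M. h1 (s, t)) = f s * (LINT t|lebesgue_on {s..b}. g t)"
      using integral_upper_part(1)[OF g s] by simp
  qed
  also have "integral\<^sup>L (?M \<Otimes>\<^sub>M ?M) h2 = (LINT t|?M. (LINT s|?M. h2 (s, t)))"
    using P.integral_snd[of "\<lambda>x y. h2 (x, y)"] h2 by simp
  also have "\<dots> = (LINT t|?M. g t * (LINT s|lebesgue_on {t..b}. f s))"
  proof (intro Bochner_Integration.integral_cong refl)
    fix t assume "t \<in> space ?M"
    then have t: "t \<in> {a..b}" by simp
    have "(LINT s|?M. h2 (s, t)) = (LINT s|?M. g t * (if t < s then f s else 0))"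
      by (intro Bochner_Integration.integral_cong) (auto simp: h2_def)
    then show "(LINT s|?M. h2 (s, t)) = g t * (LINT s|lebesgue_on {t..b}. f s)"
      using integral_upper_part(2)[OF f t] by simp
  qed
  finally show ?thesis by simp
qed

text \<open>Absolute continuity on [a,1] with derivative \<open>f\<close> almost everywhere, in
  integrated form. It is anchored at 1, where nothing degenerates, while a will be any positive
  number.\<close>

definition primitive :: "real \<Rightarrow> (real \<Rightarrow> real) \<Rightarrow> (real \<Rightarrow> real) \<Rightarrow> bool" where
  "primitive a F f \<longleftrightarrow> integrable (lebesgue_on {a..1}) f \<and>
     (\<forall>x\<in>{a..1}. F x = F 1 - (LINT t|lebesgue_on {x..1}. f t))"

lemma primitive_integrable: "\<lbrakk>primitive a F f; a \<le> x\<rbrakk> \<Longrightarrow> integrable (lebesgue_on {x..1}) f"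
  unfolding primitive_def by (auto intro: integrable_lebesgue_on_subset)

lemma primitive_eq: "\<lbrakk>primitive a F f; x \<in> {a..1}\<rbrakk> \<Longrightarrow> F x = F 1 - (LINT t|lebesgue_on {x..1}. f t)"
  unfolding primitive_def by blast

lemma continuous_on_tail_integral:
  fixes f :: "real \<Rightarrow> real"
  assumes "integrable (lebesgue_on {a..b}) f"
  shows "continuous_on {a..b} (\<lambda>x. LINT t|lebesgue_on {x..b}. f t)"
proof -
  have "continuous_on {a..b} (\<lambda>x. integral {x..b} f)"
    using assms by (intro indefinite_integral_continuous_1' integrable_on_lebesgue_on) auto
  moreover have "integral {x..b} f = (LINT t|lebesgue_on {x..b}. f t)" if "x \<in> {a..b}" for x
    using that assms by (intro lebesgue_integral_eq_integral[symmetric] integrable_lebesgue_on_subset[OF assms]) auto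
  ultimately show ?thesis
    by (rule continuous_on_eq)
qed

lemma primitive_continuous:
  assumes "primitive a F f" shows "continuous_on {a..1} F"
proof -
  have "continuous_on {a..1} (\<lambda>x. F 1 - (LINT t|lebesgue_on {x..1}. f t))"
    using assms by (intro continuous_intros continuous_on_tail_integral) (simp add: primitive_def)
  moreover have "F 1 - (LINT t|lebesgue_on {x..1}. f t) = F x" if "x \<in> {a..1}" for x
    using primitive_eq[OF assms that] by simp
  ultimately show ?thesis
    by (rule continuous_on_eq)
qed

text \<open>The product rule for absolutely continuous functions, from Fubini alone: writing F = F 1
  - f0 and G = G 1 - g0 with tail integrals f0 and g0, the only nontrivial term is f g0 + g f0,
  whose integral over [x,1] is the product of f0 and g0 at x.\<close>

lemma primitive_mult:
  assumes F: "primitive a F f" and G: "primitive a G g"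
  shows "primitive a (\<lambda>x. F x * G x) (\<lambda>x. f x * G x + g x * F x)"
  unfolding primitive_def
proof (intro conjI ballI)
  have int: "integrable (lebesgue_on {x..1}) (\<lambda>x. f x * G x)" "integrable (lebesgue_on {x..1}) (\<lambda>x. g x * F x)"
    if "a \<le> x" for x
    using primitive_integrable[OF F that] primitive_integrable[OF G that] that
      primitive_continuous[OF F] primitive_continuous[OF G]
    by (auto intro!: integrable_mult_continuous intro: continuous_on_subset)
  then show "integrable (lebesgue_on {a..1}) (\<lambda>x. f x * G x + g x * F x)"
    by auto
  fix x assume x: "x \<in> {a..1}"
  then have ax: "a \<le> x" by simp
  let ?f0 = "\<lambda>s. LINT t|lebesgue_on {s..1}. f t"
  let ?g0 = "\<lambda>s. LINT t|lebesgue_on {s..1}. g t"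
  note fi = primitive_integrable[OF F ax] and gi = primitive_integrable[OF G ax]
  have F_eq: "F y = F 1 - ?f0 y" and G_eq: "G y = G 1 - ?g0 y" if "y \<in> {x..1}" for y
    using primitive_eq[OF F, of y] primitive_eq[OF G, of y] that ax by simp_all
  have i0: "integrable (lebesgue_on {x..1}) (\<lambda>s. f s * ?g0 s)" "integrable (lebesgue_on {x..1}) (\<lambda>s. g s * ?f0 s)"
    by (intro integrable_mult_continuous continuous_on_tail_integral fi gi)+
  have "(LINT s|lebesgue_on {x..1}. f s * G s + g s * F s)
    = (LINT s|lebesgue_on {x..1}. (G 1 * f s + F 1 * g s) - (f s * ?g0 s + g s * ?f0 s))"
  proof (intro Bochner_Integration.integral_cong refl)
    fix s assume "s \<in> space (lebesgue_on {x..1})"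
    then have "f s * G s + g s * F s = f s * (G 1 - ?g0 s) + g s * (F 1 - ?f0 s)"
      using F_eq[of s] G_eq[of s] by simp
    then show "f s * G s + g s * F s = (G 1 * f s + F 1 * g s) - (f s * ?g0 s + g s * ?f0 s)"
      by (simp add: algebra_simps)
  qed
  also have "\<dots> = (G 1 * ?f0 x + F 1 * ?g0 x) - ?f0 x * ?g0 x"
    using fi gi i0 integral_by_parts_Fubini[OF fi gi] by simp
  finally show "F x * G x = F 1 * G 1 - (LINT s|lebesgue_on {x..1}. f s * G s + g s * F s)"
    using arg_cong2[OF F_eq[of x] G_eq[of x], of "(*)"] x by (simp add: algebra_simps)
qed

lemma primitive_add:
  assumes F: "primitive a F f" and G: "primitive a G g"
  shows "primitive a (\<lambda>x. F x + G x) (\<lambda>x. f x + g x)"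
  unfolding primitive_def
proof (intro conjI ballI)
  show "integrable (lebesgue_on {a..1}) (\<lambda>x. f x + g x)"
    using assms by (simp add: primitive_def)
  fix x assume x: "x \<in> {a..1}"
  then show "F x + G x = F 1 + G 1 - (LINT t|lebesgue_on {x..1}. f t + g t)"
    using primitive_eq[OF F x] primitive_eq[OF G x] primitive_integrable[OF F, of x] primitive_integrable[OF G, of x]
    by simp
qed

lemma primitive_scale:
  assumes F: "primitive a F f" shows "primitive a (\<lambda>x. c * F x) (\<lambda>x. c * f x)"
  unfolding primitive_def
proof (intro conjI ballI)
  show "integrable (lebesgue_on {a..1}) (\<lambda>x. c * f x)"
    using assms by (simp add: primitive_def)
  fix x assume x: "x \<in> {a..1}"
  show "c * F x = c * F 1 - (LINT t|lebesgue_on {x..1}. c * f t)"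
    by (subst primitive_eq[OF F x]) (simp add: right_diff_distrib)
qed

lemma primitive_cong_AE:
  assumes F: "primitive a F f" and g: "g \<in> borel_measurable (lebesgue_on {a..1})"
    and eq: "AE x in lebesgue_on {a..1}. f x = g x"
  shows "primitive a F g"
proof -
  have f: "f \<in> borel_measurable (lebesgue_on {a..1})" using F by (auto simp: primitive_def)
  have sub: "g \<in> borel_measurable (lebesgue_on {x..1})" "f \<in> borel_measurable (lebesgue_on {x..1})"
    "AE t in lebesgue_on {x..1}. f t = g t" if "a \<le> x" for x
  proof -
    have "{x..1} \<subseteq> {a..1}" using that by simp
    then show "g \<in> borel_measurable (lebesgue_on {x..1})" "f \<in> borel_measurable (lebesgue_on {x..1})"
      using measurable_restrict_mono[OF g] measurable_restrict_mono[OF f] by auto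
    have "AE t in lebesgue. t \<in> {a..1} \<longrightarrow> f t = g t"
      using eq by (subst (asm) AE_restrict_space_iff) auto
    then show "AE t in lebesgue_on {x..1}. f t = g t"
      using \<open>{x..1} \<subseteq> {a..1}\<close> by (subst AE_restrict_space_iff) (auto elim!: eventually_mono)
  qed
  show ?thesis
    unfolding primitive_def
  proof (intro conjI ballI)
    show "integrable (lebesgue_on {a..1}) g"
      using primitive_integrable[OF F order_refl] integrable_cong_AE[OF f g eq] by simp
    fix x assume x: "x \<in> {a..1}"
    then have "(LINT t|lebesgue_on {x..1}. f t) = (LINT t|lebesgue_on {x..1}. g t)"
      using sub[of x] by (intro integral_cong_AE) simp_all
    then show "F x = F 1 - (LINT t|lebesgue_on {x..1}. g t)"
      using primitive_eq[OF F x] by simp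
  qed
qed

lemma primitive_C1:
  assumes deriv: "\<And>x. a \<le> x \<Longrightarrow> (F has_field_derivative f x) (at x)" and cont: "continuous_on {a..} f"
  shows "primitive a F f"
  unfolding primitive_def
proof (intro conjI ballI)
  have int: "integrable (lebesgue_on {x..1}) f" if "a \<le> x" for x
  proof -
    have "integrable (lebesgue_on {x..1}) (\<lambda>x. 1 * f x)"
      using that by (intro integrable_mult_continuous continuous_on_subset[OF cont]) auto
    then show ?thesis by simp
  qed
  then show "integrable (lebesgue_on {a..1}) f" by simp
  fix x assume x: "x \<in> {a..1}"
  have "(f has_integral (F 1 - F x)) {x..1}"
    using x by (intro fundamental_theorem_of_calculus)
      (auto simp: has_real_derivative_iff_has_vector_derivative[symmetric] intro!: has_field_derivative_at_within deriv)
  then have "F 1 - F x = (LINT t|lebesgue_on {x..1}. f t)"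
    using has_integral_unique[OF _ has_integral_integral_lebesgue_on[OF int]] x by auto
  then show "F x = F 1 - (LINT t|lebesgue_on {x..1}. f t)" by simp
qed

lemma primitive_tail:
  "integrable (lebesgue_on {a..1}) f \<Longrightarrow> primitive a (\<lambda>x. - (LINT t|lebesgue_on {x..1}. f t)) f"
proof -
  assume f: "integrable (lebesgue_on {a..1}) f"
  have "(LINT t|lebesgue_on {1..1::real}. f t) = 0"
    by (rule integral_eq_zero_AE, rule AE_mp[OF AE_lebesgue_on_neq[of _ 1]]) auto
  with f show ?thesis by (simp add: primitive_def)
qed

lemma locally_integrable_primitive:
  assumes "\<And>a. 0 < a \<Longrightarrow> primitive a F f"
  shows "locally_integrable F" "locally_integrable f"
proof -
  have "continuous_on {0<..<1} F"
  proof (rule continuous_at_imp_continuous_on, rule ballI)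
    fix x :: real assume x: "x \<in> {0<..<1}"
    have "continuous_on {x/2<..<1} F"
      using primitive_continuous[OF assms[of "x/2"]] x by (auto intro: continuous_on_subset)
    then show "isCont F x"
      using x by (subst (asm) continuous_on_eq_continuous_at) auto
  qed
  then show "locally_integrable F" by (rule locally_integrable_continuous)
  show "locally_integrable f"
    unfolding locally_integrable_def
  proof (intro allI impI)
    fix a b :: real assume ab: "0 < a \<and> b < 1"
    then have "integrable (lebesgue_on {a..1}) f"
      by (intro primitive_integrable[OF assms order_refl]) simp
    then show "integrable (lebesgue_on {a..b}) f"
      by (rule integrable_lebesgue_on_subset) (use ab in auto)
  qed
qed

section \<open>Weak derivatives and their absolutely continuous representatives\<close>

lemma primitive_weak_deriv:
  assumes F: "\<And>a. 0 < a \<Longrightarrow> primitive a F f"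
  shows "weak_deriv F f"
  unfolding weak_deriv_def
proof (intro conjI ballI)
  show loc: "locally_integrable F" "locally_integrable f"
    using locally_integrable_primitive[of F f] F by blast+
  fix \<phi> assume \<phi>: "\<phi> \<in> test_functions"
  obtain a b where ab: "0 < a" "a \<le> b" "b < 1" "\<And>x. x < a \<or> b < x \<Longrightarrow> \<phi> x = 0"
    using test_supportE[OF \<phi>] by metis
  obtain c d where cd: "0 < c" "c \<le> d" "d < 1" "\<And>x. x < c \<or> d < x \<Longrightarrow> deriv \<phi> x = 0"
    using test_supportE[OF test_deriv[OF \<phi>]] by metis
  \<comment> \<open>Below the supports of \<phi> and of its derivative, so that neither a boundary
    term nor an integral over (0,e) remains.\<close>
  define e where "e = min a c / 2"
  have e: "0 < e" "e < a" "e < c" using ab cd by (auto simp: e_def min_def)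
  have "primitive e (\<lambda>x. F x * \<phi> x) (\<lambda>x. f x * \<phi> x + deriv \<phi> x * F x)"
    by (intro primitive_mult F e primitive_C1 test_DERIV[OF \<phi>] test_continuous test_deriv \<phi>)
  then have "F e * \<phi> e = F 1 * \<phi> 1 - (LINT x|lebesgue_on {e..1}. f x * \<phi> x + deriv \<phi> x * F x)"
    using e ab by (intro primitive_eq) auto
  moreover have "\<phi> e = 0" "\<phi> 1 = 0" using ab e by simp_all
  ultimately have "0 = (LINT x|lebesgue_on {e..1}. f x * \<phi> x + deriv \<phi> x * F x)" by simp
  also have "\<dots> = (LINT x|lebesgue_on {e..<1}. f x * \<phi> x + deriv \<phi> x * F x)"
    using ab cd by (intro integrable_lebesgue_on_support) (auto simp: less_le)
  also have "\<dots> = (LINT x|L01. f x * \<phi> x + deriv \<phi> x * F x)"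
    using ab cd e by (intro integrable_lebesgue_on_support(2)[symmetric]) (auto simp: not_le)
  also have "\<dots> = (LINT x|L01. f x * \<phi> x + F x * deriv \<phi> x)"
    by (simp add: mult.commute)
  also have "\<dots> = (LINT x|L01. f x * \<phi> x) + (LINT x|L01. F x * deriv \<phi> x)"
    using loc \<phi> test_deriv[OF \<phi>] by (simp add: test_mult_integral)
  finally show "(LINT x|L01. F x * deriv \<phi> x) = - (LINT x|L01. f x * \<phi> x)" by simp
qed

lemma locally_integrable_diff:
  "\<lbrakk>locally_integrable u; locally_integrable v\<rbrakk> \<Longrightarrow> locally_integrable (\<lambda>x. u x - v x)"
  by (auto simp: locally_integrable_def)

lemma weak_deriv_comb:
  assumes "weak_deriv u w" "weak_deriv u' w'"
  shows "weak_deriv (\<lambda>x. a * u x + b * u' x) (\<lambda>x. a * w x + b * w' x)"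
proof -
  have loc: "locally_integrable u" "locally_integrable w" "locally_integrable u'" "locally_integrable w'"
    using assms by (simp_all add: weak_deriv_def)
  have eq: "(LINT x|L01. (a * f x + b * g x) * \<phi> x) = a * (LINT x|L01. f x * \<phi> x) + b * (LINT x|L01. g x * \<phi> x)"
    if "locally_integrable f" "locally_integrable g" "\<phi> \<in> test_functions" for f g \<phi>
  proof -
    have "(LINT x|L01. (a * f x + b * g x) * \<phi> x) = (LINT x|L01. a * (f x * \<phi> x) + b * (g x * \<phi> x))"
      by (simp add: algebra_simps)
    then show ?thesis using that by (simp add: test_mult_integral)
  qed
  have "locally_integrable (\<lambda>x. a * u x + b * u' x)" "locally_integrable (\<lambda>x. a * w x + b * w' x)"
    using loc by (auto simp: locally_integrable_def)
  with assms show ?thesis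
    unfolding weak_deriv_def by (simp add: eq test_deriv)
qed

lemma weak_deriv_diff:
  assumes "weak_deriv u w" "weak_deriv u' w'"
  shows "weak_deriv (\<lambda>x. u x - u' x) (\<lambda>x. w x - w' x)"
  using weak_deriv_comb[OF assms, of 1 "-1"] by simp

lemma weak_deriv_unique:
  assumes "weak_deriv u w" "weak_deriv u' w'" "AE x in L01. u x = u' x"
  shows "AE x in L01. w x = w' x"
proof -
  have d: "weak_deriv (\<lambda>x. u x - u' x) (\<lambda>x. w x - w' x)"
    using assms by (intro weak_deriv_diff)
  have "AE x in L01. w x - w' x = 0"
  proof (rule fundamental_lemma)
    show "locally_integrable (\<lambda>x. w x - w' x)" using d by (simp add: weak_deriv_def)
    fix \<phi> assume \<phi>: "\<phi> \<in> test_functions"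
    have "(LINT x|L01. (u x - u' x) * deriv \<phi> x) = 0"
      by (rule integral_eq_zero_AE) (use assms(3) in eventually_elim, simp)
    then show "(LINT x|L01. (w x - w' x) * \<phi> x) = 0"
      using d \<phi> by (simp add: weak_deriv_def)
  qed
  then show ?thesis by simp
qed

text \<open>u minus the tail primitive of w has weak derivative 0 and is therefore constant.
  Integrability of w up to 1 gives the representative a value at 1.\<close>

lemma weak_deriv_primitive:
  assumes uw: "weak_deriv u w" and w: "\<And>a. 0 < a \<Longrightarrow> integrable (lebesgue_on {a..1}) w"
  shows "\<exists>F. (\<forall>a>0. primitive a F w) \<and> (AE x in L01. u x = F x)"
proof -
  define W where "W x = - (LINT t|lebesgue_on {x..1}. w t)" for x
  have W: "primitive a W w" if "a > 0" for a
    unfolding W_def by (rule primitive_tail[OF w[OF that]])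
  have d: "weak_deriv (\<lambda>x. u x - W x) (\<lambda>x. w x - w x)"
    by (intro weak_deriv_diff uw primitive_weak_deriv W)
  have "\<exists>c. AE x in L01. u x - W x = c"
    using d by (intro du_Bois_Reymond) (auto simp: weak_deriv_def)
  then obtain c where c: "AE x in L01. u x - W x = c" by blast
  have "primitive a (\<lambda>x. W x + c) w" if "a > 0" for a
    using primitive_add[OF W[OF that] primitive_C1[of a "\<lambda>_. c" "\<lambda>_. 0"]] by simp
  moreover have "AE x in L01. u x = W x + c"
    using c by eventually_elim simp
  ultimately show ?thesis by blast
qed

section \<open>The form on test functions\<close>

abbreviation ip01 :: "(real \<Rightarrow> real) \<Rightarrow> (real \<Rightarrow> real) \<Rightarrow> real" where
  "ip01 \<equiv> L2_ip {0<..<1}"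

abbreviation L2_01 :: "(real \<Rightarrow> real) set" where
  "L2_01 \<equiv> square_integrable {0<..<1}"

lemma locally_integrable_measurable:
  assumes "locally_integrable f"
  shows "f \<in> borel_measurable L01"
proof -
  define J where "J n = {1 / real (n + 2)..1 - 1 / real (n + 2)}" for n
  show ?thesis
  proof (rule borel_measurable_LIMSEQ_real[where u="\<lambda>n x. if x \<in> J n then f x else 0"])
    fix n
    have "integrable (lebesgue_on (J n)) f"
      using assms unfolding locally_integrable_def J_def by simp
    then have "integrable lebesgue (\<lambda>x. if x \<in> J n then f x else 0)"
      by (subst Lebesgue_Measure.integrable_restrict_UNIV) (auto simp: J_def)
    then show "(\<lambda>x. if x \<in> J n then f x else 0) \<in> borel_measurable L01"
      by (intro measurable_restrict_space1) auto
  next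
    fix x :: real assume "x \<in> space L01"
    then have x: "0 < x" "x < 1" by auto
    obtain m where m: "inverse (real (Suc m)) < min x (1 - x)"
      using reals_Archimedean[of "min x (1 - x)"] x by auto
    have "x \<in> J n" if "n \<ge> m" for n
    proof -
      have "1 / real (n + 2) \<le> inverse (real (Suc m))"
        using that by (simp add: field_simps)
      then show ?thesis using m by (simp add: J_def)
    qed
    then show "(\<lambda>n. if x \<in> J n then f x else 0) \<longlonglongrightarrow> f x"
      by (intro tendsto_eventually eventually_sequentiallyI[of m]) simp
  qed
qed

lemma L2_ip_cong_AE:
  assumes "f \<in> borel_measurable L01" "f' \<in> borel_measurable L01" "g \<in> borel_measurable L01" "g' \<in> borel_measurable L01"
    and "AE x in L01. f x = f' x" "AE x in L01. g x = g' x"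
  shows "ip01 f g = ip01 f' g'"
  unfolding L2_ip_def
proof (rule integral_cong_AE)
  show "AE x in L01. f x * g x = f' x * g' x"
    using assms(5,6) by eventually_elim simp
qed (use assms in measurable)

lemma square_integrable_cong:
  assumes "f \<in> L2_01" "\<And>x. \<lbrakk>0 < x; x < 1\<rbrakk> \<Longrightarrow> f x = g x"
  shows "g \<in> L2_01"
proof -
  have "f \<in> borel_measurable L01 \<longleftrightarrow> g \<in> borel_measurable L01"
    using assms(2) by (intro measurable_cong) auto
  moreover have "integrable L01 (\<lambda>x. (f x)\<^sup>2) \<longleftrightarrow> integrable L01 (\<lambda>x. (g x)\<^sup>2)"
    using assms(2) by (intro Bochner_Integration.integrable_cong) auto
  ultimately show ?thesis
    using assms(1) by (simp add: square_integrable_def)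
qed

lemma square_integrable_bounded:
  assumes f: "f \<in> borel_measurable L01" and bound: "\<And>x. \<lbrakk>0 < x; x < 1\<rbrakk> \<Longrightarrow> \<bar>f x\<bar> \<le> C"
  shows "f \<in> L2_01"
proof -
  have "integrable L01 (\<lambda>x. (f x)\<^sup>2)"
  proof (rule Bochner_Integration.integrable_bound[of _ "\<lambda>x. C\<^sup>2"])
    show "integrable L01 (\<lambda>x. C\<^sup>2)"
      by (intro finite_measure.integrable_const finite_measure_lebesgue_on) simp
    show "AE x in L01. norm ((f x)\<^sup>2) \<le> norm (C\<^sup>2)"
    proof (rule AE_I2)
      fix x assume "x \<in> space L01"
      then have "\<bar>f x\<bar> \<le> C" using bound by simp
      then show "norm ((f x)\<^sup>2) \<le> norm (C\<^sup>2)"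
        using power_mono[of "\<bar>f x\<bar>" C 2] by simp
    qed
  qed (use f in measurable)
  with f show ?thesis by (simp add: square_integrable_def)
qed

lemma square_integrable_bounded_mult:
  assumes f: "f \<in> L2_01" and g: "g \<in> borel_measurable L01"
    and bound: "\<And>x. \<lbrakk>0 < x; x < 1\<rbrakk> \<Longrightarrow> \<bar>g x\<bar> \<le> \<bar>f x\<bar>"
  shows "g \<in> L2_01" "L2.N g \<le> L2.N f"
proof -
  have sq: "(g x)\<^sup>2 \<le> (f x)\<^sup>2" if "x \<in> {0<..<1}" for x
    using bound[of x] that abs_le_square_iff[of "g x" "f x"] by simp
  have int: "integrable L01 (\<lambda>x. (g x)\<^sup>2)"
  proof (rule Bochner_Integration.integrable_bound[of _ "\<lambda>x. (f x)\<^sup>2"])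
    show "integrable L01 (\<lambda>x. (f x)\<^sup>2)" using f by (simp add: square_integrable_def)
    show "AE x in L01. norm ((g x)\<^sup>2) \<le> norm ((f x)\<^sup>2)"
      using sq by (intro AE_I2) auto
  qed (use g in measurable)
  with g show "g \<in> L2_01" by (simp add: square_integrable_def)
  show "L2.N g \<le> L2.N f"
    unfolding L2_norm_square using f int sq
    by (intro real_sqrt_le_mono integral_mono) (auto simp: square_integrable_def)
qed

lemma square_integrable_vanishing_near_0:
  assumes a: "0 < a" and cont: "continuous_on {a..1} f" and zero: "\<And>x. \<lbrakk>0 < x; x < a\<rbrakk> \<Longrightarrow> f x = 0"
  shows "f \<in> L2_01"
proof -
  have "bounded (f ` {a..1})"
    using cont by (intro compact_imp_bounded compact_continuous_image) auto
  then obtain C where C: "\<And>x. x \<in> {a..1} \<Longrightarrow> \<bar>f x\<bar> \<le> C"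
    by (force simp: bounded_iff)
  have "f \<in> borel_measurable (lebesgue_on {a..1})"
    using cont by (intro continuous_imp_measurable_on_sets_lebesgue) auto
  then have "(\<lambda>x. if x \<in> {a..1} then f x else 0) \<in> borel_measurable lebesgue"
    by (subst borel_measurable_if) auto
  then have "(\<lambda>x. if x \<in> {a..1} then f x else 0) \<in> borel_measurable L01"
    by (rule measurable_restrict_space1)
  then have meas: "f \<in> borel_measurable L01"
    by (rule measurable_cong[THEN iffD1, rotated]) (use zero in auto)
  show ?thesis
  proof (rule square_integrable_bounded[OF meas])
    fix x :: real assume x: "0 < x" "x < 1"
    show "\<bar>f x\<bar> \<le> max C 0"
      using C[of x] zero[of x] x by (cases "x < a") auto
  qed
qed

lemma test_square_integrable: "\<phi> \<in> test_functions \<Longrightarrow> \<phi> \<in> L2_01"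
proof -
  assume \<phi>: "\<phi> \<in> test_functions"
  obtain a b where ab: "0 < a" "a \<le> b" "b < 1" "\<And>x. x < a \<or> b < x \<Longrightarrow> \<phi> x = 0"
    using test_supportE[OF \<phi>] by metis
  then show ?thesis
    by (intro square_integrable_vanishing_near_0[of a] test_continuous \<phi>) auto
qed

lemma square_integrable_integrable: "f \<in> L2_01 \<Longrightarrow> integrable L01 f"
  using square_integrable_mult[of f "{0<..<1}" "\<lambda>x. 1"]
  by (simp add: square_integrable_bounded[of _ 1])

lemma integrable_L01_tail:
  fixes f :: "real \<Rightarrow> real"
  assumes f: "integrable L01 f" and a: "0 < a"
  shows "integrable (lebesgue_on {a..1}) f"
proof (cases "a \<le> 1")
  case True
  have "integrable (lebesgue_on {a..<1}) f"
    by (rule integrable_lebesgue_on_subset[OF f]) (use a in auto)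
  then have "integrable lebesgue (\<lambda>x. if x \<in> {a..<1} then f x else 0)"
    by (subst Lebesgue_Measure.integrable_restrict_UNIV) auto
  moreover have "integrable lebesgue (\<lambda>x. if x \<in> {1::real} then f x else 0)"
  proof -
    have "integrable (lebesgue_on {1::real}) (\<lambda>x. f 1)"
      by (intro finite_measure.integrable_const finite_measure_lebesgue_on negligible_imp_measurable negligible_sing)
    then have "integrable (lebesgue_on {1::real}) f"
      by (rule Bochner_Integration.integrable_cong[THEN iffD1, rotated 2]) auto
    then show ?thesis by (subst Lebesgue_Measure.integrable_restrict_UNIV) auto
  qed
  ultimately have "integrable lebesgue (\<lambda>x. (if x \<in> {a..<1} then f x else 0) + (if x \<in> {1} then f x else 0))"
    by (rule Bochner_Integration.integrable_add)
  also have "(\<lambda>x. (if x \<in> {a..<1} then f x else 0) + (if x \<in> {1} then f x else 0)) = (\<lambda>x. if x \<in> {a..1} then f x else 0)"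
    using True by (auto simp: fun_eq_iff)
  finally show ?thesis
    by (subst (asm) Lebesgue_Measure.integrable_restrict_UNIV) auto
qed simp

lemma test_deriv_comb:
  assumes "\<phi> \<in> test_functions" "\<psi> \<in> test_functions"
  shows "deriv (\<lambda>x. a * \<phi> x + b * \<psi> x) = (\<lambda>x. a * deriv \<phi> x + b * deriv \<psi> x)"
  by (intro ext DERIV_imp_deriv) (auto intro!: derivative_eq_intros test_DERIV assms)

lemma test_weak_deriv: "\<phi> \<in> test_functions \<Longrightarrow> weak_deriv \<phi> (deriv \<phi>)"
  by (intro primitive_weak_deriv primitive_C1 test_DERIV test_continuous test_deriv)

locale degenerate_wave =
  fixes \<alpha> \<mu> :: real
  assumes alpha: "\<alpha> < 2" and mu: "\<mu> \<le> (1 - \<alpha>)\<^sup>2 / 4"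
begin

text \<open>The gap to Hardy's constant, zero exactly in the critical case.\<close>

definition \<nu> where "\<nu> = (1 - \<alpha>)\<^sup>2 / 4 - \<mu>"

text \<open>
  Completing the square with the ground state \<open>x\<^bsup>(1-\<alpha>)/2\<^esup>\<close> of Hardy's inequality turns the form into
  \<open>\<parallel>G u\<^sub>x u\<parallel>\<^sup>2 + \<parallel>R u\<parallel>\<^sup>2\<close>. Both terms extend to the energy space, also for critical \<open>\<mu>\<close>, where the integral
  defining the form may diverge.
\<close>

definition G :: "(real \<Rightarrow> real) \<Rightarrow> (real \<Rightarrow> real) \<Rightarrow> real \<Rightarrow> real" where
  "G w u x = x powr (\<alpha> / 2) * (w x - (1 - \<alpha>) / (2 * x) * u x)"

definition R :: "(real \<Rightarrow> real) \<Rightarrow> real \<Rightarrow> real" where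
  "R u x = sqrt \<nu> * (x powr (\<alpha> / 2 - 1) * u x)"

lemma nu_nonneg: "0 \<le> \<nu>" using mu by (simp add: \<nu>_def)

text \<open>Reduces every exponent in use to the single quantity x^(\<alpha>/2), so that the
  pointwise identities below become rational and fall to \<open>field_simps\<close>.\<close>

lemma powr_half:
  assumes "0 < (x::real)"
  shows "x powr \<alpha> = x powr (\<alpha> / 2) * x powr (\<alpha> / 2)"
    "x powr (\<alpha> - 1) = x powr (\<alpha> / 2) * x powr (\<alpha> / 2) / x"
    "x powr (\<alpha> - 2) = x powr (\<alpha> / 2) * x powr (\<alpha> / 2) / (x * x)"
    "x powr (\<alpha> / 2 - 1) = x powr (\<alpha> / 2) / x"
    "x powr (2 - \<alpha>) = x * x / (x powr (\<alpha> / 2) * x powr (\<alpha> / 2))"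
    "x powr (1 - \<alpha> / 2) = x / x powr (\<alpha> / 2)"
    "x powr (- \<alpha> / 2) = 1 / x powr (\<alpha> / 2)"
    "x powr (1 - \<alpha>) = x / (x powr (\<alpha> / 2) * x powr (\<alpha> / 2))"
proof -
  show a: "x powr \<alpha> = x powr (\<alpha> / 2) * x powr (\<alpha> / 2)"
    by (simp add: powr_add[symmetric])
  show "x powr (\<alpha> - 1) = x powr (\<alpha> / 2) * x powr (\<alpha> / 2) / x"
    "x powr (1 - \<alpha>) = x / (x powr (\<alpha> / 2) * x powr (\<alpha> / 2))"
    using assms unfolding powr_diff a by simp_all
  have 2: "x powr 2 = x * x"
    using assms by (simp add: power2_eq_square)
  show "x powr (\<alpha> - 2) = x powr (\<alpha> / 2) * x powr (\<alpha> / 2) / (x * x)"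
    "x powr (2 - \<alpha>) = x * x / (x powr (\<alpha> / 2) * x powr (\<alpha> / 2))"
    unfolding powr_diff a 2 by simp_all
  show "x powr (\<alpha> / 2 - 1) = x powr (\<alpha> / 2) / x" "x powr (1 - \<alpha> / 2) = x / x powr (\<alpha> / 2)"
    using assms unfolding powr_diff by simp_all
  show "x powr (- \<alpha> / 2) = 1 / x powr (\<alpha> / 2)"
    using powr_minus_divide[of x "\<alpha> / 2"] by simp
qed

lemma mu_div_powr: "\<mu> / x powr (2 - \<alpha>) = \<mu> * x powr (\<alpha> - 2)" for x :: real
proof -
  have "1 / x powr (2 - \<alpha>) = x powr (\<alpha> - 2)"
    using powr_minus_divide[of x "2 - \<alpha>"] by simp
  then show ?thesis by (metis mult.right_neutral times_divide_eq_right)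
qed

text \<open>The bilinear form of Hardy's identity with a merely weakly differentiable u. Expanding
  the product of the two \<open>G\<close> leaves mixed terms that assemble into the pairings of w
  with \<open>?\<zeta>\<close> and of u with its derivative; these cancel by definition of the weak
  derivative.\<close>

lemma form_weak:
  assumes uw: "weak_deriv u w" and \<psi>: "\<psi> \<in> test_functions"
  shows "ip01 (G w u) (G (deriv \<psi>) \<psi>) + ip01 (R u) (R \<psi>)
    = (LINT x|L01. w x * (x powr \<alpha> * deriv \<psi> x)) - \<mu> * (LINT x|L01. u x * (x powr (\<alpha> - 2) * \<psi> x))"
proof -
  let ?a1 = "\<lambda>x. x powr \<alpha> * deriv \<psi> x" and ?a2 = "\<lambda>x. x powr (\<alpha> - 2) * \<psi> x" and ?\<zeta> = "\<lambda>x. x powr (\<alpha> - 1) * \<psi> x"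
  have tests: "?a1 \<in> test_functions" "?a2 \<in> test_functions" "?\<zeta> \<in> test_functions" "deriv ?\<zeta> \<in> test_functions"
    using \<psi> by (simp_all add: test_powr_mult test_deriv)
  have loc: "locally_integrable u" "locally_integrable w"
    using uw by (simp_all add: weak_deriv_def)
  have ints: "integrable L01 (\<lambda>x. w x * ?a1 x)" "integrable L01 (\<lambda>x. u x * ?a2 x)"
    "integrable L01 (\<lambda>x. w x * ?\<zeta> x)" "integrable L01 (\<lambda>x. u x * deriv ?\<zeta> x)"
    using loc tests by (simp_all add: test_mult_integral)
  have d\<zeta>: "deriv ?\<zeta> x = (\<alpha> - 1) * (x powr (\<alpha> - 2) * \<psi> x) + x powr (\<alpha> - 1) * deriv \<psi> x" if "0 < x" for x
    using that \<psi> by (intro DERIV_imp_deriv) (auto intro!: derivative_eq_intros test_DERIV)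
  have RR: "R u x * R \<psi> x = \<nu> * (u x * ?a2 x)" if "0 < x" for x
  proof -
    have "R u x * R \<psi> x = (sqrt \<nu> * sqrt \<nu>) * (x powr (\<alpha>/2 - 1) * x powr (\<alpha>/2 - 1)) * (u x * \<psi> x)"
      by (simp add: R_def)
    also have "x powr (\<alpha>/2 - 1) * x powr (\<alpha>/2 - 1) = x powr (\<alpha> - 2)"
      by (simp add: powr_add[symmetric])
    finally show ?thesis using nu_nonneg by simp
  qed
  \<comment> \<open>Completing the derivative of \<open>?\<zeta>\<close> turns the coefficient
    (1-\<alpha>)^2/4 of x^(\<alpha>-2) u \<psi> into its negative, which is -\<mu> - \<nu>.\<close>
  have GG: "G w u x * G (deriv \<psi>) \<psi> x = (w x * ?a1 x) - \<mu> * (u x * ?a2 x)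
      - (1 - \<alpha>) / 2 * (w x * ?\<zeta> x + u x * deriv ?\<zeta> x) - \<nu> * (u x * ?a2 x)" if "0 < x" for x
  proof -
    obtain p where p: "x powr (\<alpha>/2) = p" by blast
    show ?thesis
      unfolding G_def d\<zeta>[OF that] powr_half[OF that] p \<nu>_def using that
      by (simp add: field_simps power2_eq_square)
  qed
  have "ip01 (R u) (R \<psi>) = (LINT x|L01. \<nu> * (u x * ?a2 x))"
    unfolding L2_ip_def by (intro Bochner_Integration.integral_cong) (auto simp: RR)
  moreover have "ip01 (G w u) (G (deriv \<psi>) \<psi>) = (LINT x|L01. (w x * ?a1 x) - \<mu> * (u x * ?a2 x)
      - (1 - \<alpha>) / 2 * (w x * ?\<zeta> x + u x * deriv ?\<zeta> x) - \<nu> * (u x * ?a2 x))"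
    unfolding L2_ip_def by (intro Bochner_Integration.integral_cong) (auto simp: GG)
  moreover have "\<dots> = (LINT x|L01. w x * ?a1 x) - \<mu> * (LINT x|L01. u x * ?a2 x)
      - (1 - \<alpha>) / 2 * ((LINT x|L01. w x * ?\<zeta> x) + (LINT x|L01. u x * deriv ?\<zeta> x)) - \<nu> * (LINT x|L01. u x * ?a2 x)"
    using ints by simp
  moreover have "(LINT x|L01. u x * deriv ?\<zeta> x) = - (LINT x|L01. w x * ?\<zeta> x)"
    using uw tests by (simp add: weak_deriv_def)
  ultimately show ?thesis by simp
qed

lemma form_test_eq:
  assumes \<phi>: "\<phi> \<in> test_functions" and \<psi>: "\<psi> \<in> test_functions"
  shows "form_test \<alpha> \<mu> \<phi> \<psi>
    = ip01 (G (deriv \<phi>) \<phi>) (G (deriv \<psi>) \<psi>) + ip01 (R \<phi>) (R \<psi>)"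
proof -
  have loc: "locally_integrable \<phi>" "locally_integrable (deriv \<phi>)"
    using test_weak_deriv[OF \<phi>] by (simp_all add: weak_deriv_def)
  have "form_test \<alpha> \<mu> \<phi> \<psi> = (LINT x|L01. deriv \<phi> x * (x powr \<alpha> * deriv \<psi> x) - \<mu> * (\<phi> x * (x powr (\<alpha> - 2) * \<psi> x)))"
    unfolding form_test_def
    unfolding mu_div_powr by (simp add: mult_ac)
  also have "\<dots> = (LINT x|L01. deriv \<phi> x * (x powr \<alpha> * deriv \<psi> x)) - \<mu> * (LINT x|L01. \<phi> x * (x powr (\<alpha> - 2) * \<psi> x))"
    using test_mult_integral[OF loc(2) test_powr_mult[OF test_deriv[OF \<psi>]], of \<alpha>]
      test_mult_integral[OF loc(1) test_powr_mult[OF \<psi>], of "\<alpha> - 2"] by simp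
  finally show ?thesis
    using form_weak[OF test_weak_deriv[OF \<phi>] \<psi>] by simp
qed

lemma G_test: "\<phi> \<in> test_functions \<Longrightarrow> G (deriv \<phi>) \<phi> \<in> L2_01"
proof -
  assume \<phi>: "\<phi> \<in> test_functions"
  have "(\<lambda>x. x powr (\<alpha>/2) * deriv \<phi> x - (1 - \<alpha>) / 2 * (x powr (\<alpha>/2 - 1) * \<phi> x)) \<in> test_functions"
    by (intro test_diff test_scale test_powr_mult test_deriv \<phi>)
  from test_square_integrable[OF this] show ?thesis
  proof (rule square_integrable_cong)
    fix x :: real assume "0 < x"
    then show "x powr (\<alpha>/2) * deriv \<phi> x - (1 - \<alpha>) / 2 * (x powr (\<alpha>/2 - 1) * \<phi> x) = G (deriv \<phi>) \<phi> x"
      unfolding G_def powr_half(4)[OF \<open>0 < x\<close>] by (simp add: field_simps)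
  qed
qed

lemma R_test: "\<phi> \<in> test_functions \<Longrightarrow> R \<phi> \<in> L2_01"
  unfolding R_def by (intro test_square_integrable test_scale test_powr_mult)

lemma test_comb: "\<lbrakk>\<phi> \<in> test_functions; \<psi> \<in> test_functions\<rbrakk> \<Longrightarrow> (\<lambda>x. a * \<phi> x + b * \<psi> x) \<in> test_functions"
  by (intro test_add test_scale)

lemma G_comb: "G (\<lambda>x. a * w x + b * w' x) (\<lambda>x. a * u x + b * u' x) = a *\<^sub>R G w u + b *\<^sub>R G w' u'"
proof
  fix x
  obtain c where c: "(1 - \<alpha>) / (2 * x) = c" by blast
  show "G (\<lambda>x. a * w x + b * w' x) (\<lambda>x. a * u x + b * u' x) x = (a *\<^sub>R G w u + b *\<^sub>R G w' u') x"
    unfolding plus_fun_def scaleR_fun_def G_def c by (simp add: algebra_simps)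
qed

lemma R_comb: "R (\<lambda>x. a * u x + b * u' x) = a *\<^sub>R R u + b *\<^sub>R R u'"
  by (simp add: R_def fun_eq_iff scaleR_fun_def algebra_simps)

lemma form_test_comb:
  assumes "\<phi> \<in> test_functions" "\<psi> \<in> test_functions" "\<theta> \<in> test_functions"
  shows "form_test \<alpha> \<mu> (\<lambda>x. a * \<phi> x + b * \<psi> x) \<theta> = a * form_test \<alpha> \<mu> \<phi> \<theta> + b * form_test \<alpha> \<mu> \<psi> \<theta>"
  unfolding form_test_eq[OF assms(1,3)] form_test_eq[OF assms(2,3)] form_test_eq[OF test_comb[OF assms(1,2)] assms(3)]
    test_deriv_comb[OF assms(1,2)] G_comb R_comb
  using assms by (simp add: L2.ip_add L2.ip_scale G_test R_test algebra_simps)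

text \<open>Positivity is Hardy's inequality with its sharp constant; \<open>form_test_eq\<close>
  shows it by writing the form as a sum of two squared norms.\<close>

lemma form_test_semi_inner: "semi_inner test_functions (form_test \<alpha> \<mu>)"
proof
  show "subspace test_functions"
  proof (rule subspaceI)
    show "(0 :: real \<Rightarrow> real) \<in> test_functions"
      unfolding test_functions_iff zero_fun_def
      by (intro conjI smooth_on_const exI[of _ "1/2"]) auto
  qed (auto simp: plus_fun_def scaleR_fun_def intro: test_add test_scale)
next
  fix \<phi> \<psi> \<theta> assume t: "\<phi> \<in> test_functions" "\<psi> \<in> test_functions" "\<theta> \<in> test_functions"
  show "form_test \<alpha> \<mu> (\<phi> + \<psi>) \<theta> = form_test \<alpha> \<mu> \<phi> \<theta> + form_test \<alpha> \<mu> \<psi> \<theta>"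
    using form_test_comb[OF t, of 1 1] by (simp add: plus_fun_def)
next
  fix \<phi> \<theta> :: "real \<Rightarrow> real" and c assume t: "\<phi> \<in> test_functions" "\<theta> \<in> test_functions"
  show "form_test \<alpha> \<mu> (c *\<^sub>R \<phi>) \<theta> = c * form_test \<alpha> \<mu> \<phi> \<theta>"
    using form_test_comb[OF t(1,1,2), of c 0] by (simp add: scaleR_fun_def)
next
  fix \<phi> \<psi> assume t: "\<phi> \<in> test_functions" "\<psi> \<in> test_functions"
  then show "form_test \<alpha> \<mu> \<phi> \<psi> = form_test \<alpha> \<mu> \<psi> \<phi>"
    by (simp add: form_test_def mult_ac)
  show "0 \<le> form_test \<alpha> \<mu> \<phi> \<phi>"
    using t by (simp add: form_test_eq L2.ip_nonneg G_test R_test)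
qed

end

section \<open>The energy space\<close>

lemma locally_integrable_mult_continuous:
  assumes u: "locally_integrable u" and g: "continuous_on {0<..} g"
  shows "locally_integrable (\<lambda>x. u x * g x)"
  unfolding locally_integrable_def
proof (intro allI impI)
  fix a b :: real assume ab: "0 < a \<and> b < 1"
  then have "continuous_on {a..b} g" by (intro continuous_on_subset[OF g]) auto
  then show "integrable (lebesgue_on {a..b}) (\<lambda>x. u x * g x)"
    using u ab by (intro integrable_mult_continuous) (simp_all add: locally_integrable_def)
qed

lemma integrable_imp_locally_integrable:
  "integrable L01 f \<Longrightarrow> locally_integrable f"
  unfolding locally_integrable_def
proof (intro allI impI)
  fix a b :: real assume f: "integrable L01 f" and ab: "0 < a \<and> b < 1"
  show "integrable (lebesgue_on {a..b}) f"
    by (rule integrable_lebesgue_on_subset[OF f]) (use ab in auto)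
qed

lemma integral_L01_tail:
  fixes f :: "real \<Rightarrow> real"
  assumes f: "integrable L01 f" and a: "0 < a" "a \<le> 1" and zero: "\<And>x. x < a \<Longrightarrow> f x = 0"
  shows "(LINT x|lebesgue_on {a..1}. f x) = (LINT x|L01. f x)"
proof -
  have i1: "integrable lebesgue (\<lambda>x. if x \<in> {a..1} then f x else 0)"
    using integrable_L01_tail[OF f a(1)] by (subst Lebesgue_Measure.integrable_restrict_UNIV) auto
  have i2: "integrable lebesgue (\<lambda>x. if x \<in> {0<..<1} then f x else 0)"
    using f by (subst Lebesgue_Measure.integrable_restrict_UNIV) auto
  have "AE x in lebesgue. x \<noteq> (1::real)"
    by (rule AE_I'[of "{1}"]) auto
  then have "AE x in lebesgue. (if x \<in> {a..1} then f x else 0) = (if x \<in> {0<..<1} then f x else 0)"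
    by eventually_elim (use a zero in \<open>auto simp: not_le\<close>)
  then have "(LINT x|lebesgue. (if x \<in> {a..1} then f x else 0)) = (LINT x|lebesgue. (if x \<in> {0<..<1} then f x else 0))"
    using i1 i2 by (intro integral_cong_AE) auto
  then show ?thesis
    using Lebesgue_Measure.integral_restrict_UNIV[of "{a..1}" f]
      Lebesgue_Measure.integral_restrict_UNIV[of "{0<..<1}" f] by simp
qed

lemma L2_N_tendsto_iff:
  "(\<lambda>n. L2.N (f n)) \<longlonglongrightarrow> 0 \<longleftrightarrow> (\<lambda>n. LINT x|L01. (f n x)\<^sup>2) \<longlonglongrightarrow> 0"
proof
  assume "(\<lambda>n. L2.N (f n)) \<longlonglongrightarrow> 0"
  then have "(\<lambda>n. (L2.N (f n))\<^sup>2) \<longlonglongrightarrow> 0\<^sup>2" by (rule tendsto_power)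
  then show "(\<lambda>n. LINT x|L01. (f n x)\<^sup>2) \<longlonglongrightarrow> 0" by (simp add: L2_norm_square)
next
  assume "(\<lambda>n. LINT x|L01. (f n x)\<^sup>2) \<longlonglongrightarrow> 0"
  then have "(\<lambda>n. sqrt (LINT x|L01. (f n x)\<^sup>2)) \<longlonglongrightarrow> sqrt 0" by (rule tendsto_real_sqrt)
  then show "(\<lambda>n. L2.N (f n)) \<longlonglongrightarrow> 0" by (simp add: L2_norm_square)
qed

lemma L2_N_cong_AE:
  assumes "f \<in> borel_measurable L01" "g \<in> borel_measurable L01" "AE x in L01. f x = g x"
  shows "L2.N f = L2.N g"
  unfolding L2.N_def using assms by (simp add: L2_ip_cong_AE[of f g f g])

lemma L2_weak_limit:
  assumes "\<And>n. f n \<in> L2_01" "g \<in> L2_01"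
    "(\<lambda>n. L2.N (f n - g)) \<longlonglongrightarrow> 0" "h \<in> L2_01"
  shows "(\<lambda>n. ip01 (f n) h) \<longlonglongrightarrow> ip01 g h"
  using L2.ip_tendsto[of f g sequentially "\<lambda>_. h" h] assms by simp

text \<open>The hypothesis allows \<zeta> that vanish near 0 but not at 1. On test functions it is
  the definition of the weak derivative; on the larger class it encodes u(1) = 0, which
  \<open>energy_primitive\<close> extracts.\<close>

lemma by_parts_weak_deriv:
  assumes u: "u \<in> L2_01" and w: "\<And>a. 0 < a \<Longrightarrow> integrable (lebesgue_on {a..1}) w"
    and parts: "\<And>\<zeta> a. \<lbrakk>0 < a; smooth_on UNIV \<zeta>; \<And>x. x < a \<Longrightarrow> \<zeta> x = 0\<rbrakk> \<Longrightarrow>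
       (LINT x|L01. u x * deriv \<zeta> x) = - (LINT x|L01. w x * \<zeta> x)"
  shows "weak_deriv u w"
  unfolding weak_deriv_def
proof (intro conjI ballI)
  show "locally_integrable u"
    using u by (simp add: integrable_imp_locally_integrable square_integrable_integrable)
  show "locally_integrable w"
    unfolding locally_integrable_def
  proof (intro allI impI)
    fix a b :: real assume ab: "0 < a \<and> b < 1"
    then have "integrable (lebesgue_on {a..1}) w" by (intro w) simp
    then show "integrable (lebesgue_on {a..b}) w"
      by (rule integrable_lebesgue_on_subset) (use ab in auto)
  qed
  fix \<psi> assume \<psi>: "\<psi> \<in> test_functions"
  obtain a b where "0 < a" "a \<le> b" "b < 1" "\<And>x. x < a \<or> b < x \<Longrightarrow> \<psi> x = 0"
    using test_supportE[OF \<psi>] by metis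
  then show "(LINT x|L01. u x * deriv \<psi> x) = - (LINT x|L01. w x * \<psi> x)"
    by (intro parts[of a] test_smooth \<psi>) auto
qed

context degenerate_wave
begin

sublocale FT: semi_inner test_functions "form_test \<alpha> \<mu>"
  by (rule form_test_semi_inner)

abbreviation Gt where "Gt \<phi> \<equiv> G (deriv \<phi>) \<phi>"

lemma Gt_diff: "\<lbrakk>\<phi> \<in> test_functions; \<psi> \<in> test_functions\<rbrakk> \<Longrightarrow> Gt (\<phi> - \<psi>) = Gt \<phi> - Gt \<psi>"
  using test_deriv_comb[of \<phi> \<psi> 1 "-1"] G_comb[of 1 "deriv \<phi>" "-1" "deriv \<psi>" \<phi> \<psi>]
  by (simp add: fun_diff_def scaleR_fun_def plus_fun_def)

lemma R_diff: "R (u - v) = R u - R v"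
  by (simp add: R_def fun_eq_iff algebra_simps)

lemma form_test_square: "\<phi> \<in> test_functions \<Longrightarrow> form_test \<alpha> \<mu> \<phi> \<phi> = (L2.N (Gt \<phi>))\<^sup>2 + (L2.N (R \<phi>))\<^sup>2"
  by (simp add: form_test_eq L2.N_square G_test R_test)

lemma approximates_iff:
  "approximates \<alpha> \<mu> \<phi> u \<longleftrightarrow> (\<forall>n. \<phi> n \<in> test_functions) \<and>
     (\<forall>e>0. \<exists>K. \<forall>m\<ge>K. \<forall>n\<ge>K. FT.N (\<phi> m - \<phi> n) < e) \<and>
     u \<in> L2_01 \<and> (\<lambda>n. L2.N (\<phi> n - u)) \<longlonglongrightarrow> 0"
proof -
  have "(\<forall>e>0. \<exists>K. \<forall>m\<ge>K. \<forall>n\<ge>K. form_test \<alpha> \<mu> (\<phi> m - \<phi> n) (\<phi> m - \<phi> n) < e) \<longleftrightarrow>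
      (\<forall>e>0. \<exists>K. \<forall>m\<ge>K. \<forall>n\<ge>K. FT.N (\<phi> m - \<phi> n) < e)" (is "?L \<longleftrightarrow> ?R")
  proof
    assume L: ?L
    show ?R
    proof (intro allI impI)
      fix e :: real assume "e > 0"
      then have "e\<^sup>2 > 0" by simp
      with L obtain K where K: "\<And>m n. \<lbrakk>m \<ge> K; n \<ge> K\<rbrakk> \<Longrightarrow> form_test \<alpha> \<mu> (\<phi> m - \<phi> n) (\<phi> m - \<phi> n) < e\<^sup>2"
        by blast
      have "FT.N (\<phi> m - \<phi> n) < e" if "m \<ge> K" "n \<ge> K" for m n
        using real_sqrt_less_mono[OF K[OF that]] \<open>e > 0\<close> by (simp add: FT.N_def)
      then show "\<exists>K. \<forall>m\<ge>K. \<forall>n\<ge>K. FT.N (\<phi> m - \<phi> n) < e" by blast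
    qed
  next
    assume R: ?R
    show ?L
    proof (intro allI impI)
      fix e :: real assume "e > 0"
      then have "sqrt e > 0" by simp
      with R obtain K where K: "\<And>m n. \<lbrakk>m \<ge> K; n \<ge> K\<rbrakk> \<Longrightarrow> FT.N (\<phi> m - \<phi> n) < sqrt e"
        by blast
      have "form_test \<alpha> \<mu> (\<phi> m - \<phi> n) (\<phi> m - \<phi> n) < e" if "m \<ge> K" "n \<ge> K" for m n
        using K[OF that] by (simp add: FT.N_def)
      then show "\<exists>K. \<forall>m\<ge>K. \<forall>n\<ge>K. form_test \<alpha> \<mu> (\<phi> m - \<phi> n) (\<phi> m - \<phi> n) < e" by blast
    qed
  qed
  then show ?thesis
    unfolding approximates_def L2_N_tendsto_iff by (simp add: fun_diff_def)
qed

text \<open>By \<open>form_test_square\<close>, a form-Cauchy sequence makes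
  \<open>Gt (\<phi> n)\<close> and \<open>R (\<phi> n)\<close> Cauchy in L^2, so both converge even
  where the integral of the form diverges. The limits are recognised as \<open>G w u\<close> and
  \<open>R u\<close>. The last clause is integration by parts without a boundary term at 1.\<close>

lemma approximates_limits:
  assumes "approximates \<alpha> \<mu> \<phi> u"
  obtains w where "\<forall>a>0. integrable (lebesgue_on {a..1}) w"
    "G w u \<in> L2_01" "R u \<in> L2_01"
    "(\<lambda>n. L2.N (Gt (\<phi> n) - G w u)) \<longlonglongrightarrow> 0" "(\<lambda>n. L2.N (R (\<phi> n) - R u)) \<longlonglongrightarrow> 0"
    "\<forall>\<zeta>. \<forall>a>0. smooth_on UNIV \<zeta> \<longrightarrow> (\<forall>x<a. \<zeta> x = 0) \<longrightarrow>
       (LINT x|L01. u x * deriv \<zeta> x) = - (LINT x|L01. w x * \<zeta> x)"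
proof -
  have \<phi>: "\<phi> n \<in> test_functions" for n using assms by (simp add: approximates_def)
  have u: "u \<in> L2_01" and lim_u: "(\<lambda>n. L2.N (\<phi> n - u)) \<longlonglongrightarrow> 0"
    using assms by (simp_all add: approximates_iff)
  have cauchy: "\<exists>K. \<forall>m\<ge>K. \<forall>n\<ge>K. L2.N (Gt (\<phi> m) - Gt (\<phi> n)) < e \<and> L2.N (R (\<phi> m) - R (\<phi> n)) < e" if "e > 0" for e
  proof -
    have "\<exists>K. \<forall>m\<ge>K. \<forall>n\<ge>K. FT.N (\<phi> m - \<phi> n) < e"
      using assms that by (simp add: approximates_iff)
    then obtain K where K: "\<And>m n. \<lbrakk>m \<ge> K; n \<ge> K\<rbrakk> \<Longrightarrow> FT.N (\<phi> m - \<phi> n) < e"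
      by blast
    have "L2.N (Gt (\<phi> m) - Gt (\<phi> n)) < e \<and> L2.N (R (\<phi> m) - R (\<phi> n)) < e" if mn: "m \<ge> K" "n \<ge> K" for m n
    proof -
      have t: "\<phi> m - \<phi> n \<in> test_functions" using \<phi> by simp
      have "(L2.N (Gt (\<phi> m) - Gt (\<phi> n)))\<^sup>2 + (L2.N (R (\<phi> m) - R (\<phi> n)))\<^sup>2 = (FT.N (\<phi> m - \<phi> n))\<^sup>2"
        using form_test_square[OF t] by (simp add: FT.N_square t Gt_diff \<phi> R_diff)
      also have "\<dots> < e\<^sup>2"
        using K[OF mn] FT.N_nonneg[OF t] by (intro power_strict_mono) auto
      finally have "(L2.N (Gt (\<phi> m) - Gt (\<phi> n)))\<^sup>2 < e\<^sup>2" "(L2.N (R (\<phi> m) - R (\<phi> n)))\<^sup>2 < e\<^sup>2"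
        by (smt (verit) zero_le_power2)+
      then show ?thesis
        using \<open>e > 0\<close> by (auto intro: power_less_imp_less_base[of _ 2])
    qed
    then show ?thesis by blast
  qed
  obtain q where q: "q \<in> L2_01" "(\<lambda>n. L2.N (Gt (\<phi> n) - q)) \<longlonglongrightarrow> 0"
    using L2.complete[of "\<lambda>n. Gt (\<phi> n)"] cauchy G_test[OF \<phi>] by meson
  obtain r where r: "r \<in> L2_01" "(\<lambda>n. L2.N (R (\<phi> n) - r)) \<longlonglongrightarrow> 0"
    using L2.complete[of "\<lambda>n. R (\<phi> n)"] cauchy R_test[OF \<phi>] by meson
  have \<phi>2: "\<phi> n \<in> L2_01" for n using \<phi> by (rule test_square_integrable)
  have loc_u: "locally_integrable u" and loc_r: "locally_integrable r"
    using u r by (simp_all add: integrable_imp_locally_integrable square_integrable_integrable)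
  have "continuous_on {0<..} (\<lambda>x. sqrt \<nu> * x powr (\<alpha> / 2 - 1))"
    by (intro continuous_intros) auto
  from locally_integrable_mult_continuous[OF loc_u this] have loc_R: "locally_integrable (R u)"
    by (simp add: R_def[abs_def] mult_ac)
  \<comment> \<open>\<open>R\<close> multiplies by a weight that may be unbounded near 0, so L^2
    convergence does not pass through it. The limit is identified weakly, by moving the weight onto
    test functions.\<close>
  have "AE x in L01. r x - R u x = 0"
  proof (rule fundamental_lemma)
    show "locally_integrable (\<lambda>x. r x - R u x)"
      by (intro locally_integrable_diff loc_r loc_R)
    fix \<psi> assume \<psi>: "\<psi> \<in> test_functions"
    define \<theta> where "\<theta> x = sqrt \<nu> * (x powr (\<alpha> / 2 - 1) * \<psi> x)" for x
    have \<theta>: "\<theta> \<in> test_functions" unfolding \<theta>_def by (intro test_scale test_powr_mult \<psi>)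
    have swap: "ip01 (R v) \<psi> = ip01 v \<theta>" for v
      unfolding L2_ip_def R_def \<theta>_def by (simp add: mult_ac)
    have "(\<lambda>n. ip01 (R (\<phi> n)) \<psi>) \<longlonglongrightarrow> ip01 r \<psi>"
      by (intro L2_weak_limit R_test \<phi> r test_square_integrable \<psi>)
    moreover have "(\<lambda>n. ip01 (R (\<phi> n)) \<psi>) \<longlonglongrightarrow> ip01 (R u) \<psi>"
      unfolding swap by (intro L2_weak_limit \<phi>2 u lim_u test_square_integrable \<theta>)
    ultimately have "ip01 r \<psi> = ip01 (R u) \<psi>"
      by (rule LIMSEQ_unique)
    then show "(LINT x|L01. (r x - R u x) * \<psi> x) = 0"
      using test_mult_integral[OF loc_r \<psi>] test_mult_integral[OF loc_R \<psi>]
      by (simp add: L2_ip_def left_diff_distrib)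
  qed
  then have rR: "AE x in L01. r x = R u x" by simp
  have Ru: "R u \<in> L2_01"
    using r(1) locally_integrable_measurable[OF loc_R] rR by (rule square_integrable_cong_AE)
  have lim_R: "(\<lambda>n. L2.N (R (\<phi> n) - R u)) \<longlonglongrightarrow> 0"
  proof -
    have "L2.N (R (\<phi> n) - R u) = L2.N (R (\<phi> n) - r)" for n
    proof (rule L2_N_cong_AE)
      show "AE x in L01. (R (\<phi> n) - R u) x = (R (\<phi> n) - r) x"
        using rR by eventually_elim simp
      show "R (\<phi> n) - R u \<in> borel_measurable L01" "R (\<phi> n) - r \<in> borel_measurable L01"
        using R_test[OF \<phi>] Ru r(1) by (auto intro: square_integrable_measurable)
    qed
    with r(2) show ?thesis by simp
  qed
  \<comment> \<open>Solves \<open>G w u = q\<close> for w. The coefficients are continuous away from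
    0, so w is integrable on every [a,1].\<close>
  define w where "w x = q x * x powr (- \<alpha> / 2) + u x * ((1 - \<alpha>) / (2 * x))" for x
  have Gw: "G w u x = q x" if "0 < x" for x
    unfolding G_def w_def powr_half(7)[OF that] using that by (simp add: field_simps)
  have G2: "G w u \<in> L2_01"
    using q(1) by (rule square_integrable_cong) (simp add: Gw)
  have lim_G: "(\<lambda>n. L2.N (Gt (\<phi> n) - G w u)) \<longlonglongrightarrow> 0"
  proof -
    have "L2.N (Gt (\<phi> n) - G w u) = L2.N (Gt (\<phi> n) - q)" for n
    proof (rule L2_N_cong_AE)
      show "AE x in L01. (Gt (\<phi> n) - G w u) x = (Gt (\<phi> n) - q) x"
        by (rule AE_I2) (simp add: Gw)
      show "Gt (\<phi> n) - G w u \<in> borel_measurable L01" "Gt (\<phi> n) - q \<in> borel_measurable L01"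
        using G_test[OF \<phi>] G2 q(1) by (auto intro: square_integrable_measurable)
    qed
    with q(2) show ?thesis by simp
  qed
  have w_int: "integrable (lebesgue_on {a..1}) w" if "0 < a" for a
    unfolding w_def using that u q(1)
    by (intro Bochner_Integration.integrable_add integrable_mult_continuous integrable_L01_tail
        square_integrable_integrable continuous_intros) auto
  have by_parts: "(LINT x|L01. u x * deriv \<zeta> x) = - (LINT x|L01. w x * \<zeta> x)"
    if a: "0 < a" and \<zeta>: "smooth_on UNIV \<zeta>" and zero': "\<forall>x<a. \<zeta> x = 0" for \<zeta> a
  proof -
    have zero: "\<zeta> x = 0" if "x < a" for x using zero' that by blast
    have D: "(\<zeta> has_field_derivative deriv \<zeta> x) (at x)" "(deriv \<zeta> has_field_derivative deriv (deriv \<zeta>) x) (at x)" for x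
      using \<zeta> by (auto intro: smooth_on_DERIV smooth_on_deriv)
    have cont: "continuous_on S \<zeta>" "continuous_on S (deriv \<zeta>)" for S
      using D by (meson DERIV_isCont continuous_at_imp_continuous_on)+
    have dzero: "deriv \<zeta> x = 0" if "x < a" for x
    proof (rule DERIV_imp_deriv, rule DERIV_transform_open[of "{..<a}"])
      show "((\<lambda>x. 0) has_field_derivative 0) (at x)" by simp
    qed (use that zero in auto)
    define \<zeta>1 where "\<zeta>1 x = x powr (- \<alpha> / 2) * \<zeta> x" for x
    define \<zeta>2 where "\<zeta>2 x = (1 - \<alpha>) / (2 * x) * \<zeta> x" for x
    have sq: "\<zeta> \<in> L2_01" "deriv \<zeta> \<in> L2_01"
      "\<zeta>1 \<in> L2_01" "\<zeta>2 \<in> L2_01"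
      unfolding \<zeta>1_def \<zeta>2_def using a
      by (auto intro!: square_integrable_vanishing_near_0[of a] continuous_intros cont simp: zero dzero)
    \<comment> \<open>Here \<open>\<phi> n\<close> has compact support, so the derivative of its
      product with \<zeta> integrates to 0 whatever \<zeta> does at 1. The derivative of
      \<open>\<phi> n\<close> is then rewritten through \<open>Gt (\<phi> n)\<close>, whose
      convergence in L^2 is known.\<close>
    have n: "ip01 (\<phi> n) (deriv \<zeta>) = - (ip01 (Gt (\<phi> n)) \<zeta>1 + ip01 (\<phi> n) \<zeta>2)" for n
    proof -
      have "(\<lambda>x. \<zeta> x * \<phi> n x) \<in> test_functions"
        by (intro test_smooth_mult \<phi> smooth_on_subset[OF \<zeta>]) simp
      from test_integral_deriv[OF this] have "0 = (LINT x|L01. deriv (\<lambda>x. \<zeta> x * \<phi> n x) x)" by simp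
      also have "deriv (\<lambda>x. \<zeta> x * \<phi> n x) = (\<lambda>x. deriv \<zeta> x * \<phi> n x + deriv (\<phi> n) x * \<zeta> x)"
        by (intro ext DERIV_imp_deriv DERIV_mult D test_DERIV[OF \<phi>])
      also have "(LINT x|L01. deriv \<zeta> x * \<phi> n x + deriv (\<phi> n) x * \<zeta> x)
        = (LINT x|L01. \<phi> n x * deriv \<zeta> x + (Gt (\<phi> n) x * \<zeta>1 x + \<phi> n x * \<zeta>2 x))"
      proof (intro Bochner_Integration.integral_cong refl)
        fix x assume "x \<in> space L01"
        then have "0 < x" by simp
        then show "deriv \<zeta> x * \<phi> n x + deriv (\<phi> n) x * \<zeta> x = \<phi> n x * deriv \<zeta> x + (Gt (\<phi> n) x * \<zeta>1 x + \<phi> n x * \<zeta>2 x)"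
          unfolding G_def \<zeta>1_def \<zeta>2_def powr_half(7)[OF \<open>0 < x\<close>] by (simp add: field_simps)
      qed
      also have "\<dots> = ip01 (\<phi> n) (deriv \<zeta>) + (ip01 (Gt (\<phi> n)) \<zeta>1 + ip01 (\<phi> n) \<zeta>2)"
        unfolding L2_ip_def using sq \<phi>2[of n] G_test[OF \<phi>[of n]]
        by (simp add: square_integrable_mult)
      finally show ?thesis by simp
    qed
    have "(\<lambda>n. ip01 (\<phi> n) (deriv \<zeta>)) \<longlonglongrightarrow> ip01 u (deriv \<zeta>)"
      by (intro L2_weak_limit \<phi>2 u lim_u sq)
    moreover have "(\<lambda>n. ip01 (\<phi> n) (deriv \<zeta>)) \<longlonglongrightarrow> - (ip01 q \<zeta>1 + ip01 u \<zeta>2)"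
      unfolding n by (intro tendsto_intros L2_weak_limit G_test \<phi> q \<phi>2 u lim_u sq)
    ultimately have "ip01 u (deriv \<zeta>) = - (ip01 q \<zeta>1 + ip01 u \<zeta>2)"
      by (rule LIMSEQ_unique)
    also have "ip01 q \<zeta>1 + ip01 u \<zeta>2 = (LINT x|L01. q x * \<zeta>1 x + u x * \<zeta>2 x)"
      unfolding L2_ip_def using sq u q by (simp add: square_integrable_mult)
    also have "\<dots> = (LINT x|L01. w x * \<zeta> x)"
      by (simp add: w_def \<zeta>1_def \<zeta>2_def algebra_simps)
    finally show ?thesis by (simp add: L2_ip_def)
  qed
  show thesis
    using w_int G2 Ru lim_G lim_R by_parts by (intro that[of w]) blast+
qed

text \<open>A total choice of weak derivative, so that \<open>gd\<close> and \<open>B\<close> are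
  functions of u alone; only its class modulo null sets is determined.\<close>

definition wd :: "(real \<Rightarrow> real) \<Rightarrow> real \<Rightarrow> real" where
  "wd u = (SOME w. weak_deriv u w)"

abbreviation gd where "gd u \<equiv> G (wd u) u"

lemma wd_unique: 
  assumes "weak_deriv u w"
  shows "weak_deriv u (wd u)" "AE x in L01. wd u x = w x"
proof -
  show "weak_deriv u (wd u)" unfolding wd_def using assms by (rule someI[of "weak_deriv u"])
  then show "AE x in L01. wd u x = w x"
    using assms by (rule weak_deriv_unique) simp
qed

lemma G_measurable:
  assumes "weak_deriv u w" shows "G w u \<in> borel_measurable L01"
proof -
  have [measurable]: "u \<in> borel_measurable L01" "w \<in> borel_measurable L01"
    using assms by (simp_all add: weak_deriv_def locally_integrable_measurable)
  have [measurable]: "(\<lambda>x. x) \<in> borel_measurable L01"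
    by (rule continuous_imp_measurable_lebesgue_on) simp
  show ?thesis unfolding G_def by measurable
qed

lemma gd_eq_AE:
  assumes "weak_deriv u w" shows "AE x in L01. gd u x = G w u x"
  using wd_unique(2)[OF assms] by eventually_elim (simp add: G_def)

text \<open>The Dirichlet condition at 1. For a \<zeta> positive at 1, integrating by parts with the
  representative F gives the boundary term \<open>F 1 * \<zeta> 1\<close>, whereas membership in the
  energy space leaves none.\<close>

lemma energy_primitive:
  assumes "u \<in> energy_space \<alpha> \<mu>"
  obtains w F where "weak_deriv u w" "\<And>a. 0 < a \<Longrightarrow> primitive a F w" "AE x in L01. u x = F x" "F 1 = 0"
proof -
  obtain \<phi> where \<phi>: "approximates \<alpha> \<mu> \<phi> u" using assms by (auto simp: energy_space_def)
  obtain w where w': "\<forall>a>0. integrable (lebesgue_on {a..1}) w"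
    and parts': "\<forall>\<zeta>. \<forall>a>0. smooth_on UNIV \<zeta> \<longrightarrow> (\<forall>x<a. \<zeta> x = 0) \<longrightarrow>
       (LINT x|L01. u x * deriv \<zeta> x) = - (LINT x|L01. w x * \<zeta> x)"
    by (rule approximates_limits[OF \<phi>]) (rule that; assumption)
  have w: "integrable (lebesgue_on {a..1}) w" if "0 < a" for a using w' that by blast
  have parts: "(LINT x|L01. u x * deriv \<zeta> x) = - (LINT x|L01. w x * \<zeta> x)"
    if "0 < a" "smooth_on UNIV \<zeta>" "\<And>x. x < a \<Longrightarrow> \<zeta> x = 0" for \<zeta> a
    using parts' that by blast
  have u: "u \<in> L2_01" using \<phi> by (simp add: approximates_def)
  have uw: "weak_deriv u w"
    by (rule by_parts_weak_deriv[OF u w parts])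
  obtain F where F: "\<And>a. 0 < a \<Longrightarrow> primitive a F w" "AE x in L01. u x = F x"
    using weak_deriv_primitive[OF uw w] by blast
  define \<zeta> where "\<zeta> x = flat_exp 0 (1 * x + - 1 / 2)" for x
  have \<zeta>: "smooth_on UNIV \<zeta>" unfolding \<zeta>_def by (intro smooth_on_affine flat_exp_smooth)
  have zero: "\<zeta> x = 0" if "x < 1/2" for x using that by (simp add: \<zeta>_def flat_exp_def)
  have pos: "\<zeta> 1 > 0" by (simp add: \<zeta>_def flat_exp_def)
  have D: "(\<zeta> has_field_derivative deriv \<zeta> x) (at x)" "(deriv \<zeta> has_field_derivative deriv (deriv \<zeta>) x) (at x)" for x
    using \<zeta> by (auto intro: smooth_on_DERIV smooth_on_deriv)
  have cont: "continuous_on S \<zeta>" "continuous_on S (deriv \<zeta>)" for S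
    using D by (meson DERIV_isCont continuous_at_imp_continuous_on)+
  have dzero: "deriv \<zeta> x = 0" if "x < 1/2" for x
  proof (rule DERIV_imp_deriv, rule DERIV_transform_open[of "{..<1/2}"])
    show "((\<lambda>x. 0) has_field_derivative 0) (at x)" by simp
  qed (use that zero in auto)
  have "primitive (1/4) (\<lambda>x. F x * \<zeta> x) (\<lambda>x. w x * \<zeta> x + deriv \<zeta> x * F x)"
    by (intro primitive_mult F primitive_C1 D cont) simp
  from primitive_eq[OF this, of "1/4"] zero[of "1/4"]
  have eq: "F 1 * \<zeta> 1 = (LINT x|lebesgue_on {1/4..1}. w x * \<zeta> x + deriv \<zeta> x * F x)" by simp
  have prod_int: "integrable L01 (\<lambda>x. f x * g x)"
    if f: "integrable (lebesgue_on {1/4..1}) f" and g: "continuous_on {1/4..1} g" "\<And>x. x < 1/2 \<Longrightarrow> g x = 0" for f g :: "real \<Rightarrow> real"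
  proof -
    have "integrable (lebesgue_on {1/4..1}) (\<lambda>x. f x * g x)"
      using f g by (intro integrable_mult_continuous)
    then have "integrable (lebesgue_on {1/4..<1}) (\<lambda>x. f x * g x)"
      by (rule integrable_lebesgue_on_subset) auto
    then show ?thesis
      using g by (subst integrable_lebesgue_on_support(1)[of "{1/4..<1}"]) (auto simp: not_le)
  qed
  have i1: "integrable L01 (\<lambda>x. w x * \<zeta> x)"
    by (intro prod_int w cont zero) simp
  have "integrable (lebesgue_on {1/4..1}) (\<lambda>x. 1 * F x)"
    by (intro integrable_mult_continuous primitive_continuous[OF F(1)]) auto
  then have i2: "integrable L01 (\<lambda>x. F x * deriv \<zeta> x)"
    by (intro prod_int cont dzero) simp_all
  have "(LINT x|lebesgue_on {1/4..1}. w x * \<zeta> x + deriv \<zeta> x * F x) = (LINT x|L01. w x * \<zeta> x + deriv \<zeta> x * F x)"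
    using i1 i2 by (intro integral_L01_tail) (auto simp: zero dzero mult.commute)
  also have "\<dots> = (LINT x|L01. w x * \<zeta> x) + (LINT x|L01. F x * deriv \<zeta> x)"
    using i1 i2 by (simp add: mult.commute)
  also have "(LINT x|L01. F x * deriv \<zeta> x) = (LINT x|L01. u x * deriv \<zeta> x)"
  proof (rule integral_cong_AE)
    show "AE x in L01. F x * deriv \<zeta> x = u x * deriv \<zeta> x"
      using F(2) by eventually_elim simp
    show "(\<lambda>x. F x * deriv \<zeta> x) \<in> borel_measurable L01" using i2 by auto
    show "(\<lambda>x. u x * deriv \<zeta> x) \<in> borel_measurable L01"
      using square_integrable_measurable[OF u] continuous_imp_measurable_lebesgue_on[OF cont(2), of "{0<..<1}"] by measurable
  qed
  also have "\<dots> = - (LINT x|L01. w x * \<zeta> x)"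
    by (rule parts[of "1/2"]) (use \<zeta> zero in auto)
  finally have "F 1 = 0" using eq pos by simp
  with that uw F show thesis by blast
qed

lemma approximates_gd:
  assumes "approximates \<alpha> \<mu> \<phi> u"
  shows "weak_deriv u (wd u)" "gd u \<in> L2_01" "R u \<in> L2_01"
    "(\<lambda>n. L2.N (Gt (\<phi> n) - gd u)) \<longlonglongrightarrow> 0" "(\<lambda>n. L2.N (R (\<phi> n) - R u)) \<longlonglongrightarrow> 0"
proof -
  have \<phi>: "\<phi> n \<in> test_functions" for n using assms by (simp add: approximates_def)
  have u: "u \<in> L2_01" using assms by (simp add: approximates_def)
  obtain w where w: "\<forall>a>0. integrable (lebesgue_on {a..1}) w"
    and G: "G w u \<in> L2_01" and R: "R u \<in> L2_01"
    and limG: "(\<lambda>n. L2.N (Gt (\<phi> n) - G w u)) \<longlonglongrightarrow> 0" and limR: "(\<lambda>n. L2.N (R (\<phi> n) - R u)) \<longlonglongrightarrow> 0"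
    and parts: "\<forall>\<zeta>. \<forall>a>0. smooth_on UNIV \<zeta> \<longrightarrow> (\<forall>x<a. \<zeta> x = 0) \<longrightarrow>
       (LINT x|L01. u x * deriv \<zeta> x) = - (LINT x|L01. w x * \<zeta> x)"
    by (rule approximates_limits[OF assms]) (rule that; assumption)
  have uw: "weak_deriv u w"
    by (rule by_parts_weak_deriv[OF u]) (use w parts in blast)+
  show wd: "weak_deriv u (wd u)" by (rule wd_unique(1)[OF uw])
  have ae: "AE x in L01. G w u x = gd u x"
    using gd_eq_AE[OF uw] by eventually_elim simp
  show gd: "gd u \<in> L2_01"
    by (rule square_integrable_cong_AE[OF G G_measurable[OF wd] ae])
  show "R u \<in> L2_01" by (rule R)
  show "(\<lambda>n. L2.N (R (\<phi> n) - R u)) \<longlonglongrightarrow> 0" by (rule limR)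
  have "L2.N (Gt (\<phi> n) - gd u) = L2.N (Gt (\<phi> n) - G w u)" for n
  proof (rule L2_N_cong_AE)
    show "AE x in L01. (Gt (\<phi> n) - gd u) x = (Gt (\<phi> n) - G w u) x"
      using ae by eventually_elim simp
    show "Gt (\<phi> n) - gd u \<in> borel_measurable L01" "Gt (\<phi> n) - G w u \<in> borel_measurable L01"
      using G_test[OF \<phi>] G gd by (auto intro: square_integrable_measurable)
  qed
  with limG show "(\<lambda>n. L2.N (Gt (\<phi> n) - gd u)) \<longlonglongrightarrow> 0" by simp
qed

lemma energyD:
  assumes "u \<in> energy_space \<alpha> \<mu>"
  shows "u \<in> L2_01" "weak_deriv u (wd u)" "gd u \<in> L2_01"
    "R u \<in> L2_01"
proof -
  obtain \<phi> where \<phi>: "approximates \<alpha> \<mu> \<phi> u" using assms by (auto simp: energy_space_def)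
  show "u \<in> L2_01" using \<phi> by (simp add: approximates_def)
  show "weak_deriv u (wd u)" "gd u \<in> L2_01" "R u \<in> L2_01"
    using approximates_gd[OF \<phi>] by simp_all
qed

lemma form_limit:
  assumes u: "approximates \<alpha> \<mu> \<phi> u" and v: "approximates \<alpha> \<mu> \<psi> v"
  shows "(\<lambda>n. form_test \<alpha> \<mu> (\<phi> n) (\<psi> n)) \<longlonglongrightarrow> ip01 (gd u) (gd v) + ip01 (R u) (R v)"
proof -
  have \<phi>: "\<phi> n \<in> test_functions" and \<psi>: "\<psi> n \<in> test_functions" for n
    using u v by (simp_all add: approximates_def)
  show ?thesis
    unfolding form_test_eq[OF \<phi> \<psi>]
    by (intro tendsto_add L2.ip_tendsto G_test R_test \<phi> \<psi> approximates_gd[OF u] approximates_gd[OF v])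
qed

text \<open>The limit defining \<open>form\<close> is the same for all approximating sequences,
  which justifies the \<open>THE\<close>. From here on the form is a sum of two L^2 inner
  products.\<close>

lemma form_eq:
  assumes "u \<in> energy_space \<alpha> \<mu>" "v \<in> energy_space \<alpha> \<mu>"
  shows "form \<alpha> \<mu> u v = ip01 (gd u) (gd v) + ip01 (R u) (R v)"
  unfolding form_def
proof (rule the_equality)
  obtain \<phi> \<psi> where "approximates \<alpha> \<mu> \<phi> u" "approximates \<alpha> \<mu> \<psi> v"
    using assms by (auto simp: energy_space_def)
  then show "\<exists>\<phi> \<psi>. approximates \<alpha> \<mu> \<phi> u \<and> approximates \<alpha> \<mu> \<psi> v \<and>
     (\<lambda>n. form_test \<alpha> \<mu> (\<phi> n) (\<psi> n)) \<longlonglongrightarrow> ip01 (gd u) (gd v) + ip01 (R u) (R v)"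
    using form_limit by blast
next
  fix c assume "\<exists>\<phi> \<psi>. approximates \<alpha> \<mu> \<phi> u \<and> approximates \<alpha> \<mu> \<psi> v \<and>
     (\<lambda>n. form_test \<alpha> \<mu> (\<phi> n) (\<psi> n)) \<longlonglongrightarrow> c"
  then obtain \<phi> \<psi> where ap: "approximates \<alpha> \<mu> \<phi> u" "approximates \<alpha> \<mu> \<psi> v"
    and lim: "(\<lambda>n. form_test \<alpha> \<mu> (\<phi> n) (\<psi> n)) \<longlonglongrightarrow> c" by blast
  show "c = ip01 (gd u) (gd v) + ip01 (R u) (R v)"
    by (rule LIMSEQ_unique[OF lim form_limit[OF ap]])
qed

lemma test_in_energy: "\<phi> \<in> test_functions \<Longrightarrow> \<phi> \<in> energy_space \<alpha> \<mu>"
  unfolding energy_space_def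
proof (intro CollectI exI)
  assume \<phi>: "\<phi> \<in> test_functions"
  then show "approximates \<alpha> \<mu> (\<lambda>_. \<phi>) \<phi>"
    by (simp add: approximates_iff test_square_integrable)
qed

lemma gd_test: "\<phi> \<in> test_functions \<Longrightarrow> AE x in L01. gd \<phi> x = Gt \<phi> x"
  by (intro gd_eq_AE test_weak_deriv)

lemma energy_comb:
  assumes "u \<in> energy_space \<alpha> \<mu>" "v \<in> energy_space \<alpha> \<mu>"
  shows "a *\<^sub>R u + b *\<^sub>R v \<in> energy_space \<alpha> \<mu>"
proof -
  obtain \<phi> \<psi> where ap: "approximates \<alpha> \<mu> \<phi> u" "approximates \<alpha> \<mu> \<psi> v"
    using assms by (auto simp: energy_space_def)
  have \<phi>: "\<phi> n \<in> test_functions" and \<psi>: "\<psi> n \<in> test_functions" for n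
    using ap by (simp_all add: approximates_def)
  have u: "u \<in> L2_01" "(\<lambda>n. L2.N (\<phi> n - u)) \<longlonglongrightarrow> 0"
    and v: "v \<in> L2_01" "(\<lambda>n. L2.N (\<psi> n - v)) \<longlonglongrightarrow> 0"
    and C: "\<And>e. e > 0 \<Longrightarrow> \<exists>K. \<forall>m\<ge>K. \<forall>n\<ge>K. FT.N (\<phi> m - \<phi> n) < e" "\<And>e. e > 0 \<Longrightarrow> \<exists>K. \<forall>m\<ge>K. \<forall>n\<ge>K. FT.N (\<psi> m - \<psi> n) < e"
    using ap by (simp_all add: approximates_iff)
  have "approximates \<alpha> \<mu> (\<lambda>n. a *\<^sub>R \<phi> n + b *\<^sub>R \<psi> n) (a *\<^sub>R u + b *\<^sub>R v)"
    unfolding approximates_iff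
  proof (intro conjI allI impI)
    show "a *\<^sub>R \<phi> n + b *\<^sub>R \<psi> n \<in> test_functions" for n using \<phi> \<psi> by simp
    show "a *\<^sub>R u + b *\<^sub>R v \<in> L2_01" using u v by simp
    fix e :: real assume "e > 0"
    define d where "d = e / (\<bar>a\<bar> + \<bar>b\<bar> + 1)"
    have d: "d > 0" using \<open>e > 0\<close> by (simp add: d_def add_nonneg_pos)
    obtain K where K: "\<And>m n. \<lbrakk>m \<ge> K; n \<ge> K\<rbrakk> \<Longrightarrow> FT.N (\<phi> m - \<phi> n) < d" using C(1)[OF d] by blast
    obtain L where L: "\<And>m n. \<lbrakk>m \<ge> L; n \<ge> L\<rbrakk> \<Longrightarrow> FT.N (\<psi> m - \<psi> n) < d" using C(2)[OF d] by blast
    have "FT.N (a *\<^sub>R \<phi> m + b *\<^sub>R \<psi> m - (a *\<^sub>R \<phi> n + b *\<^sub>R \<psi> n)) < e" if mn: "m \<ge> max K L" "n \<ge> max K L" for m n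
    proof -
      have eq: "a *\<^sub>R \<phi> m + b *\<^sub>R \<psi> m - (a *\<^sub>R \<phi> n + b *\<^sub>R \<psi> n) = a *\<^sub>R (\<phi> m - \<phi> n) + b *\<^sub>R (\<psi> m - \<psi> n)"
        by (simp add: algebra_simps)
      have "FT.N (a *\<^sub>R (\<phi> m - \<phi> n) + b *\<^sub>R (\<psi> m - \<psi> n)) \<le> FT.N (a *\<^sub>R (\<phi> m - \<phi> n)) + FT.N (b *\<^sub>R (\<psi> m - \<psi> n))"
        using \<phi> \<psi> by (intro FT.N_triangle) auto
      also have "\<dots> = \<bar>a\<bar> * FT.N (\<phi> m - \<phi> n) + \<bar>b\<bar> * FT.N (\<psi> m - \<psi> n)"
        using \<phi> \<psi> by (simp add: FT.N_scale)
      also have "\<dots> \<le> \<bar>a\<bar> * d + \<bar>b\<bar> * d"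
        using K[of m n] L[of m n] mn by (intro add_mono mult_left_mono) auto
      also have "\<dots> < (\<bar>a\<bar> + \<bar>b\<bar> + 1) * d"
        using d by (simp add: algebra_simps)
      also have "\<dots> = e"
      proof -
        have "\<bar>a\<bar> + \<bar>b\<bar> + 1 \<noteq> 0" by linarith
        then show ?thesis by (simp add: d_def)
      qed
      finally show ?thesis unfolding eq .
    qed
    then show "\<exists>K. \<forall>m\<ge>K. \<forall>n\<ge>K. FT.N (a *\<^sub>R \<phi> m + b *\<^sub>R \<psi> m - (a *\<^sub>R \<phi> n + b *\<^sub>R \<psi> n)) < e" by blast
  next
    have lim: "(\<lambda>n. \<bar>a\<bar> * L2.N (\<phi> n - u) + \<bar>b\<bar> * L2.N (\<psi> n - v)) \<longlonglongrightarrow> 0"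
      using u(2) v(2) by (auto intro!: tendsto_eq_intros)
    show "(\<lambda>n. L2.N (a *\<^sub>R \<phi> n + b *\<^sub>R \<psi> n - (a *\<^sub>R u + b *\<^sub>R v))) \<longlonglongrightarrow> 0"
    proof (rule Lim_null_comparison[OF always_eventually lim], rule allI)
      fix n
      have sq: "\<phi> n \<in> L2_01" "\<psi> n \<in> L2_01"
        using \<phi> \<psi> by (simp_all add: test_square_integrable)
      have eq: "a *\<^sub>R \<phi> n + b *\<^sub>R \<psi> n - (a *\<^sub>R u + b *\<^sub>R v) = a *\<^sub>R (\<phi> n - u) + b *\<^sub>R (\<psi> n - v)"
        by (simp add: algebra_simps)
      show "norm (L2.N (a *\<^sub>R \<phi> n + b *\<^sub>R \<psi> n - (a *\<^sub>R u + b *\<^sub>R v))) \<le> \<bar>a\<bar> * L2.N (\<phi> n - u) + \<bar>b\<bar> * L2.N (\<psi> n - v)"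
        unfolding eq using sq u(1) v(1) L2.N_triangle[of "a *\<^sub>R (\<phi> n - u)" "b *\<^sub>R (\<psi> n - v)"]
        by (simp add: L2.N_scale)
    qed
  qed
  then show ?thesis by (auto simp: energy_space_def)
qed

lemma gd_comb:
  assumes "u \<in> energy_space \<alpha> \<mu>" "v \<in> energy_space \<alpha> \<mu>"
  shows "AE x in L01. gd (a *\<^sub>R u + b *\<^sub>R v) x = (a *\<^sub>R gd u + b *\<^sub>R gd v) x"
proof -
  have "weak_deriv (\<lambda>x. a * u x + b * v x) (\<lambda>x. a * wd u x + b * wd v x)"
    using assms by (intro weak_deriv_comb energyD)
  from gd_eq_AE[OF this] show ?thesis
    unfolding G_comb by (simp add: plus_fun_def scaleR_fun_def)
qed

lemma R_scaleR_add: "R (a *\<^sub>R u + b *\<^sub>R v) = a *\<^sub>R R u + b *\<^sub>R R v"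
  using R_comb[of a u b v] by (simp add: plus_fun_def scaleR_fun_def)

lemma form_comb:
  assumes u: "u \<in> energy_space \<alpha> \<mu>" and v: "v \<in> energy_space \<alpha> \<mu>" and z: "z \<in> energy_space \<alpha> \<mu>"
  shows "form \<alpha> \<mu> (a *\<^sub>R u + b *\<^sub>R v) z = a * form \<alpha> \<mu> u z + b * form \<alpha> \<mu> v z"
proof -
  note gds = energyD(3,4)[OF u] energyD(3,4)[OF v] energyD(3,4)[OF z]
  have "ip01 (gd (a *\<^sub>R u + b *\<^sub>R v)) (gd z) = ip01 (a *\<^sub>R gd u + b *\<^sub>R gd v) (gd z)"
    using gds energyD(3)[OF energy_comb[OF u v]]
    by (intro L2_ip_cong_AE gd_comb u v square_integrable_measurable) auto
  then show ?thesis
    using gds by (simp add: form_eq energy_comb u v z R_scaleR_add L2.ip_add L2.ip_scale algebra_simps)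
qed

lemma form_semi_inner: "semi_inner (energy_space \<alpha> \<mu>) (form \<alpha> \<mu>)"
proof
  show "subspace (energy_space \<alpha> \<mu>)"
  proof (rule subspaceI)
    show "0 \<in> energy_space \<alpha> \<mu>" by (rule test_in_energy) simp
    show "u + v \<in> energy_space \<alpha> \<mu>" if "u \<in> energy_space \<alpha> \<mu>" "v \<in> energy_space \<alpha> \<mu>" for u v
      using energy_comb[OF that, of 1 1] by simp
    show "c *\<^sub>R u \<in> energy_space \<alpha> \<mu>" if "u \<in> energy_space \<alpha> \<mu>" for c u
      using energy_comb[OF that that, of c 0] by simp
  qed
next
  fix u v z assume e: "u \<in> energy_space \<alpha> \<mu>" "v \<in> energy_space \<alpha> \<mu>" "z \<in> energy_space \<alpha> \<mu>"
  show "form \<alpha> \<mu> (u + v) z = form \<alpha> \<mu> u z + form \<alpha> \<mu> v z"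
    using form_comb[OF e, of 1 1] by simp
next
  fix u z :: "real \<Rightarrow> real" and c assume e: "u \<in> energy_space \<alpha> \<mu>" "z \<in> energy_space \<alpha> \<mu>"
  show "form \<alpha> \<mu> (c *\<^sub>R u) z = c * form \<alpha> \<mu> u z"
    using form_comb[OF e(1,1,2), of c 0] by simp
next
  fix u v assume e: "u \<in> energy_space \<alpha> \<mu>" "v \<in> energy_space \<alpha> \<mu>"
  then show "form \<alpha> \<mu> u v = form \<alpha> \<mu> v u"
    by (simp add: form_eq L2.ip_sym energyD)
  show "0 \<le> form \<alpha> \<mu> u u"
    using e by (simp add: form_eq L2.ip_nonneg energyD)
qed

sublocale EN: semi_inner "energy_space \<alpha> \<mu>" "form \<alpha> \<mu>"
  by (rule form_semi_inner)

lemma EN_square: "u \<in> energy_space \<alpha> \<mu> \<Longrightarrow> (EN.N u)\<^sup>2 = (L2.N (gd u))\<^sup>2 + (L2.N (R u))\<^sup>2"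
  by (simp add: EN.N_square form_eq L2.N_square energyD)

text \<open>Density of test functions in the energy norm, needed for completeness and for testing
  the equation with arbitrary elements of the energy space.\<close>

lemma approximates_EN:
  assumes ap: "approximates \<alpha> \<mu> \<phi> u"
  shows "(\<lambda>n. EN.N (\<phi> n - u)) \<longlonglongrightarrow> 0"
proof -
  have \<phi>: "\<phi> n \<in> test_functions" for n using ap by (simp add: approximates_def)
  have u: "u \<in> energy_space \<alpha> \<mu>" using ap by (auto simp: energy_space_def)
  have e: "\<phi> n - u \<in> energy_space \<alpha> \<mu>" for n using u \<phi> test_in_energy by simp
  have "EN.N (\<phi> n - u) = sqrt ((L2.N (Gt (\<phi> n) - gd u))\<^sup>2 + (L2.N (R (\<phi> n) - R u))\<^sup>2)" for n
  proof -
    have "AE x in L01. gd (\<phi> n - u) x = (Gt (\<phi> n) - gd u) x"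
      using gd_comb[OF test_in_energy[OF \<phi>[of n]] u, of 1 "-1"] gd_test[OF \<phi>[of n]]
      by eventually_elim simp
    then have "L2.N (gd (\<phi> n - u)) = L2.N (Gt (\<phi> n) - gd u)"
      using energyD(3)[OF e[of n]] energyD(3)[OF u] G_test[OF \<phi>[of n]]
      by (intro L2_N_cong_AE square_integrable_measurable) auto
    then have "(EN.N (\<phi> n - u))\<^sup>2 = (L2.N (Gt (\<phi> n) - gd u))\<^sup>2 + (L2.N (R (\<phi> n) - R u))\<^sup>2"
      using EN_square[OF e[of n]] by (simp add: R_diff)
    then show ?thesis
      using EN.N_nonneg[OF e[of n]] by (metis real_sqrt_abs abs_of_nonneg)
  qed
  moreover have "(\<lambda>n. sqrt ((L2.N (Gt (\<phi> n) - gd u))\<^sup>2 + (L2.N (R (\<phi> n) - R u))\<^sup>2)) \<longlonglongrightarrow> sqrt (0\<^sup>2 + 0\<^sup>2)"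
    by (intro tendsto_intros approximates_gd[OF ap])
  ultimately show ?thesis by simp
qed

text \<open>The multiplier \<open>x u\<^sub>x + \<alpha>/4 u\<close>, written in terms of \<open>G\<close>.\<close>

definition B :: "(real \<Rightarrow> real) \<Rightarrow> real \<Rightarrow> real" where
  "B u x = x powr (1 - \<alpha> / 2) * gd u x + (2 - \<alpha>) / 4 * u x"

text \<open>Since \<alpha> < 2, the weight is at most 1 on (0,1).\<close>

lemma weighted_bounded:
  assumes "f \<in> L2_01"
  shows "(\<lambda>x. x powr (1 - \<alpha> / 2) * f x) \<in> L2_01"
    "L2.N (\<lambda>x. x powr (1 - \<alpha> / 2) * f x) \<le> L2.N f"
proof -
  have [measurable]: "(\<lambda>x. x) \<in> borel_measurable L01" "f \<in> borel_measurable L01"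
    using continuous_imp_measurable_lebesgue_on[of "\<lambda>x. x"] square_integrable_measurable[OF assms] by simp_all
  have meas: "(\<lambda>x. x powr (1 - \<alpha> / 2) * f x) \<in> borel_measurable L01" by measurable
  have bound: "\<bar>x powr (1 - \<alpha> / 2) * f x\<bar> \<le> \<bar>f x\<bar>" if "0 < x" "x < 1" for x
  proof -
    have "x powr (1 - \<alpha> / 2) \<le> 1"
      using that alpha by (intro powr_le1) auto
    then show ?thesis by (simp add: abs_mult mult_left_le_one_le)
  qed
  show "(\<lambda>x. x powr (1 - \<alpha> / 2) * f x) \<in> L2_01"
    "L2.N (\<lambda>x. x powr (1 - \<alpha> / 2) * f x) \<le> L2.N f"
    using square_integrable_bounded_mult[OF assms meas bound] by simp_all
qed

abbreviation P where "P f \<equiv> (\<lambda>x. x powr (1 - \<alpha> / 2) * f x)"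

lemma P_diff: "P f - P g = P (f - g)"
  by (simp add: fun_eq_iff algebra_simps)

text \<open>Pointwise \<open>P (Gt \<phi>)\<close> is x \<phi>' - (1-\<alpha>)/2 \<phi>, so its
  product with \<phi> is half the derivative of x \<phi>^2 minus (2-\<alpha>)/2 \<phi>^2; the
  derivative integrates to 0.\<close>

lemma ip_P_test:
  assumes \<phi>: "\<phi> \<in> test_functions"
  shows "ip01 \<phi> (P (Gt \<phi>)) = - (2 - \<alpha>) / 2 * (L2.N \<phi>)\<^sup>2"
proof -
  have p: "(\<lambda>x. x * (\<phi> x * \<phi> x)) \<in> test_functions"
  proof -
    have "(\<lambda>x. x powr 1 * (\<phi> x * \<phi> x)) \<in> test_functions"
      by (intro test_powr_mult test_mult \<phi>)
    also have "(\<lambda>x. x powr 1 * (\<phi> x * \<phi> x)) = (\<lambda>x. x * (\<phi> x * \<phi> x))"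
    proof
      fix x
      obtain a b where "0 < a" "\<And>x. x < a \<or> b < x \<Longrightarrow> \<phi> x = 0"
        using test_supportE[OF \<phi>] by metis
      then show "x powr 1 * (\<phi> x * \<phi> x) = x * (\<phi> x * \<phi> x)"
        by (cases "x \<le> 0") simp_all
    qed
    finally show ?thesis .
  qed
  have d: "deriv (\<lambda>x. x * (\<phi> x * \<phi> x)) x = \<phi> x * \<phi> x + 2 * x * \<phi> x * deriv \<phi> x" for x
    by (rule DERIV_imp_deriv) (auto intro!: derivative_eq_intros test_DERIV[OF \<phi>])
  have i1: "integrable L01 (\<lambda>x. deriv (\<lambda>x. x * (\<phi> x * \<phi> x)) x)"
    by (intro test_integrable test_deriv p)
  have i2: "integrable L01 (\<lambda>x. \<phi> x * \<phi> x)"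
    by (intro test_integrable test_mult \<phi>)
  have "ip01 \<phi> (P (Gt \<phi>)) = (LINT x|L01. 1 / 2 * deriv (\<lambda>x. x * (\<phi> x * \<phi> x)) x - (2 - \<alpha>) / 2 * (\<phi> x * \<phi> x))"
    unfolding L2_ip_def
  proof (intro Bochner_Integration.integral_cong refl)
    fix x assume "x \<in> space L01"
    then have x: "0 < x" by simp
    show "\<phi> x * P (Gt \<phi>) x = 1 / 2 * deriv (\<lambda>x. x * (\<phi> x * \<phi> x)) x - (2 - \<alpha>) / 2 * (\<phi> x * \<phi> x)"
      unfolding d G_def powr_half(6)[OF x] using x by (simp add: field_simps)
  qed
  also have "\<dots> = - ((2 - \<alpha>) / 2 * (LINT x|L01. \<phi> x * \<phi> x))"
    using i1 i2 by (simp add: test_integral_deriv[OF p])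
  also have "\<dots> = - (2 - \<alpha>) / 2 * (LINT x|L01. \<phi> x * \<phi> x)"
    by (simp add: field_simps)
  finally show ?thesis
    by (simp add: L2.N_square test_square_integrable \<phi> L2_ip_def)
qed

lemma ip_P:
  assumes u: "u \<in> energy_space \<alpha> \<mu>"
  shows "ip01 u (P (gd u)) = - (2 - \<alpha>) / 2 * (L2.N u)\<^sup>2"
proof -
  obtain \<phi> where ap: "approximates \<alpha> \<mu> \<phi> u" using u by (auto simp: energy_space_def)
  have \<phi>: "\<phi> n \<in> test_functions" for n using ap by (simp add: approximates_def)
  have lim: "(\<lambda>n. L2.N (\<phi> n - u)) \<longlonglongrightarrow> 0" using ap by (simp add: approximates_iff)
  have \<phi>2: "\<phi> n \<in> L2_01" for n using \<phi> by (rule test_square_integrable)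
  have Plim: "(\<lambda>n. L2.N (P (Gt (\<phi> n)) - P (gd u))) \<longlonglongrightarrow> 0"
  proof (rule Lim_null_comparison[OF always_eventually approximates_gd(4)[OF ap]], rule allI)
    fix n
    have "Gt (\<phi> n) - gd u \<in> L2_01"
      using G_test[OF \<phi>] energyD(3)[OF u] by simp
    from weighted_bounded[OF this] show "norm (L2.N (P (Gt (\<phi> n)) - P (gd u))) \<le> L2.N (Gt (\<phi> n) - gd u)"
      unfolding P_diff by simp
  qed
  have "(\<lambda>n. ip01 (\<phi> n) (P (Gt (\<phi> n)))) \<longlonglongrightarrow> ip01 u (P (gd u))"
    by (intro L2.ip_tendsto \<phi>2 lim Plim weighted_bounded G_test \<phi> energyD[OF u])
  moreover have "(\<lambda>n. ip01 (\<phi> n) (P (Gt (\<phi> n)))) \<longlonglongrightarrow> - (2 - \<alpha>) / 2 * (L2.N u)\<^sup>2"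
    unfolding ip_P_test[OF \<phi>]
    by (intro tendsto_intros L2.N_tendsto \<phi>2 lim energyD[OF u])
  ultimately show ?thesis by (rule LIMSEQ_unique)
qed

lemma B_eq: "B u = P (gd u) + ((2 - \<alpha>) / 4) *\<^sub>R u"
  by (simp add: B_def fun_eq_iff scaleR_fun_def)

text \<open>Put c = (2-\<alpha>)/4. Then \<open>ip_P\<close> reads (u,p) = -2c |u|^2, and the square
  of |p + c u| is |p|^2 - 4c^2 |u|^2 + c^2 |u|^2, hence at most |p|^2 and at most the form.
  Cauchy-Schwarz applied to the same identity gives the Hardy-Poincare bound with constant
  2/(2-\<alpha>).\<close>

lemma energy_bounds:
  assumes u: "u \<in> energy_space \<alpha> \<mu>"
  shows "B u \<in> L2_01"
    "ip01 u (B u) = - (2 - \<alpha>) / 4 * (L2.N u)\<^sup>2"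
    "L2.N (B u) \<le> EN.N u"
    "L2.N u \<le> 2 / (2 - \<alpha>) * EN.N u"
proof -
  note sq = energyD[OF u]
  define p where "p = P (gd u)"
  note Pg = weighted_bounded[OF sq(3), folded p_def]
  note ip_p = ip_P[OF u, folded p_def]
  have B_p: "B u = p + ((2 - \<alpha>) / 4) *\<^sub>R u"
    unfolding p_def by (rule B_eq)
  show B2: "B u \<in> L2_01"
    unfolding B_p by (rule L2.V_closed(1)[OF Pg(1) L2.V_closed(3)[OF sq(1)]])
  have gd_le: "L2.N (gd u) \<le> EN.N u"
    by (rule power2_le_imp_le) (use EN_square[OF u] EN.N_nonneg[OF u] in simp_all)
  then have P_le: "L2.N p \<le> EN.N u"
    using Pg(2) by simp
  show "ip01 u (B u) = - (2 - \<alpha>) / 4 * (L2.N u)\<^sup>2"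
    unfolding B_p using sq Pg(1)
    by (simp add: L2.ip_add2 L2.ip_scale2 ip_p L2.N_square field_simps)
  have "(L2.N (B u))\<^sup>2 = (L2.N p)\<^sup>2 - 3 * ((2 - \<alpha>) / 4)\<^sup>2 * (L2.N u)\<^sup>2"
  proof -
    have ip: "ip01 u p = - (2 - \<alpha>) / 2 * ip01 u u"
      using ip_p sq by (simp add: L2.N_square)
    obtain c where c: "(2 - \<alpha>) / 4 = c" by blast
    have "(L2.N (B u))\<^sup>2 = ip01 p p + 2 * ((2 - \<alpha>) / 4) * ip01 u p
        + ((2 - \<alpha>) / 4)\<^sup>2 * ip01 u u"
      unfolding L2.N_square[OF B2] unfolding B_p c using sq Pg(1)
      by (simp add: L2.ip_add L2.ip_add2 L2.ip_scale L2.ip_scale2 L2.ip_sym[of p u] power2_eq_square algebra_simps)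
    then show ?thesis
      unfolding ip L2.N_square[OF sq(1)] L2.N_square[OF Pg(1)] by (simp add: power2_eq_square field_simps)
  qed
  then have "(L2.N (B u))\<^sup>2 \<le> (L2.N p)\<^sup>2"
    by simp
  also have "\<dots> \<le> (EN.N u)\<^sup>2"
    using P_le Pg(1) by (intro power_mono) auto
  finally show "L2.N (B u) \<le> EN.N u"
    using EN.N_nonneg[OF u] by (rule power2_le_imp_le)
  have "(2 - \<alpha>) / 2 * (L2.N u)\<^sup>2 \<le> L2.N u * EN.N u"
  proof -
    have "(2 - \<alpha>) / 2 * (L2.N u)\<^sup>2 \<le> \<bar>ip01 u p\<bar>"
      unfolding ip_p using alpha by (simp add: abs_mult)
    also have "\<dots> \<le> L2.N u * L2.N p"
      by (rule L2.ip_Cauchy_Schwarz[OF sq(1) Pg(1)])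
    also have "\<dots> \<le> L2.N u * EN.N u"
      using P_le sq(1) by (intro mult_left_mono) auto
    finally show ?thesis .
  qed
  then show "L2.N u \<le> 2 / (2 - \<alpha>) * EN.N u"
  proof (cases "L2.N u = 0")
    case True
    then show ?thesis using alpha EN.N_nonneg[OF u] by simp
  next
    case False
    then have "L2.N u > 0" using L2.N_nonneg[OF sq(1)] by simp
    have "L2.N u * ((2 - \<alpha>) / 2 * L2.N u) \<le> L2.N u * EN.N u"
      using \<open>(2 - \<alpha>) / 2 * (L2.N u)\<^sup>2 \<le> L2.N u * EN.N u\<close> by (simp add: power2_eq_square mult_ac)
    then have "(2 - \<alpha>) / 2 * L2.N u \<le> EN.N u"
      using \<open>L2.N u > 0\<close> by simp
    then show ?thesis using alpha by (simp add: field_simps)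
  qed
qed

text \<open>Test functions within 1/(n+1) of \<open>X n\<close> form a form-Cauchy sequence. The
  Hardy-Poincare bound makes it Cauchy in L^2 as well, so its L^2 limit lies in the energy space by
  the very definition of \<open>approximates\<close>.\<close>

lemma EN_complete:
  assumes X: "\<And>n. X n \<in> energy_space \<alpha> \<mu>"
    and Cauchy: "\<forall>e>0. \<exists>M. \<forall>m\<ge>M. \<forall>n\<ge>M. EN.N (X m - X n) < e"
  shows "\<exists>u\<in>energy_space \<alpha> \<mu>. (\<lambda>n. EN.N (X n - u)) \<longlonglongrightarrow> 0"
proof -
  have "\<exists>\<psi>\<in>test_functions. EN.N (\<psi> - X n) < inverse (real (Suc n))" for n
  proof -
    obtain \<phi> where ap: "approximates \<alpha> \<mu> \<phi> (X n)" using X by (auto simp: energy_space_def)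
    have "\<forall>\<^sub>F k in sequentially. EN.N (\<phi> k - X n) < inverse (real (Suc n))"
      using approximates_EN[OF ap] by (rule order_tendstoD) simp
    then obtain k where "EN.N (\<phi> k - X n) < inverse (real (Suc n))"
      by (auto simp: eventually_sequentially)
    then show ?thesis using ap by (auto simp: approximates_def)
  qed
  then obtain \<psi> where \<psi>: "\<And>n. \<psi> n \<in> test_functions" "\<And>n. EN.N (\<psi> n - X n) < inverse (real (Suc n))"
    by metis
  have \<psi>e: "\<psi> n \<in> energy_space \<alpha> \<mu>" for n by (rule test_in_energy[OF \<psi>(1)])
  \<comment> \<open>\<open>approximates\<close> speaks of the form on test functions, so its norm
    must first be identified with the energy norm.\<close>
  have FT_EN: "FT.N \<phi> = EN.N \<phi>" if \<phi>: "\<phi> \<in> test_functions" for \<phi>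
  proof -
    have "form \<alpha> \<mu> \<phi> \<phi> = form_test \<alpha> \<mu> \<phi> \<phi>"
      using \<phi> gd_test[OF \<phi>] energyD[OF test_in_energy[OF \<phi>]] G_test[OF \<phi>]
      by (simp add: form_eq form_test_eq test_in_energy L2_ip_cong_AE[of "gd \<phi>" "Gt \<phi>" "gd \<phi>" "Gt \<phi>"] square_integrable_measurable)
    then show ?thesis by (simp add: FT.N_def EN.N_def)
  qed
  have near: "\<exists>K. \<forall>n\<ge>K. EN.N (\<psi> n - X n) < e" if e: "e > 0" for e
  proof -
    obtain K where K: "inverse (real (Suc K)) < e" using reals_Archimedean[OF e] by blast
    have "EN.N (\<psi> n - X n) < e" if "n \<ge> K" for n
    proof -
      have "inverse (real (Suc n)) \<le> inverse (real (Suc K))" using that by simp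
      then show ?thesis using \<psi>(2)[of n] K by linarith
    qed
    then show ?thesis by blast
  qed
  have C\<psi>: "\<exists>K. \<forall>m\<ge>K. \<forall>n\<ge>K. EN.N (\<psi> m - \<psi> n) < e" if e: "e > 0" for e
  proof -
    obtain K where K: "\<And>n. n \<ge> K \<Longrightarrow> EN.N (\<psi> n - X n) < e/3" using near[of "e/3"] e by auto
    obtain M where M: "\<And>m n. \<lbrakk>m \<ge> M; n \<ge> M\<rbrakk> \<Longrightarrow> EN.N (X m - X n) < e/3"
      using Cauchy[rule_format, of "e/3"] e by auto
    have "EN.N (\<psi> m - \<psi> n) < e" if "m \<ge> max K M" "n \<ge> max K M" for m n
      using EN.N_triangle_diff[of "\<psi> m" "X m" "\<psi> n"] EN.N_triangle_diff[of "X m" "X n" "\<psi> n"]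
        EN.N_commute[of "X n" "\<psi> n"] K[of m] K[of n] M[of m n] that X \<psi>e by simp
    then show ?thesis by blast
  qed
  have "\<exists>u\<in>L2_01. (\<lambda>n. L2.N (\<psi> n - u)) \<longlonglongrightarrow> 0"
  proof (rule L2.complete)
    show "\<psi> n \<in> L2_01" for n by (rule test_square_integrable[OF \<psi>(1)])
    show "\<forall>e>0. \<exists>K. \<forall>m\<ge>K. \<forall>n\<ge>K. L2.N (\<psi> m - \<psi> n) < e"
    proof (intro allI impI)
      fix e :: real assume "e > 0"
      then have "(2 - \<alpha>) / 2 * e > 0" using alpha by simp
      then obtain K where K: "\<And>m n. \<lbrakk>m \<ge> K; n \<ge> K\<rbrakk> \<Longrightarrow> EN.N (\<psi> m - \<psi> n) < (2 - \<alpha>) / 2 * e"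
        using C\<psi> by blast
      have "L2.N (\<psi> m - \<psi> n) < e" if "m \<ge> K" "n \<ge> K" for m n
      proof -
        have "L2.N (\<psi> m - \<psi> n) \<le> 2 / (2 - \<alpha>) * EN.N (\<psi> m - \<psi> n)"
          by (intro energy_bounds EN.V_closed \<psi>e)
        also have "\<dots> < 2 / (2 - \<alpha>) * ((2 - \<alpha>) / 2 * e)"
          using K[OF that] alpha by (intro mult_strict_left_mono) auto
        finally show ?thesis using alpha by simp
      qed
      then show "\<exists>K. \<forall>m\<ge>K. \<forall>n\<ge>K. L2.N (\<psi> m - \<psi> n) < e" by blast
    qed
  qed
  then obtain u where u: "u \<in> L2_01" "(\<lambda>n. L2.N (\<psi> n - u)) \<longlonglongrightarrow> 0" by blast
  have ap: "approximates \<alpha> \<mu> \<psi> u"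
    unfolding approximates_iff using \<psi>(1) u C\<psi> by (simp add: FT_EN)
  then have ue: "u \<in> energy_space \<alpha> \<mu>" by (auto simp: energy_space_def)
  have "(\<lambda>n. EN.N (X n - u)) \<longlonglongrightarrow> 0"
  proof (rule Lim_null_comparison[OF always_eventually], rule allI)
    fix n
    show "norm (EN.N (X n - u)) \<le> inverse (real (Suc n)) + EN.N (\<psi> n - u)"
      using EN.N_triangle_diff[of "X n" "\<psi> n" u] EN.N_commute[of "X n" "\<psi> n"] \<psi>(2)[of n] X \<psi>e ue
        EN.N_nonneg[of "X n - u"] by simp
    show "(\<lambda>n. inverse (real (Suc n)) + EN.N (\<psi> n - u)) \<longlonglongrightarrow> 0"
      using tendsto_add[OF LIMSEQ_inverse_real_of_nat approximates_EN[OF ap]] by simp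
  qed
  with ue show ?thesis by blast
qed

end

section \<open>The trace identity\<close>

text \<open>For the space of pairs (u, u_t), whose completeness feeds
  \<open>uniform_boundedness\<close>.\<close>

lemma semi_hilbert_prod:
  assumes 1: "semi_hilbert V1 ip1" and 2: "semi_hilbert V2 ip2"
  shows "semi_hilbert (V1 \<times> V2) (\<lambda>x y. ip1 (fst x) (fst y) + ip2 (snd x) (snd y))"
proof -
  interpret A: semi_hilbert V1 ip1 by (rule 1)
  interpret B: semi_hilbert V2 ip2 by (rule 2)
  interpret P: semi_inner "V1 \<times> V2" "\<lambda>x y. ip1 (fst x) (fst y) + ip2 (snd x) (snd y)"
  proof
    show "subspace (V1 \<times> V2)"
      by (rule subspaceI) (auto simp: zero_prod_def)
    show "ip1 (fst x) (fst y) + ip2 (snd x) (snd y) = ip1 (fst y) (fst x) + ip2 (snd y) (snd x)"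
      if "x \<in> V1 \<times> V2" "y \<in> V1 \<times> V2" for x y
      using that A.ip_sym[of "fst x" "fst y"] B.ip_sym[of "snd x" "snd y"] by (simp add: mem_Times_iff)
  qed (auto simp: A.ip_add B.ip_add A.ip_scale B.ip_scale A.ip_nonneg B.ip_nonneg distrib_left)
  have NA: "A.N (fst x) \<le> P.N x" and NB: "B.N (snd x) \<le> P.N x" and NP: "P.N x \<le> A.N (fst x) + B.N (snd x)"
    if "x \<in> V1 \<times> V2" for x
  proof -
    have ge: "0 \<le> ip1 (fst x) (fst x)" "0 \<le> ip2 (snd x) (snd x)"
      using that by (auto intro: A.ip_nonneg B.ip_nonneg)
    then show "A.N (fst x) \<le> P.N x" "B.N (snd x) \<le> P.N x" "P.N x \<le> A.N (fst x) + B.N (snd x)"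
      by (auto simp: A.N_def B.N_def P.N_def intro: sqrt_add_le_add_sqrt)
  qed
  show ?thesis
  proof unfold_locales
    fix X :: "nat \<Rightarrow> 'a \<times> 'b"
    assume X: "\<And>n. X n \<in> V1 \<times> V2" and C: "\<forall>e>0. \<exists>M. \<forall>m\<ge>M. \<forall>n\<ge>M. P.N (X m - X n) < e"
    have X12: "fst (X n) \<in> V1" "snd (X n) \<in> V2" for n using X[of n] by auto
    have "\<forall>e>0. \<exists>M. \<forall>m\<ge>M. \<forall>n\<ge>M. A.N (fst (X m) - fst (X n)) < e"
    proof (intro allI impI)
      fix e :: real assume "e > 0"
      then obtain M where M: "\<forall>m\<ge>M. \<forall>n\<ge>M. P.N (X m - X n) < e" using C by blast
      have "A.N (fst (X m) - fst (X n)) < e" if "m \<ge> M" "n \<ge> M" for m n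
      proof -
        have "A.N (fst (X m - X n)) \<le> P.N (X m - X n)" by (intro NA P.V_closed(2) X)
        then show ?thesis using M that by fastforce
      qed
      then show "\<exists>M. \<forall>m\<ge>M. \<forall>n\<ge>M. A.N (fst (X m) - fst (X n)) < e" by blast
    qed
    then obtain a where a: "a \<in> V1" "(\<lambda>n. A.N (fst (X n) - a)) \<longlonglongrightarrow> 0"
      using A.complete[of "\<lambda>n. fst (X n)"] X12 by blast
    have "\<forall>e>0. \<exists>M. \<forall>m\<ge>M. \<forall>n\<ge>M. B.N (snd (X m) - snd (X n)) < e"
    proof (intro allI impI)
      fix e :: real assume "e > 0"
      then obtain M where M: "\<forall>m\<ge>M. \<forall>n\<ge>M. P.N (X m - X n) < e" using C by blast
      have "B.N (snd (X m) - snd (X n)) < e" if "m \<ge> M" "n \<ge> M" for m n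
      proof -
        have "B.N (snd (X m - X n)) \<le> P.N (X m - X n)" by (intro NB P.V_closed(2) X)
        then show ?thesis using M that by fastforce
      qed
      then show "\<exists>M. \<forall>m\<ge>M. \<forall>n\<ge>M. B.N (snd (X m) - snd (X n)) < e" by blast
    qed
    then obtain b where b: "b \<in> V2" "(\<lambda>n. B.N (snd (X n) - b)) \<longlonglongrightarrow> 0"
      using B.complete[of "\<lambda>n. snd (X n)"] X12 by blast
    have ab: "(a, b) \<in> V1 \<times> V2" using a b by simp
    have "(\<lambda>n. P.N (X n - (a, b))) \<longlonglongrightarrow> 0"
    proof (rule Lim_null_comparison[OF always_eventually], rule allI)
      fix n
      have "X n - (a, b) \<in> V1 \<times> V2" using X ab by (intro P.V_closed)
      from NP[OF this] P.N_nonneg[OF this] show "norm (P.N (X n - (a, b))) \<le> A.N (fst (X n) - a) + B.N (snd (X n) - b)"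
        by simp
      show "(\<lambda>n. A.N (fst (X n) - a) + B.N (snd (X n) - b)) \<longlonglongrightarrow> 0"
        using tendsto_add[OF a(2) b(2)] by simp
    qed
    with ab show "\<exists>x\<in>V1 \<times> V2. (\<lambda>n. P.N (X n - x)) \<longlonglongrightarrow> 0" by blast
  qed
qed

lemma weak_derivD:
  "\<lbrakk>weak_deriv u w; \<phi> \<in> test_functions\<rbrakk> \<Longrightarrow> (LINT x|L01. u x * deriv \<phi> x) = - (LINT x|L01. w x * \<phi> x)"
  by (simp add: weak_deriv_def)

lemma weak_deriv_cong:
  assumes uw: "weak_deriv u w" and eq: "AE x in L01. u x = u' x" "AE x in L01. w x = w' x"
    and loc: "locally_integrable u'" "locally_integrable w'"
  shows "weak_deriv u' w'"
proof -
  have *: "(LINT x|L01. f x * \<phi> x) = (LINT x|L01. g x * \<phi> x)"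
    if "AE x in L01. f x = g x" "locally_integrable f" "locally_integrable g" "\<phi> \<in> test_functions" for f g \<phi>
  proof (rule integral_cong_AE)
    show "AE x in L01. f x * \<phi> x = g x * \<phi> x" using that(1) by eventually_elim simp
  qed (use that test_mult_integral in blast)+
  show ?thesis
    using uw loc *[OF eq(1)] *[OF eq(2)] unfolding weak_deriv_def by (metis test_deriv)
qed

lemma AE_L01_tail:
  assumes "AE x in L01. Q x" "0 < a"
  shows "AE x in lebesgue_on {a..1}. Q x"
proof -
  have "AE x in lebesgue. x \<noteq> (1::real)" by (rule AE_I'[of "{1}"]) auto
  moreover have "AE x in lebesgue. x \<in> {0<..<1} \<longrightarrow> Q x"
    using assms(1) by (subst (asm) AE_restrict_space_iff) auto
  ultimately have "AE x in lebesgue. x \<in> {a..1} \<longrightarrow> Q x"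
    by eventually_elim (use assms(2) in auto)
  then show ?thesis by (subst AE_restrict_space_iff) auto
qed

text \<open>Makes the value in \<open>normal_trace\<close> independent of the representative: a
  nonzero difference at 1 would persist on an interval to the left of 1, which is not a null
  set.\<close>

lemma AE_eq_continuous_at_1:
  fixes f g :: "real \<Rightarrow> real"
  assumes f: "continuous_on {0<..1} f" and g: "continuous_on {0<..1} g" and eq: "AE x in L01. f x = g x"
  shows "f 1 = g 1"
proof (rule ccontr)
  assume ne: "f 1 \<noteq> g 1"
  define h where "h x = \<bar>f x - g x\<bar>" for x
  have "continuous_on {0<..1} h" unfolding h_def by (intro continuous_intros f g)
  then have "(h \<longlongrightarrow> h 1) (at 1 within {0<..1})" by (simp add: continuous_on)
  moreover have "h 1 > 0" using ne by (simp add: h_def)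
  ultimately have "\<forall>\<^sub>F x in at 1 within {0<..1}. h x > 0" by (rule order_tendstoD(1))
  then obtain d where d: "d > 0" "\<And>x. \<lbrakk>x \<in> {0<..1}; x \<noteq> 1; dist x 1 < d\<rbrakk> \<Longrightarrow> h x > 0"
    by (auto simp: eventually_at)
  have ae: "AE x in lebesgue. x \<in> {0<..<1} \<longrightarrow> f x = g x"
    using eq by (subst (asm) AE_restrict_space_iff) auto
  define c where "c = max 0 (1 - d)"
  have "AE x in lebesgue. x \<notin> {c<..<1}"
    using ae
  proof eventually_elim
    case (elim x)
    show ?case
    proof
      assume "x \<in> {c<..<1}"
      then have "0 < x" "x < 1" "1 - x < d" by (auto simp: c_def)
      with d(2)[of x] elim show False by (simp add: h_def dist_real_def)
    qed
  qed
  then have "{c<..<1} \<in> null_sets lebesgue"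
    by (subst (asm) AE_iff_null_sets[symmetric]) auto
  moreover have "c < 1" using d(1) by (simp add: c_def)
  ultimately show False by (auto simp: null_sets_def)
qed

text \<open>A nonzero limit L would force |h| >= |L| / (2x) almost everywhere near 0, and the
  integral of that bound diverges logarithmically.\<close>

lemma limit_zero_of_integrable_quotient:
  fixes h H :: "real \<Rightarrow> real"
  assumes h: "integrable L01 h" and eq: "AE x in L01. H x = x * h x" and lim: "(H \<longlongrightarrow> L) (at_right 0)"
  shows "L = 0"
proof (rule ccontr)
  assume "L \<noteq> 0"
  then have L: "\<bar>L\<bar> / 2 < \<bar>L\<bar>" "0 < \<bar>L\<bar>" by simp_all
  have "((\<lambda>x. \<bar>H x\<bar>) \<longlongrightarrow> \<bar>L\<bar>) (at_right 0)" using lim by (rule tendsto_rabs)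
  then have "\<forall>\<^sub>F x in at_right 0. \<bar>L\<bar> / 2 < \<bar>H x\<bar>" using L(1) by (rule order_tendstoD(1))
  then obtain b where b: "b > 0" "\<And>x. \<lbrakk>0 < x; x < b\<rbrakk> \<Longrightarrow> \<bar>L\<bar> / 2 < \<bar>H x\<bar>"
    by (auto simp: eventually_at_right_field)
  define d where "d = min b 1 / 2"
  have d: "0 < d" "d < b" "d < 1" using b(1) by (auto simp: d_def min_def)
  define M where "M = (LINT x|L01. \<bar>h x\<bar>)"
  \<comment> \<open>Chosen so that the integral of |L| / (2x) over [\<epsilon>, d] is exactly |M| +
    1, more than the whole integral \<open>M\<close> of |h| allows.\<close>
  define \<epsilon> where "\<epsilon> = d * exp (- (2 * (\<bar>M\<bar> + 1) / \<bar>L\<bar>))"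
  have \<epsilon>: "0 < \<epsilon>" "\<epsilon> \<le> d"
  proof -
    show "0 < \<epsilon>" using d by (simp add: \<epsilon>_def)
    have "exp (- (2 * (\<bar>M\<bar> + 1) / \<bar>L\<bar>)) \<le> 1" by simp
    then show "\<epsilon> \<le> d" using d by (simp add: \<epsilon>_def mult_left_le)
  qed
  have habs: "integrable L01 (\<lambda>x. \<bar>h x\<bar>)" using h by simp
  have hsub: "integrable (lebesgue_on {\<epsilon>..d}) (\<lambda>x. \<bar>h x\<bar>)"
    by (rule integrable_lebesgue_on_subset[OF habs]) (use \<epsilon> d in auto)
  have inv_has: "((\<lambda>x. \<bar>L\<bar> / 2 * (1 / x)) has_integral (\<bar>L\<bar> / 2 * ln d - \<bar>L\<bar> / 2 * ln \<epsilon>)) {\<epsilon>..d}"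
    using \<epsilon> by (intro fundamental_theorem_of_calculus)
      (auto simp: has_real_derivative_iff_has_vector_derivative[symmetric] intro!: derivative_eq_intros)
  have inv_int: "integrable (lebesgue_on {\<epsilon>..d}) (\<lambda>x. \<bar>L\<bar> / 2 * (1 / x))"
  proof (rule integrable_mult_continuous)
    show "integrable (lebesgue_on {\<epsilon>..d}) (\<lambda>_. \<bar>L\<bar> / 2)"
      by (intro finite_measure.integrable_const finite_measure_lebesgue_on) simp
    show "continuous_on {\<epsilon>..d} (\<lambda>x. 1 / x)"
      using \<epsilon> by (intro continuous_intros) auto
  qed
  have "\<bar>M\<bar> + 1 = \<bar>L\<bar> / 2 * ln d - \<bar>L\<bar> / 2 * ln \<epsilon>"
    using d L(2) by (simp add: \<epsilon>_def ln_mult field_simps)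
  also have "\<dots> = (LINT x|lebesgue_on {\<epsilon>..d}. \<bar>L\<bar> / 2 * (1 / x))"
    using has_integral_unique[OF inv_has has_integral_integral_lebesgue_on[OF inv_int]] by simp
  also have "\<dots> \<le> (LINT x|lebesgue_on {\<epsilon>..d}. \<bar>h x\<bar>)"
  proof (rule integral_mono_AE[OF inv_int hsub])
    have "AE x in lebesgue. x \<in> {0<..<1} \<longrightarrow> H x = x * h x"
      using eq by (subst (asm) AE_restrict_space_iff) auto
    then have "AE x in lebesgue. x \<in> {\<epsilon>..d} \<longrightarrow> \<bar>L\<bar> / 2 * (1 / x) \<le> \<bar>h x\<bar>"
    proof eventually_elim
      case (elim x)
      show ?case
      proof
        assume "x \<in> {\<epsilon>..d}"
        then have x: "0 < x" "x < b" "x < 1" using \<epsilon> d by auto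
        then have "\<bar>L\<bar> / 2 < x * \<bar>h x\<bar>" using b(2)[OF x(1,2)] elim by (simp add: abs_mult)
        then show "\<bar>L\<bar> / 2 * (1 / x) \<le> \<bar>h x\<bar>" using x by (simp add: field_simps)
      qed
    qed
    then show "AE x in lebesgue_on {\<epsilon>..d}. \<bar>L\<bar> / 2 * (1 / x) \<le> \<bar>h x\<bar>"
      by (subst AE_restrict_space_iff) auto
  qed
  also have "\<dots> = (LINT x|lebesgue. (if x \<in> {\<epsilon>..d} then \<bar>h x\<bar> else 0))"
    by (rule Lebesgue_Measure.integral_restrict_UNIV[symmetric]) simp
  also have "\<dots> \<le> (LINT x|lebesgue. (if x \<in> {0<..<1} then \<bar>h x\<bar> else 0))"
  proof (rule integral_mono)
    show "integrable lebesgue (\<lambda>x. if x \<in> {\<epsilon>..d} then \<bar>h x\<bar> else 0)"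
      using hsub by (subst Lebesgue_Measure.integrable_restrict_UNIV) auto
    show "integrable lebesgue (\<lambda>x. if x \<in> {0<..<1} then \<bar>h x\<bar> else 0)"
      using habs by (subst Lebesgue_Measure.integrable_restrict_UNIV) auto
  qed (use \<epsilon> d in auto)
  also have "\<dots> = M"
    unfolding M_def by (rule Lebesgue_Measure.integral_restrict_UNIV) simp
  finally show False by simp
qed

lemma tail_integral_tendsto:
  fixes k :: "real \<Rightarrow> real"
  assumes k: "integrable L01 k"
  shows "((\<lambda>a. LINT x|lebesgue_on {a..1}. k x) \<longlongrightarrow> (LINT x|L01. k x)) (at_right 0)"
proof -
  \<comment> \<open>Extension by 0 makes k integrable on the closed interval [0,1], where continuity
    of the tail integral up to the end point 0 is available.\<close>
  define k0 where "k0 x = (if x \<in> {0<..<1} then k x else 0)" for x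
  have k0: "integrable L01 k0"
    using k by (rule Bochner_Integration.integrable_cong[THEN iffD1, rotated 2]) (auto simp: k0_def)
  have i0: "integrable (lebesgue_on {0..1}) k0"
    using k0 by (subst integrable_lebesgue_on_support(1)[of "{0<..<1}"]) (auto simp: k0_def)
  have "((\<lambda>a. LINT x|lebesgue_on {a..1}. k0 x) \<longlongrightarrow> (LINT x|lebesgue_on {0..1}. k0 x)) (at 0 within {0..1})"
    using continuous_on_tail_integral[OF i0] by (simp add: continuous_on)
  then have "((\<lambda>a. LINT x|lebesgue_on {a..1}. k0 x) \<longlongrightarrow> (LINT x|lebesgue_on {0..1}. k0 x)) (at_right 0)"
    by (simp add: at_within_Icc_at_right)
  moreover have "(LINT x|lebesgue_on {0..1}. k0 x) = (LINT x|L01. k0 x)"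
    by (rule integrable_lebesgue_on_support(2)) (auto simp: k0_def)
  moreover have "(LINT x|L01. k0 x) = (LINT x|L01. k x)"
    by (intro Bochner_Integration.integral_cong) (auto simp: k0_def)
  moreover have "(LINT x|lebesgue_on {a..1}. k0 x) = (LINT x|lebesgue_on {a..1}. k x)" if "0 < a" for a
  proof (rule integral_cong_AE)
    show "AE x in lebesgue_on {a..1}. k0 x = k x"
      by (rule AE_L01_tail[OF AE_I2 that]) (simp add: k0_def)
    show "k0 \<in> borel_measurable (lebesgue_on {a..1})" "k \<in> borel_measurable (lebesgue_on {a..1})"
      using integrable_L01_tail[OF k0 that] integrable_L01_tail[OF k that] by auto
  qed
  then have "\<forall>\<^sub>F a in at_right 0. (LINT x|lebesgue_on {a..1}. k0 x) = (LINT x|lebesgue_on {a..1}. k x)"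
    by (auto simp: eventually_at_filter)
  ultimately show ?thesis
    by (auto intro: Lim_transform_eventually)
qed

context degenerate_wave
begin

text \<open>For test functions this is the distributional equation combined with
  \<open>form_weak\<close>. Both sides are continuous in v for the energy norm, so density gives the
  rest, and no boundary term ever has to be evaluated.\<close>

lemma op_ip:
  assumes u: "u \<in> energy_space \<alpha> \<mu>" and op: "degenerate_op \<alpha> \<mu> u f" and f: "f \<in> L2_01"
    and v: "v \<in> energy_space \<alpha> \<mu>"
  shows "ip01 f v = - form \<alpha> \<mu> u v"
proof -
  obtain w z where uw: "weak_deriv u w" and wz: "weak_deriv (\<lambda>x. x powr \<alpha> * w x) z"
    and fz: "AE x in L01. z x + \<mu> / x powr (2 - \<alpha>) * u x = f x"
    using op by (auto simp: degenerate_op_def)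
  have test: "ip01 f \<psi> = - form \<alpha> \<mu> u \<psi>" if \<psi>: "\<psi> \<in> test_functions" for \<psi>
  proof -
    have t1: "(\<lambda>x. x powr \<alpha> * deriv \<psi> x) \<in> test_functions" and t2: "(\<lambda>x. x powr (\<alpha> - 2) * \<psi> x) \<in> test_functions"
      using \<psi> by (auto intro: test_powr_mult test_deriv)
    have loc: "locally_integrable u" "locally_integrable z"
      using uw wz by (simp_all add: weak_deriv_def)
    have ints: "integrable L01 (\<lambda>x. z x * \<psi> x)" "integrable L01 (\<lambda>x. u x * (x powr (\<alpha> - 2) * \<psi> x))"
      by (intro test_mult_integral loc \<psi> t2)+
    have "ip01 f \<psi> = (LINT x|L01. z x * \<psi> x + \<mu> * (u x * (x powr (\<alpha> - 2) * \<psi> x)))"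
      unfolding L2_ip_def
    proof (rule integral_cong_AE)
      have "AE x in L01. x \<in> {0<..<1}" by (rule AE_I2) simp
      with fz show "AE x in L01. f x * \<psi> x = z x * \<psi> x + \<mu> * (u x * (x powr (\<alpha> - 2) * \<psi> x))"
      proof eventually_elim
        case (elim x)
        then show ?case
          unfolding elim(1)[symmetric] mu_div_powr by (simp add: algebra_simps)
      qed
      show "(\<lambda>x. f x * \<psi> x) \<in> borel_measurable L01"
        using square_integrable_mult[OF f test_square_integrable[OF \<psi>]] by auto
      show "(\<lambda>x. z x * \<psi> x + \<mu> * (u x * (x powr (\<alpha> - 2) * \<psi> x))) \<in> borel_measurable L01"
        using ints by (intro borel_measurable_integrable) simp
    qed
    also have "\<dots> = (LINT x|L01. z x * \<psi> x) + \<mu> * (LINT x|L01. u x * (x powr (\<alpha> - 2) * \<psi> x))"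
      using ints by simp
    also have "(LINT x|L01. z x * \<psi> x) = - (LINT x|L01. w x * (x powr \<alpha> * deriv \<psi> x))"
      using wz \<psi> by (simp add: weak_deriv_def mult_ac)
    \<comment> \<open>The w supplied by \<open>op\<close> and the chosen \<open>wd u\<close> are
      weak derivatives of the same u, hence pair alike with test functions.\<close>
    also have "(LINT x|L01. w x * (x powr \<alpha> * deriv \<psi> x)) = (LINT x|L01. wd u x * (x powr \<alpha> * deriv \<psi> x))"
      using weak_derivD[OF uw t1] weak_derivD[OF energyD(2)[OF u] t1] by simp
    finally have "ip01 f \<psi> = - (ip01 (gd u) (Gt \<psi>) + ip01 (R u) (R \<psi>))"
      using form_weak[OF energyD(2)[OF u] \<psi>] by simp
    also have "ip01 (gd u) (Gt \<psi>) = ip01 (gd u) (gd \<psi>)"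
    proof (rule L2_ip_cong_AE)
      show "AE x in L01. Gt \<psi> x = gd \<psi> x"
        using gd_test[OF \<psi>] by eventually_elim simp
    qed (use energyD[OF u] energyD[OF test_in_energy[OF \<psi>]] G_test[OF \<psi>] in \<open>auto intro: square_integrable_measurable\<close>)
    finally show ?thesis
      by (simp add: form_eq u test_in_energy \<psi>)
  qed
  obtain \<phi> where ap: "approximates \<alpha> \<mu> \<phi> v" using v by (auto simp: energy_space_def)
  have \<phi>: "\<phi> n \<in> test_functions" for n using ap by (simp add: approximates_def)
  have "(\<lambda>n. ip01 f (\<phi> n)) \<longlonglongrightarrow> ip01 f v"
    using ap by (intro L2.ip_tendsto f test_square_integrable \<phi> energyD[OF v]) (simp_all add: approximates_iff)
  moreover have "(\<lambda>n. ip01 f (\<phi> n)) \<longlonglongrightarrow> - form \<alpha> \<mu> u v"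
    unfolding test[OF \<phi>] by (intro tendsto_minus EN.ip_tendsto u test_in_energy \<phi> v approximates_EN[OF ap]) simp
  ultimately show ?thesis by (rule LIMSEQ_unique)
qed

text \<open>
  Rellich's identity. In terms of \<open>W = x\<^bsup>(\<alpha>-1)/2\<^esup> u\<close> the function \<open>H\<close> below is
  \<open>((x W\<^sub>x)\<^sup>2 - \<nu> W\<^sup>2) / 2\<close>. Its derivative and \<open>H / x\<close> are integrable, so that \<open>H\<close> vanishes at \<open>0\<close>
  and no boundary term survives there.
\<close>

lemma trace_identity:
  assumes u: "u \<in> energy_space \<alpha> \<mu>" and op: "degenerate_op \<alpha> \<mu> u f" and f: "f \<in> L2_01"
  shows "ip01 f (P (gd u)) = 1 / 2 * (normal_trace u)\<^sup>2"
proof -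
  note sq = energyD[OF u]
  obtain w F where uw: "weak_deriv u w" and F: "\<And>a. 0 < a \<Longrightarrow> primitive a F w" and uF: "AE x in L01. u x = F x" and F1: "F 1 = 0"
    using energy_primitive[OF u] by blast
  obtain w' z where uw': "weak_deriv u w'" and wz: "weak_deriv (\<lambda>x. x powr \<alpha> * w' x) z"
    and fz: "AE x in L01. z x + \<mu> / x powr (2 - \<alpha>) * u x = f x"
    using op by (auto simp: degenerate_op_def)
  \<comment> \<open>The derivative of the flux x^\<alpha> u_x, read off from the equation. While z
    is only known to be locally integrable in (0,1), this form is integrable up to 1, so the flux is
    absolutely continuous there.\<close>
  define z1 where "z1 x = f x - u x * (\<mu> * x powr (\<alpha> - 2))" for x
  have z1_int: "integrable (lebesgue_on {a..1}) z1" if "0 < a" for a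
    unfolding z1_def using that f sq(1)
    by (intro Bochner_Integration.integrable_diff integrable_mult_continuous integrable_L01_tail
        square_integrable_integrable continuous_intros) auto
  have loc_u: "locally_integrable u" and loc_w: "locally_integrable w"
    using uw by (simp_all add: weak_deriv_def)
  have loc_f: "locally_integrable f"
    using f by (simp add: integrable_imp_locally_integrable square_integrable_integrable)
  have loc_z1: "locally_integrable z1"
    unfolding z1_def
    by (intro locally_integrable_diff locally_integrable_mult_continuous loc_u loc_f continuous_intros) auto
  have loc_aw: "locally_integrable (\<lambda>x. x powr \<alpha> * w x)"
  proof -
    have "continuous_on {0<..} (\<lambda>x::real. x powr \<alpha>)" by (intro continuous_intros) auto
    from locally_integrable_mult_continuous[OF loc_w this] show ?thesis by (simp add: mult.commute)
  qed
  have "weak_deriv (\<lambda>x. x powr \<alpha> * w x) z1"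
  proof (rule weak_deriv_cong[OF wz _ _ loc_aw loc_z1])
    have "AE x in L01. w' x = w x" by (rule weak_deriv_unique[OF uw' uw]) simp
    then show "AE x in L01. x powr \<alpha> * w' x = x powr \<alpha> * w x"
      by eventually_elim simp
    show "AE x in L01. z x = z1 x"
      using fz by eventually_elim (simp add: z1_def mu_div_powr mult_ac)
  qed
  then obtain Y where Y: "\<And>a. 0 < a \<Longrightarrow> primitive a Y z1" and wY: "AE x in L01. x powr \<alpha> * w x = Y x"
    using weak_deriv_primitive[OF _ z1_int] by blast
  \<comment> \<open>The continuous representative of u_x on (0,1]. Its value at 1 is
    \<open>Y 1\<close>, because the weight x^\<alpha> equals 1 there.\<close>
  define w0 where "w0 x = Y x * x powr (- \<alpha>)" for x
  have cont_Y: "continuous_on {0<..1} Y"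
    unfolding continuous_on_eq_continuous_within
  proof
    fix x :: real assume x: "x \<in> {0<..1}"
    have "continuous_on {x/2..1} Y" using x by (intro primitive_continuous[OF Y]) simp
    then have "continuous (at x within {x/2..1}) Y"
      using x by (simp add: continuous_on_eq_continuous_within)
    moreover have "at x within {x/2..1} = at x within {0<..1}"
      by (rule at_within_nhd[of x "{x/2<..}"]) (use x in auto)
    ultimately show "continuous (at x within {0<..1}) Y" by simp
  qed
  have cont_w0: "continuous_on {0<..1} w0"
    unfolding w0_def by (intro continuous_intros cont_Y) auto
  have pos: "AE x in L01. 0 < x" by (rule AE_I2) simp
  have w0_eq: "AE x in L01. w x = w0 x"
    using wY pos by eventually_elim (simp add: w0_def powr_minus field_simps)
  have loc_w0: "locally_integrable w0"
    by (intro locally_integrable_continuous continuous_on_subset[OF cont_w0]) auto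
  have uw0: "weak_deriv u w0"
    by (rule weak_deriv_cong[OF uw _ w0_eq loc_u loc_w0]) simp
  have trace: "normal_trace u = Y 1"
    unfolding normal_trace_def
  proof (rule the_equality)
    show "\<exists>w. weak_deriv u w \<and> continuous_on {0<..1} w \<and> w 1 = Y 1"
      using uw0 cont_w0 by (intro exI[of _ w0]) (simp add: w0_def)
  next
    fix c assume "\<exists>w. weak_deriv u w \<and> continuous_on {0<..1} w \<and> w 1 = c"
    then obtain v where v: "weak_deriv u v" "continuous_on {0<..1} v" "v 1 = c" by blast
    have "v 1 = w0 1"
      by (rule AE_eq_continuous_at_1[OF v(2) cont_w0 weak_deriv_unique[OF v(1) uw0]]) simp
    then show "c = Y 1" using v(3) by (simp add: w0_def)
  qed
  have gd_AE: "AE x in L01. gd u x = G w0 F x"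
    using gd_eq_AE[OF uw0] uF by eventually_elim (simp add: G_def)
  have R_AE: "AE x in L01. R u x = R F x"
    using uF by eventually_elim (simp add: R_def)
  define k where "k x = f x * P (gd u) x" for x
  have k: "integrable L01 k"
    unfolding k_def by (intro square_integrable_mult f weighted_bounded sq)
  \<comment> \<open>Written in the absolutely continuous flux \<open>Y\<close> and representative
    \<open>F\<close>, so that \<open>primitive_mult\<close> can differentiate it.\<close>
  define H where "H x = 1 / 2 * (x powr (1 - \<alpha>) * (Y x * Y x) + (- (1 - \<alpha>)) * (Y x * F x) + \<mu> * (x powr (\<alpha> - 1) * (F x * F x)))" for x
  have prim: "primitive a H k" if a: "0 < a" for a
  proof -
    have p1: "primitive a (\<lambda>x. x powr (1 - \<alpha>)) (\<lambda>x. (1 - \<alpha>) * x powr (- \<alpha>))"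
      using a by (intro primitive_C1) (auto intro!: derivative_eq_intros continuous_intros)
    have p2: "primitive a (\<lambda>x. x powr (\<alpha> - 1)) (\<lambda>x. (\<alpha> - 1) * x powr (\<alpha> - 2))"
      using a by (intro primitive_C1) (auto intro!: derivative_eq_intros continuous_intros)
    have FF: "primitive a F w0"
    proof (rule primitive_cong_AE[OF F[OF a]])
      show "w0 \<in> borel_measurable (lebesgue_on {a..1})"
        by (rule continuous_imp_measurable_on_sets_lebesgue[OF continuous_on_subset[OF cont_w0]]) (use a in auto)
      show "AE x in lebesgue_on {a..1}. w x = w0 x" by (rule AE_L01_tail[OF w0_eq a])
    qed
    note YY = Y[OF a]
    note all = primitive_scale[where c="1/2", OF primitive_add[OF primitive_add[OF primitive_mult[OF p1 primitive_mult[OF YY YY]]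
        primitive_scale[where c="- (1 - \<alpha>)", OF primitive_mult[OF YY FF]]]
        primitive_scale[where c=\<mu>, OF primitive_mult[OF p2 primitive_mult[OF FF FF]]]]]
    have pH: "primitive a H (\<lambda>x. 1 / 2 * ((1 - \<alpha>) * x powr (- \<alpha>) * (Y x * Y x) + (z1 x * Y x + z1 x * Y x) * x powr (1 - \<alpha>)
        + (- (1 - \<alpha>)) * (z1 x * F x + w0 x * Y x)
        + \<mu> * ((\<alpha> - 1) * x powr (\<alpha> - 2) * (F x * F x) + (w0 x * F x + w0 x * F x) * x powr (\<alpha> - 1))))" (is "primitive a H ?h")
      unfolding H_def by (rule all)
    show ?thesis
    proof (rule primitive_cong_AE[OF pH])
      show "k \<in> borel_measurable (lebesgue_on {a..1})"
        using integrable_L01_tail[OF k a] by auto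
      \<comment> \<open>All terms without f cancel once \<open>z1\<close> is inserted; what remains
        is f times x u_x - (1-\<alpha>)/2 u.\<close>
      have "AE x in L01. ?h x = k x"
        using uF gd_AE pos
      proof eventually_elim
        case (elim x)
        have x: "0 < x" by (rule elim(3))
        obtain q where q: "x powr (\<alpha> / 2) = q" "q > 0" using x by simp
        have m: "x powr (- \<alpha>) = 1 / (q * q)"
          using powr_minus_divide[of x \<alpha>] powr_half(1)[OF x] q by simp
        show ?case
          unfolding k_def elim(2) unfolding G_def w0_def z1_def elim(1) m powr_half[OF x] q(1) using x q(2)
          by (simp add: field_simps)
      qed
      then show "AE x in lebesgue_on {a..1}. ?h x = k x"
        by (rule AE_L01_tail[OF _ a])
    qed
  qed
  \<comment> \<open>The Dirichlet condition \<open>F 1 = 0\<close> leaves only the flux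
    term.\<close>
  have H1: "H 1 = 1 / 2 * (Y 1)\<^sup>2" by (simp add: H_def F1 power2_eq_square)
  have "((\<lambda>a. H 1 - (LINT x|lebesgue_on {a..1}. k x)) \<longlongrightarrow> H 1 - (LINT x|L01. k x)) (at_right 0)"
    by (intro tendsto_intros tail_integral_tendsto k)
  moreover have "\<forall>\<^sub>F a in at_right 0. H 1 - (LINT x|lebesgue_on {a..1}. k x) = H a"
  proof -
    have "\<forall>\<^sub>F a in at_right 0. 0 < a \<and> a < (1::real)"
      by (auto simp: eventually_at_right_field intro: exI[of _ 1])
    then show ?thesis
    proof eventually_elim
      case (elim a)
      then show ?case using primitive_eq[OF prim, of a a] by simp
    qed
  qed
  ultimately have limH: "(H \<longlongrightarrow> H 1 - (LINT x|L01. k x)) (at_right 0)"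
    by (rule Lim_transform_eventually)
  have "H 1 - (LINT x|L01. k x) = 0"
  proof (rule limit_zero_of_integrable_quotient[OF _ _ limH])
    show "integrable L01 (\<lambda>x. 1 / 2 * (gd u x * gd u x - R u x * R u x))"
      using square_integrable_mult[OF sq(3) sq(3)] square_integrable_mult[OF sq(4) sq(4)] by simp
    show "AE x in L01. H x = x * (1 / 2 * (gd u x * gd u x - R u x * R u x))"
      using gd_AE R_AE pos
    proof eventually_elim
      case (elim x)
      have x: "0 < x" by (rule elim(3))
      obtain q where q: "x powr (\<alpha> / 2) = q" "q > 0" using x by simp
      have m: "x powr (- \<alpha>) = 1 / (q * q)"
        using powr_minus_divide[of x \<alpha>] powr_half(1)[OF x] q by simp
      have RR: "R F x * R F x = \<nu> * (q / x * F x) * (q / x * F x)"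
      proof -
        have "R F x * R F x = (sqrt \<nu> * sqrt \<nu>) * (q / x * F x) * (q / x * F x)"
          unfolding R_def powr_half(4)[OF x] q(1) by (simp add: mult_ac)
        then show ?thesis using nu_nonneg by simp
      qed
      show ?case
        unfolding elim(1,2) RR unfolding H_def G_def w0_def \<nu>_def m powr_half[OF x] q(1) using x q(2)
        by (simp add: field_simps power2_eq_square)
    qed
  qed
  then show ?thesis
    unfolding trace H1 by (simp add: L2_ip_def k_def)
qed

section \<open>Observability\<close>

definition state_ip :: "state \<Rightarrow> state \<Rightarrow> real" where
  "state_ip x y = form \<alpha> \<mu> (fst x) (fst y) + ip01 (snd x) (snd y)"

lemma state_semi_hilbert: "semi_hilbert (state_space \<alpha> \<mu>) state_ip"
proof -
  have "semi_hilbert (energy_space \<alpha> \<mu>) (form \<alpha> \<mu>)"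
    by unfold_locales (rule EN_complete)
  from semi_hilbert_prod[OF this L2.semi_hilbert_axioms] show ?thesis
    unfolding state_space_def state_ip_def[abs_def] .
qed

sublocale SN: semi_hilbert "state_space \<alpha> \<mu>" state_ip
  by (rule state_semi_hilbert)

lemma state_norm_eq: "state_norm \<alpha> \<mu> = SN.N"
  by (simp add: fun_eq_iff state_norm_def SN.N_def state_ip_def L2_ip_def power2_eq_square)

lemma energy_eq: "energy \<alpha> \<mu> U = 1 / 2 * state_ip U U"
  by (simp add: energy_def state_ip_def L2_ip_def power2_eq_square)

lemma stateD: "x \<in> state_space \<alpha> \<mu> \<Longrightarrow> fst x \<in> energy_space \<alpha> \<mu>"
  "x \<in> state_space \<alpha> \<mu> \<Longrightarrow> snd x \<in> L2_01"
  by (auto simp: state_space_def)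

lemma state_norm_ge:
  assumes "x \<in> state_space \<alpha> \<mu>"
  shows "EN.N (fst x) \<le> SN.N x" "L2.N (snd x) \<le> SN.N x" "EN.N (fst x) * L2.N (snd x) \<le> 1 / 2 * state_ip x x"
proof -
  have "0 \<le> form \<alpha> \<mu> (fst x) (fst x)" "0 \<le> ip01 (snd x) (snd x)"
    using stateD[OF assms] by (auto intro: EN.ip_nonneg L2.ip_nonneg)
  then show "EN.N (fst x) \<le> SN.N x" "L2.N (snd x) \<le> SN.N x"
    by (simp_all add: EN.N_def L2.N_def SN.N_def state_ip_def)
  have "state_ip x x = (EN.N (fst x))\<^sup>2 + (L2.N (snd x))\<^sup>2"
    using stateD[OF assms] by (simp add: state_ip_def EN.N_square L2.N_square)
  then show "EN.N (fst x) * L2.N (snd x) \<le> 1 / 2 * state_ip x x"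
    using sum_squares_bound[of "EN.N (fst x)" "L2.N (snd x)"] by simp
qed

text \<open>\<open>B\<close> is linear only modulo null sets, because \<open>wd\<close> is a choice;
  inside an inner product that suffices.\<close>

lemma B_comb:
  assumes "u \<in> energy_space \<alpha> \<mu>" "v \<in> energy_space \<alpha> \<mu>" and f: "f \<in> L2_01"
  shows "ip01 f (B (a *\<^sub>R u + b *\<^sub>R v)) = a * ip01 f (B u) + b * ip01 f (B v)"
proof -
  have e: "a *\<^sub>R u + b *\<^sub>R v \<in> energy_space \<alpha> \<mu>" using assms by (intro energy_comb)
  note B2 = energy_bounds(1)[OF assms(1)] energy_bounds(1)[OF assms(2)] energy_bounds(1)[OF e]
  have "ip01 f (B (a *\<^sub>R u + b *\<^sub>R v)) = ip01 f (a *\<^sub>R B u + b *\<^sub>R B v)"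
  proof (rule L2_ip_cong_AE)
    show "AE x in L01. B (a *\<^sub>R u + b *\<^sub>R v) x = (a *\<^sub>R B u + b *\<^sub>R B v) x"
      using gd_comb[OF assms(1,2), of a b]
    proof eventually_elim
      case (elim x)
      obtain c where c: "(2 - \<alpha>) / 4 = c" by blast
      show ?case
        unfolding B_def elim c by (simp add: scaleR_fun_def algebra_simps)
    qed
  qed (use f B2 in \<open>auto intro: square_integrable_measurable\<close>)
  then show ?thesis
    using f B2 by (simp add: L2.ip_add2 L2.ip_scale2)
qed

text \<open>Conservation of energy and the derivative of \<Phi>, both evaluated at one time. The
  velocity v contributes -(2-\<alpha>)/4 |v|^2 through \<open>energy_bounds\<close>, the operator
  contributes -(2-\<alpha>)/4 times the form beside the trace. The equal coefficients merge into
  \<open>state_ip x x\<close>, which is twice the energy.\<close>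

lemma skew_adjoint:
  assumes wave: "(x, y) \<in> wave_op \<alpha> \<mu>"
  shows "state_ip y x = 0"
    and "ip01 (snd y) (B (fst x)) + ip01 (snd x) (B (fst y))
      = 1 / 2 * (normal_trace (fst x))\<^sup>2 - (2 - \<alpha>) / 4 * state_ip x x"
proof -
  obtain u v \<omega> f where xy: "x = (u, v)" "y = (\<omega>, f)" and u: "u \<in> op_domain \<alpha> \<mu>" and v: "v \<in> energy_space \<alpha> \<mu>"
    and \<omega>: "\<omega> \<in> energy_space \<alpha> \<mu>" and f: "f \<in> L2_01"
    and ae: "AE x in L01. \<omega> x = v x" and op: "degenerate_op \<alpha> \<mu> u f"
    using wave by (auto simp: wave_op_def classical_data_def state_space_def)
  have ue: "u \<in> energy_space \<alpha> \<mu>" using u by (simp add: op_domain_def)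
  note meas = square_integrable_measurable[OF f] square_integrable_measurable[OF energyD(1)[OF v]]
    square_integrable_measurable[OF energyD(1)[OF \<omega>]] square_integrable_measurable[OF energy_bounds(1)[OF \<omega>]]
  have "ip01 f \<omega> = ip01 f v"
    using ae by (intro L2_ip_cong_AE meas) auto
  then show "state_ip y x = 0"
    using op_ip[OF ue op f \<omega>] EN.ip_sym[OF \<omega> ue] by (simp add: state_ip_def xy)
  have "ip01 v (B \<omega>) = ip01 \<omega> (B \<omega>)"
    using ae by (intro L2_ip_cong_AE meas) auto
  also have "\<dots> = - (2 - \<alpha>) / 4 * ip01 \<omega> \<omega>"
    using energy_bounds(2)[OF \<omega>] by (simp add: L2.N_square energyD[OF \<omega>])
  also have "ip01 \<omega> \<omega> = ip01 v v"
    using ae by (intro L2_ip_cong_AE meas) auto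
  finally have 1: "ip01 v (B \<omega>) = - (2 - \<alpha>) / 4 * ip01 v v" .
  have "ip01 f (B u) = ip01 f (P (gd u)) + (2 - \<alpha>) / 4 * ip01 f u"
    unfolding B_eq using f weighted_bounded(1)[OF energyD(3)[OF ue]] energyD(1)[OF ue]
    by (subst L2.ip_add2) (auto simp: L2.ip_scale2)
  then have 2: "ip01 f (B u) = 1 / 2 * (normal_trace u)\<^sup>2 - (2 - \<alpha>) / 4 * form \<alpha> \<mu> u u"
    using trace_identity[OF ue op f] op_ip[OF ue op f ue] by simp
  show "ip01 (snd y) (B (fst x)) + ip01 (snd x) (B (fst y))
      = 1 / 2 * (normal_trace (fst x))\<^sup>2 - (2 - \<alpha>) / 4 * state_ip x x"
    by (simp add: xy 1 2 state_ip_def algebra_simps add_divide_distrib diff_divide_distrib)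
qed

lemma classical_observability:
  assumes S: "C0_semigroup (state_space \<alpha> \<mu>) (state_norm \<alpha> \<mu>) S"
    and gen: "generator (state_space \<alpha> \<mu>) (state_norm \<alpha> \<mu>) S = wave_op \<alpha> \<mu>"
    and x: "x \<in> classical_data \<alpha> \<mu>" and T: "0 \<le> T"
    and trace: "(\<lambda>t. normal_trace (fst (S t x))) \<in> square_integrable {0<..<T}"
  shows "(LINT t|lebesgue_on {0<..<T}. (normal_trace (fst (S t x)))\<^sup>2) \<ge> ((2 - \<alpha>) * T - 4) * energy \<alpha> \<mu> x"
proof -
  interpret semi_hilbert_semigroup "state_space \<alpha> \<mu>" state_ip S
    by unfold_locales (use S in \<open>simp add: state_norm_eq\<close>)
  obtain f where f: "f \<in> L2_01" "degenerate_op \<alpha> \<mu> (fst x) f"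
    using x by (auto simp: classical_data_def op_domain_def)
  define y where "y = (snd x, f)"
  have "(x, y) \<in> wave_op \<alpha> \<mu>"
    using x f by (auto simp: wave_op_def y_def state_space_def classical_data_def)
  then have xy: "(x, y) \<in> generator (state_space \<alpha> \<mu>) SN.N S"
    using gen by (simp add: state_norm_eq)
  \<comment> \<open>The generator is \<open>wave_op\<close>, so invariance of its domain keeps the
    orbit classical.\<close>
  have orbit: "(S t x, S t y) \<in> wave_op \<alpha> \<mu>" if "0 \<le> t" for t
    using generator_orbit[OF that xy] gen by (simp add: state_norm_eq)
  have xV: "x \<in> state_space \<alpha> \<mu>" and yV: "y \<in> state_space \<alpha> \<mu>"
    using xy by (auto simp: generator_def)
  have SV: "S t x \<in> state_space \<alpha> \<mu>" "S t y \<in> state_space \<alpha> \<mu>" if "0 \<le> t" for t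
    using that xV yV by simp_all
  have const: "state_ip (S t x) (S t x) = state_ip x x" if "0 \<le> t" for t
  proof -
    have D: "((\<lambda>s. state_ip (S s x) (S s x)) has_real_derivative 0) (at s within {0..})" if "0 \<le> s" for s
    proof -
      have "((\<lambda>s. state_ip (S s x) (S s x)) has_real_derivative state_ip (S s y) (S s x) + state_ip (S s x) (S s y)) (at s within {0..})"
        using SN.ip_Cauchy_Schwarz
        by (intro bilinear_orbit_derivative[OF _ _ _ _ _ that xy, where K=1])
          (simp_all add: SN.ip_add SN.ip_add2 SN.ip_scale SN.ip_scale2)
      then show ?thesis
        using skew_adjoint(1)[OF orbit[OF that]] SN.ip_sym[OF SV[OF that]] by simp
    qed
    have "\<exists>c. \<forall>s\<in>{0..}. state_ip (S s x) (S s x) = c"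
      by (intro has_field_derivative_zero_constant D) auto
    then have "state_ip (S t x) (S t x) = state_ip (S 0 x) (S 0 x)" using that by auto
    also have "\<dots> = (SN.N (S 0 x))\<^sup>2" by (simp add: SN.N_square SV)
    also have "SN.N (S 0 x) = SN.N x"
      by (intro SN.N_eqI S_zero SV xV) simp
    finally show ?thesis by (simp add: SN.N_square xV)
  qed
  define \<Phi> where "\<Phi> s = ip01 (snd (S s x)) (B (fst (S s x)))" for s
  have D\<Phi>: "(\<Phi> has_real_derivative 1 / 2 * (normal_trace (fst (S t x)))\<^sup>2 - (2 - \<alpha>) / 4 * state_ip x x) (at t within {0..})"
    if t: "0 \<le> t" for t
  proof -
    have "((\<lambda>s. ip01 (snd (S s x)) (B (fst (S s x)))) has_real_derivative
        ip01 (snd (S t y)) (B (fst (S t x))) + ip01 (snd (S t x)) (B (fst (S t y)))) (at t within {0..})"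
    proof (rule bilinear_orbit_derivative[where b="\<lambda>p q. ip01 (snd p) (B (fst q))" and K=1, OF _ _ _ _ _ t xy])
      fix p q r assume V: "p \<in> state_space \<alpha> \<mu>" "q \<in> state_space \<alpha> \<mu>" "r \<in> state_space \<alpha> \<mu>"
      note en = stateD(1)[OF V(1)] stateD(1)[OF V(2)] stateD(1)[OF V(3)]
      note l2 = stateD(2)[OF V(1)] stateD(2)[OF V(2)] stateD(2)[OF V(3)]
      show "ip01 (snd (p + q)) (B (fst r)) = ip01 (snd p) (B (fst r)) + ip01 (snd q) (B (fst r))"
        using l2 energy_bounds(1)[OF en(3)] by (simp add: L2.ip_add)
      show "ip01 (snd r) (B (fst (p + q))) = ip01 (snd r) (B (fst p)) + ip01 (snd r) (B (fst q))"
        using B_comb[OF en(1,2) l2(3), of 1 1] by simp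
    next
      fix c and p r assume V: "p \<in> state_space \<alpha> \<mu>" "r \<in> state_space \<alpha> \<mu>"
      note en = stateD(1)[OF V(1)] stateD(1)[OF V(2)]
      note l2 = stateD(2)[OF V(1)] stateD(2)[OF V(2)]
      show "ip01 (snd (c *\<^sub>R p)) (B (fst r)) = c * ip01 (snd p) (B (fst r))"
        using l2 energy_bounds(1)[OF en(2)] by (simp add: L2.ip_scale)
      show "ip01 (snd r) (B (fst (c *\<^sub>R p))) = c * ip01 (snd r) (B (fst p))"
        using B_comb[OF en(1) en(1) l2(2), of c 0] by simp
    next
      fix p q assume V: "p \<in> state_space \<alpha> \<mu>" "q \<in> state_space \<alpha> \<mu>"
      have "\<bar>ip01 (snd p) (B (fst q))\<bar> \<le> L2.N (snd p) * L2.N (B (fst q))"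
        by (intro L2.ip_Cauchy_Schwarz stateD V energy_bounds)
      also have "\<dots> \<le> SN.N p * SN.N q"
        using energy_bounds(3)[OF stateD(1)[OF V(2)]] state_norm_ge(1)[OF V(2)] state_norm_ge(2)[OF V(1)]
          L2.N_nonneg[OF stateD(2)[OF V(1)]] L2.N_nonneg[OF energy_bounds(1)[OF stateD(1)[OF V(2)]]]
        by (intro mult_mono) auto
      finally show "\<bar>ip01 (snd p) (B (fst q))\<bar> \<le> 1 * SN.N p * SN.N q" by simp
    qed
    then show ?thesis
      unfolding \<Phi>_def[abs_def] skew_adjoint(2)[OF orbit[OF t]] const[OF t] .
  qed
  have \<Phi>_bound: "\<bar>\<Phi> t\<bar> \<le> 1 / 2 * state_ip x x" if "0 \<le> t" for t
  proof -
    have "\<bar>\<Phi> t\<bar> \<le> L2.N (snd (S t x)) * L2.N (B (fst (S t x)))"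
      unfolding \<Phi>_def by (intro L2.ip_Cauchy_Schwarz stateD SV that energy_bounds)
    also have "\<dots> \<le> L2.N (snd (S t x)) * EN.N (fst (S t x))"
      using energy_bounds(3)[OF stateD(1)[OF SV(1)[OF that]]] L2.N_nonneg[OF stateD(2)[OF SV(1)[OF that]]]
      by (intro mult_left_mono)
    also have "\<dots> \<le> 1 / 2 * state_ip x x"
      using state_norm_ge(3)[OF SV(1)[OF that]] const[OF that] by (simp add: mult.commute)
    finally show ?thesis .
  qed
  let ?tr = "\<lambda>t. (normal_trace (fst (S t x)))\<^sup>2"
  have tr: "integrable (lebesgue_on {0<..<T}) ?tr"
    using trace by (simp add: square_integrable_def)
  \<comment> \<open>The trace is not known to depend continuously on t. The gauge integral asks only
    that \<Phi> be differentiable at every t; square integrability of the trace then identifies the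
    value with a Lebesgue integral.\<close>
  have "((\<lambda>t. 1 / 2 * ?tr t - (2 - \<alpha>) / 4 * state_ip x x) has_integral (\<Phi> T - \<Phi> 0)) {0..T}"
  proof (rule fundamental_theorem_of_calculus[OF T])
    fix t assume "t \<in> {0..T}"
    then show "(\<Phi> has_vector_derivative 1 / 2 * ?tr t - (2 - \<alpha>) / 4 * state_ip x x) (at t within {0..T})"
      unfolding has_real_derivative_iff_has_vector_derivative[symmetric]
      by (intro has_field_derivative_subset[OF D\<Phi>]) auto
  qed
  moreover have "((\<lambda>t. 1 / 2 * ?tr t - (2 - \<alpha>) / 4 * state_ip x x) has_integral
      (1 / 2 * (LINT t|lebesgue_on {0<..<T}. ?tr t) - T * ((2 - \<alpha>) / 4 * state_ip x x))) {0..T}"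
  proof (rule has_integral_diff)
    have "(?tr has_integral (LINT t|lebesgue_on {0<..<T}. ?tr t)) {0..T}"
      using has_integral_integral_lebesgue_on[OF tr] by (simp add: has_integral_Icc_iff_Ioo)
    then show "((\<lambda>t. 1 / 2 * ?tr t) has_integral 1 / 2 * (LINT t|lebesgue_on {0<..<T}. ?tr t)) {0..T}"
      by (rule has_integral_mult_right)
    show "((\<lambda>t. (2 - \<alpha>) / 4 * state_ip x x) has_integral T * ((2 - \<alpha>) / 4 * state_ip x x)) {0..T}"
      using has_integral_const_real[of "(2 - \<alpha>) / 4 * state_ip x x" 0 T] T by simp
  qed
  ultimately have "\<Phi> T - \<Phi> 0 = 1 / 2 * (LINT t|lebesgue_on {0<..<T}. ?tr t) - T * ((2 - \<alpha>) / 4 * state_ip x x)"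
    by (rule has_integral_unique)
  \<comment> \<open>The bound by E at both ends costs 2 E, that is \<open>state_ip x x\<close>;
    after doubling it becomes the 4 E of the claim.\<close>
  moreover have "- state_ip x x \<le> \<Phi> T - \<Phi> 0"
    using \<Phi>_bound[OF T] \<Phi>_bound[of 0] by simp
  ultimately show ?thesis
    by (simp add: energy_eq field_simps)
qed

lemma classical_data_state: "x \<in> classical_data \<alpha> \<mu> \<Longrightarrow> x \<in> state_space \<alpha> \<mu>"
  using energyD(1) by (auto simp: classical_data_def state_space_def op_domain_def)

text \<open>\<open>mild_trace\<close> may draw each \<open>W n\<close> from a semigroup of its own,
  so the classical estimate is applied to every one separately. Both sides pass to the limit: the
  energy along the data \<open>D n\<close>, the trace integral by convergence in L^2(0,T).\<close>

lemma observability: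
  assumes T: "T > 4 / (2 - \<alpha>)" and U: "mild_solution \<alpha> \<mu> U\<^sub>0 U" and g: "mild_trace \<alpha> \<mu> T U g"
  shows "(LINT t|lebesgue_on {0<..<T}. (g t)\<^sup>2) \<ge> ((2 - \<alpha>) * T - 4) * energy \<alpha> \<mu> (U 0)"
proof -
  have "0 < T" using T alpha by (meson divide_pos_pos order_less_trans zero_less_numeral diff_gt_0_iff_gt)
  interpret LT: semi_inner "square_integrable {0<..<T}" "L2_ip {0<..<T}"
    by (rule L2_semi_inner)
  obtain D W where D: "\<And>n. D n \<in> classical_data \<alpha> \<mu>" and W: "\<And>n. mild_solution \<alpha> \<mu> (D n) (W n)"
    and trW: "\<And>n. (\<lambda>t. normal_trace (fst (W n t))) \<in> square_integrable {0<..<T}"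
    and limD: "(\<lambda>n. state_norm \<alpha> \<mu> (D n - U 0)) \<longlonglongrightarrow> 0"
    and limW: "(\<lambda>n. LINT t|lebesgue_on {0<..<T}. (normal_trace (fst (W n t)) - g t)\<^sup>2) \<longlonglongrightarrow> 0"
    and g2: "g \<in> square_integrable {0<..<T}"
    using g unfolding mild_trace_def by blast
  let ?tr = "\<lambda>n t. normal_trace (fst (W n t))"
  have obs: "((2 - \<alpha>) * T - 4) * energy \<alpha> \<mu> (D n) \<le> (LINT t|lebesgue_on {0<..<T}. (?tr n t)\<^sup>2)" for n
  proof -
    obtain S where S: "C0_semigroup (state_space \<alpha> \<mu>) (state_norm \<alpha> \<mu>) S"
      "generator (state_space \<alpha> \<mu>) (state_norm \<alpha> \<mu>) S = wave_op \<alpha> \<mu>" and WS: "\<And>t. 0 \<le> t \<Longrightarrow> W n t = S t (D n)"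
      using W[of n] unfolding mild_solution_def by blast
    have "(\<lambda>t. normal_trace (fst (S t (D n)))) \<in> square_integrable {0<..<T}"
    proof -
      have "?tr n \<in> borel_measurable (lebesgue_on {0<..<T}) \<longleftrightarrow> (\<lambda>t. normal_trace (fst (S t (D n)))) \<in> borel_measurable (lebesgue_on {0<..<T})"
        by (intro measurable_cong) (simp add: WS)
      moreover have "integrable (lebesgue_on {0<..<T}) (\<lambda>t. (?tr n t)\<^sup>2) \<longleftrightarrow> integrable (lebesgue_on {0<..<T}) (\<lambda>t. (normal_trace (fst (S t (D n))))\<^sup>2)"
        by (intro Bochner_Integration.integrable_cong) (simp_all add: WS)
      ultimately show ?thesis using trW[of n] by (simp add: square_integrable_def)
    qed
    from classical_observability[OF S D _ this] \<open>0 < T\<close>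
    have "((2 - \<alpha>) * T - 4) * energy \<alpha> \<mu> (D n) \<le> (LINT t|lebesgue_on {0<..<T}. (normal_trace (fst (S t (D n))))\<^sup>2)" by simp
    also have "\<dots> = (LINT t|lebesgue_on {0<..<T}. (?tr n t)\<^sup>2)"
      by (intro Bochner_Integration.integral_cong) (simp_all add: WS)
    finally show ?thesis .
  qed
  have U0: "U 0 \<in> state_space \<alpha> \<mu>"
    using U by (auto simp: mild_solution_def C0_semigroup_def)
  have "(\<lambda>n. SN.N (D n)) \<longlonglongrightarrow> SN.N (U 0)"
    using limD by (intro SN.N_tendsto classical_data_state D U0) (simp add: state_norm_eq)
  then have "(\<lambda>n. 1 / 2 * (SN.N (D n))\<^sup>2) \<longlonglongrightarrow> 1 / 2 * (SN.N (U 0))\<^sup>2"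
    by (intro tendsto_intros)
  then have limE: "(\<lambda>n. energy \<alpha> \<mu> (D n)) \<longlonglongrightarrow> energy \<alpha> \<mu> (U 0)"
    by (simp add: SN.N_square classical_data_state D U0 energy_eq)
  have "(\<lambda>n. LT.N (?tr n - g)) \<longlonglongrightarrow> 0"
    using tendsto_real_sqrt[OF limW] by (simp add: L2_norm_square fun_diff_def)
  then have "(\<lambda>n. LT.N (?tr n)) \<longlonglongrightarrow> LT.N g"
    by (intro LT.N_tendsto trW g2)
  then have "(\<lambda>n. (LT.N (?tr n))\<^sup>2) \<longlonglongrightarrow> (LT.N g)\<^sup>2"
    by (rule tendsto_power)
  then have limT: "(\<lambda>n. LINT t|lebesgue_on {0<..<T}. (?tr n t)\<^sup>2) \<longlonglongrightarrow> (LINT t|lebesgue_on {0<..<T}. (g t)\<^sup>2)"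
    by (simp add: L2_norm_square)
  show ?thesis
    by (rule LIMSEQ_le[OF tendsto_mult[OF tendsto_const limE] limT]) (use obs in blast)
qed

end

theorem corollary4p1:
  fixes \<alpha> \<mu> T :: real
  assumes "0 \<le> \<alpha>" and "\<alpha> < 2" and "\<alpha> \<noteq> 1"
    and "\<mu> \<le> (1 - \<alpha>)\<^sup>2 / 4"
    and "T > 4 / (2 - \<alpha>)"
  shows "\<exists>C>0. \<forall>u\<^sub>0 \<in> energy_space \<alpha> \<mu>. \<forall>u\<^sub>1 \<in> square_integrable {0<..<1}.
           \<forall>U g. mild_solution \<alpha> \<mu> (u\<^sub>0, u\<^sub>1) U \<longrightarrow> mild_trace \<alpha> \<mu> T U g \<longrightarrow>
             (LINT t|lebesgue_on {0<..<T}. (g t)\<^sup>2) \<ge> C * energy \<alpha> \<mu> (U 0)"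
proof (intro exI conjI ballI allI impI)
  interpret degenerate_wave \<alpha> \<mu>
    using assms by unfold_locales
  \<comment> \<open>Fixes the witness for C, which is positive exactly when T > 4 / (2 -
    \<alpha>).\<close>
  show "0 < (2 - \<alpha>) * T - 4"
    using assms by (simp add: pos_divide_less_eq mult.commute)
  fix u\<^sub>0 u\<^sub>1 U g
  assume "mild_solution \<alpha> \<mu> (u\<^sub>0, u\<^sub>1) U" "mild_trace \<alpha> \<mu> T U g"
  with assms show "(LINT t|lebesgue_on {0<..<T}. (g t)\<^sup>2) \<ge> ((2 - \<alpha>) * T - 4) * energy \<alpha> \<mu> (U 0)"
    by (intro observability)
qed

end
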